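(* Let $K$ be a field, $Q$ a connected quiver and $\alpha$ a dimension vector for $Q$. Then rank functions on $Q$ induce constructible functions on the moduli spaces (introduced by Kac) of indecomposable representations of $Q$ of dimension vector $\alpha$.
   Context: $K$ is an arbitrary field. A quiver is a finite directed graph (loops and parallel arrows allowed); all quivers are assumed connected. For an arrow $a$, $ta$ and $ha$ denote its tail and head. A representation $\phi=(V_x,\phi_a)$ of $Q$ assigns a finite-dimensional $K$-vector space $V_x$ to each vertex $x$ and a linear map $\phi_a\colon V_{ta}\to V_{ha}$ to each arrow $a$; with the usual morphisms these form a category $\operatorname{rep}(Q)$. A dimension vector $\alpha$ assigns a nonnegative integer $\alpha(x)$ to each vertex $x$. The representation space is the affine space $\operatorname{rep}(Q,\alpha)=\bigoplus_{a}\operatorname{Hom}_K(K^{\alpha(ta)},K^{\alpha(ha)})$, with the Zariski topology; its points are representations with spaces $K^{\alpha(x)}$. The base change group $\operatorname{GL}(\alpha)=\prod_x \operatorname{GL}_{\alpha(x)}(K)$ acts on it, and orbits correspond bijectively to isomorphism classes of representations of dimension vector $\alpha$. A subset of a variety is constructible if it can be obtained from finitely many subsets, each open or closed, via unions and intersections. A function from a variety to $\mathbb{Z}$ is constructible if its image is finite and each of its level sets is constructible. Moduli of indecomposables (Kac): the set of indecomposable representations in $\operatorname{rep}(Q,\alpha)$ is partitioned, by repeated application of Rosenlicht's theorem, into finitely many $\operatorname{GL}(\alpha)$-stable constructible pieces $U$, each with a geometric quotient, i.e. a surjective regular map $U\to M$ onto a variety $M$ whose fibers are exactly the $\operatorname{GL}(\alpha)$-orbits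 in $U$. The moduli space of indecomposables of dimension vector $\alpha$ is the disjoint union of these varieties $M$, and its points correspond to isomorphism classes of indecomposable representations. Rank functions depend only on the isomorphism class, so they are constant on orbits and give well-defined functions on the moduli space. Global rank function: a representation $\phi$ has a unique largest subrepresentation $\mathcal{E}(\phi)$ in which the map over every arrow is surjective, and a unique largest quotient representation $\mathcal{M}(\phi)$ in which the map over every arrow is injective. The image of the composition $\mathcal{E}(\phi)\hookrightarrow\phi\twoheadrightarrow\mathcal{M}(\phi)$ has an isomorphism over every arrow, so (as $Q$ is connected) its vector spaces at all vertices have a common dimension; this number is $\operatorname{rank}_Q(\phi)$. Rank functions: a morphism of quivers $f\colon Q'\to Q$ sends vertices to vertices and arrows to arrows compatibly with heads and tails. It induces a pullback $f^*\colon\operatorname{rep}(Q)\to\operatorname{rep}(Q')$, $f^*(W_x,\psi_a)=(W_{f(x)},\psi_{f(a)})$, and a pushforward $f_*\colon\operatorname{rep}(Q')\to\operatorname{rep}(Q)$, $f_*(V_x,\phi_a)=\left(\bigoplus_{y\in f^{-1}(x)}V_y,\ \sum_{b\in f^{-1}(a)}\phi_b\right)$, where each $\phi_b$ is extended by zero to the summands $V_y$ with $y\neq tb$. A rank function on $Q$ is any function $\operatorname{rep}(Q)\to\mathbb{Z}_{\ge 0}$ of the form $\phi\mapsto \operatorname{rank}_{Q_m}(F_{m-1}\cdots F_1\phi)$, where $Q=Q_1,Q_2,\dots,Q_m$ is a finite sequence of quivers and each $F_i\colon\operatorname{rep}(Q_i)\to\operatorname{rep}(Q_{i+1})$ is either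 the pushforward along a morphism $Q_i\to Q_{i+1}$ or the pullback along a morphism $Q_{i+1}\to Q_i$.
   Formalization: If K is not algebraically closed, each geometric quotient U→M is also required to give M the quotient topology (a standard clause); without it the claim on K-rational points fails, e.g. over the 2-adic numbers for one vertex with three loops and dimension 1. *)

theory Defs
  imports
    "Jordan_Normal_Form.DL_Rank"
    "Graph_Theory.Digraph_Component"
    "HOL-Analysis.Sum_Topology"
    "HOL-Library.Disjoint_Sets"
    "HOL-Computational_Algebra.Polynomial"
begin

section \<open>Quivers and their representations\<close>

text \<open>Vertices and arrows are labelled by natural numbers, which covers every finite directed
  graph up to isomorphism and lets a chain of different quivers live in one type.\<close>

type_synonym quiver = "(nat, nat) pre_digraph"

definition quiver :: "quiver \<Rightarrow> bool" where
  "quiver Q \<longleftrightarrow> fin_digraph Q \<and> Digraph_Component.connected Q"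

text \<open>The category of finite-dimensional representations is modelled by its skeleton of matrix
  representations: the space at the vertex \<open>x\<close> is \<open>K\<close> to the power \<open>dimv \<phi> x\<close>.\<close>

record 'k rep =
  dimv :: "nat \<Rightarrow> nat"
  mats :: "nat \<Rightarrow> 'k mat"

definition is_rep :: "quiver \<Rightarrow> 'k rep \<Rightarrow> bool" where
  "is_rep Q \<phi> \<longleftrightarrow>
     (\<forall>a\<in>arcs Q. mats \<phi> a \<in> carrier_mat (dimv \<phi> (head Q a)) (dimv \<phi> (tail Q a)))"

definition rep_hom :: "quiver \<Rightarrow> 'k::field rep \<Rightarrow> 'k rep \<Rightarrow> (nat \<Rightarrow> 'k mat) \<Rightarrow> bool" where
  "rep_hom Q \<phi> \<psi> g \<longleftrightarrow>
     (\<forall>x\<in>verts Q. g x \<in> carrier_mat (dimv \<psi> x) (dimv \<phi> x)) \<and>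
     (\<forall>a\<in>arcs Q. g (head Q a) * mats \<phi> a = mats \<psi> a * g (tail Q a))"

definition mat_inj :: "'k::field mat \<Rightarrow> bool" where
  "mat_inj A \<longleftrightarrow> inj_on (\<lambda>v. A *\<^sub>v v) (carrier_vec (dim_col A))"

definition mat_surj :: "'k::field mat \<Rightarrow> bool" where
  "mat_surj A \<longleftrightarrow> (\<lambda>v. A *\<^sub>v v) ` carrier_vec (dim_col A) = carrier_vec (dim_row A)"

definition rep_iso :: "quiver \<Rightarrow> 'k::field rep \<Rightarrow> 'k rep \<Rightarrow> bool" where
  "rep_iso Q \<phi> \<psi> \<longleftrightarrow> (\<exists>g. rep_hom Q \<phi> \<psi> g \<and> (\<forall>x\<in>verts Q. mat_inj (g x) \<and> mat_surj (g x)))"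

definition zero_rep :: "quiver \<Rightarrow> 'k rep \<Rightarrow> bool" where
  "zero_rep Q \<phi> \<longleftrightarrow> (\<forall>x\<in>verts Q. dimv \<phi> x = 0)"

definition rep_sum :: "quiver \<Rightarrow> 'k::field rep \<Rightarrow> 'k rep \<Rightarrow> 'k rep" where
  "rep_sum Q \<phi> \<psi> = \<lparr> dimv = (\<lambda>x. dimv \<phi> x + dimv \<psi> x),
     mats = (\<lambda>a. four_block_mat
       (mats \<phi> a) (0\<^sub>m (dimv \<phi> (head Q a)) (dimv \<psi> (tail Q a)))
       (0\<^sub>m (dimv \<psi> (head Q a)) (dimv \<phi> (tail Q a))) (mats \<psi> a)) \<rparr>"

definition indecomposable :: "quiver \<Rightarrow> 'k::field rep \<Rightarrow> bool" where
  "indecomposable Q \<phi> \<longleftrightarrow> is_rep Q \<phi> \<and> \<not> zero_rep Q \<phi> \<and>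
     (\<forall>\<psi>1 \<psi>2. is_rep Q \<psi>1 \<and> is_rep Q \<psi>2 \<and> rep_iso Q \<phi> (rep_sum Q \<psi>1 \<psi>2) \<longrightarrow>
        zero_rep Q \<psi>1 \<or> zero_rep Q \<psi>2)"


section \<open>The global rank function\<close>

text \<open>Subrepresentations are given by monomorphisms into \<open>\<phi>\<close>, quotient representations by
  epimorphisms from \<open>\<phi>\<close>; one is contained in (dominated by) another when it factors through it.\<close>

definition surj_sub :: "quiver \<Rightarrow> 'k::field rep \<Rightarrow> 'k rep \<Rightarrow> (nat \<Rightarrow> 'k mat) \<Rightarrow> bool" where
  "surj_sub Q \<phi> \<epsilon> i \<longleftrightarrow> is_rep Q \<epsilon> \<and> rep_hom Q \<epsilon> \<phi> i \<and> (\<forall>x\<in>verts Q. mat_inj (i x)) \<and>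
     (\<forall>a\<in>arcs Q. mat_surj (mats \<epsilon> a))"

definition largest_surj_sub :: "quiver \<Rightarrow> 'k::field rep \<Rightarrow> 'k rep \<Rightarrow> (nat \<Rightarrow> 'k mat) \<Rightarrow> bool" where
  "largest_surj_sub Q \<phi> \<epsilon> i \<longleftrightarrow> surj_sub Q \<phi> \<epsilon> i \<and>
     (\<forall>\<epsilon>' i'. surj_sub Q \<phi> \<epsilon>' i' \<longrightarrow>
        (\<exists>h. rep_hom Q \<epsilon>' \<epsilon> h \<and> (\<forall>x\<in>verts Q. i' x = i x * h x)))"

definition inj_quot :: "quiver \<Rightarrow> 'k::field rep \<Rightarrow> 'k rep \<Rightarrow> (nat \<Rightarrow> 'k mat) \<Rightarrow> bool" where
  "inj_quot Q \<phi> \<mu> p \<longleftrightarrow> is_rep Q \<mu> \<and> rep_hom Q \<phi> \<mu> p \<and> (\<forall>x\<in>verts Q. mat_surj (p x)) \<and>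
     (\<forall>a\<in>arcs Q. mat_inj (mats \<mu> a))"

definition largest_inj_quot :: "quiver \<Rightarrow> 'k::field rep \<Rightarrow> 'k rep \<Rightarrow> (nat \<Rightarrow> 'k mat) \<Rightarrow> bool" where
  "largest_inj_quot Q \<phi> \<mu> p \<longleftrightarrow> inj_quot Q \<phi> \<mu> p \<and>
     (\<forall>\<mu>' p'. inj_quot Q \<phi> \<mu>' p' \<longrightarrow>
        (\<exists>h. rep_hom Q \<mu> \<mu>' h \<and> (\<forall>x\<in>verts Q. p' x = h x * p x)))"

text \<open>The dimension of the image of the composition \<open>\<epsilon> \<rightarrow> \<phi> \<rightarrow> \<mu>\<close>, the same at all vertices.\<close>

definition global_rank :: "quiver \<Rightarrow> 'k::field rep \<Rightarrow> nat" where
  "global_rank Q \<phi> = (THE n. \<exists>\<epsilon> i \<mu> p. largest_surj_sub Q \<phi> \<epsilon> i \<and> largest_inj_quot Q \<phi> \<mu> p \<and>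
     (\<forall>x\<in>verts Q. vec_space.rank (dimv \<mu> x) (p x * i x) = n))"


section \<open>Rank functions\<close>

definition quiver_hom :: "quiver \<Rightarrow> quiver \<Rightarrow> (nat \<Rightarrow> nat) \<Rightarrow> (nat \<Rightarrow> nat) \<Rightarrow> bool" where
  "quiver_hom Q' Q fv fa \<longleftrightarrow>
     (\<forall>x\<in>verts Q'. fv x \<in> verts Q) \<and>
     (\<forall>a\<in>arcs Q'. fa a \<in> arcs Q \<and> tail Q (fa a) = fv (tail Q' a) \<and> head Q (fa a) = fv (head Q' a))"

definition pullback :: "(nat \<Rightarrow> nat) \<Rightarrow> (nat \<Rightarrow> nat) \<Rightarrow> 'k rep \<Rightarrow> 'k rep" where
  "pullback fv fa \<psi> = \<lparr> dimv = (\<lambda>x. dimv \<psi> (fv x)), mats = (\<lambda>a. mats \<psi> (fa a)) \<rparr>"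

text \<open>The direct sum over a fibre is formed in increasing order of the vertices: the coordinates
  of the summand at \<open>y\<close> are those from \<open>block_start Q' fv \<phi> y\<close> to
  \<open>block_start Q' fv \<phi> y + dimv \<phi> y - 1\<close>.\<close>

definition block_start :: "quiver \<Rightarrow> (nat \<Rightarrow> nat) \<Rightarrow> 'k rep \<Rightarrow> nat \<Rightarrow> nat" where
  "block_start Q' fv \<phi> y = (\<Sum>z | z \<in> verts Q' \<and> fv z = fv y \<and> z < y. dimv \<phi> z)"

definition extended_entry ::
    "quiver \<Rightarrow> (nat \<Rightarrow> nat) \<Rightarrow> 'k::field rep \<Rightarrow> nat \<Rightarrow> nat \<times> nat \<Rightarrow> 'k" where
  "extended_entry Q' fv \<phi> b = (\<lambda>(i, j).
     let s = block_start Q' fv \<phi> (head Q' b); t = block_start Q' fv \<phi> (tail Q' b)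
     in if s \<le> i \<and> i < s + dimv \<phi> (head Q' b) \<and> t \<le> j \<and> j < t + dimv \<phi> (tail Q' b)
        then mats \<phi> b $$ (i - s, j - t) else 0)"

definition pushforward ::
    "quiver \<Rightarrow> quiver \<Rightarrow> (nat \<Rightarrow> nat) \<Rightarrow> (nat \<Rightarrow> nat) \<Rightarrow> 'k::field rep \<Rightarrow> 'k rep" where
  "pushforward Q' Q fv fa \<phi> =
     (let d = (\<lambda>x. \<Sum>y | y \<in> verts Q' \<and> fv y = x. dimv \<phi> y)
      in \<lparr> dimv = d,
           mats = (\<lambda>a. mat (d (head Q a)) (d (tail Q a))
             (\<lambda>ij. \<Sum>b | b \<in> arcs Q' \<and> fa b = a. extended_entry Q' fv \<phi> b ij)) \<rparr>)"

inductive rank_function :: "quiver \<Rightarrow> ('k::field rep \<Rightarrow> nat) \<Rightarrow> bool" where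
  global: "quiver Q \<Longrightarrow> rank_function Q (global_rank Q)"
| pull: "quiver Q \<Longrightarrow> quiver_hom Q' Q fv fa \<Longrightarrow> rank_function Q' r \<Longrightarrow>
    rank_function Q (\<lambda>\<phi>. r (pullback fv fa \<phi>))"
| push: "quiver Q \<Longrightarrow> quiver_hom Q Q' fv fa \<Longrightarrow> rank_function Q' r \<Longrightarrow>
    rank_function Q (\<lambda>\<phi>. r (pushforward Q Q' fv fa \<phi>))"


section \<open>Zariski topology, constructible sets and functions\<close>

text \<open>The polynomial functions in a set \<open>C\<close> of coordinate functions.\<close>

inductive_set polyfun :: "('p \<Rightarrow> 'k::comm_ring_1) set \<Rightarrow> ('p \<Rightarrow> 'k) set"
  for C :: "('p \<Rightarrow> 'k) set" where
  const: "(\<lambda>_. c) \<in> polyfun C"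
| coord: "f \<in> C \<Longrightarrow> f \<in> polyfun C"
| add: "f \<in> polyfun C \<Longrightarrow> g \<in> polyfun C \<Longrightarrow> (\<lambda>x. f x + g x) \<in> polyfun C"
| mult: "f \<in> polyfun C \<Longrightarrow> g \<in> polyfun C \<Longrightarrow> (\<lambda>x. f x * g x) \<in> polyfun C"

definition zariski_open :: "'p set \<Rightarrow> ('p \<Rightarrow> 'k::field) set \<Rightarrow> 'p set \<Rightarrow> bool" where
  "zariski_open X C V \<longleftrightarrow> V \<subseteq> X \<and> (\<exists>P \<subseteq> polyfun C. X - V = {x\<in>X. \<forall>p\<in>P. p x = 0})"

definition zariski :: "'p set \<Rightarrow> ('p \<Rightarrow> 'k::field) set \<Rightarrow> 'p topology" where
  "zariski X C = topology (zariski_open X C)"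

lemma zariski_open_alt:
  "zariski_open X C V \<longleftrightarrow> (\<exists>P \<subseteq> polyfun C. V = {x\<in>X. \<exists>p\<in>P. p x \<noteq> 0})"
  unfolding zariski_open_def
proof safe
  fix P assume "V \<subseteq> X" "P \<subseteq> polyfun C" and eq: "X - V = {x\<in>X. \<forall>p\<in>P. p x = 0}"
  have "V = X - (X - V)" using \<open>V \<subseteq> X\<close> by blast
  then have "V = {x\<in>X. \<exists>p\<in>P. p x \<noteq> 0}" unfolding eq by blast
  then show "\<exists>P \<subseteq> polyfun C. V = {x\<in>X. \<exists>p\<in>P. p x \<noteq> 0}" using \<open>P \<subseteq> polyfun C\<close> by blast
next
  fix P assume P: "P \<subseteq> polyfun C"
  show "\<exists>P'\<subseteq>polyfun C. X - {x\<in>X. \<exists>p\<in>P. p x \<noteq> 0} = {x\<in>X. \<forall>p\<in>P'. p x = 0}"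
    by (rule exI[of _ P]) (use P in blast)
qed

lemma istopology_zariski_open: "istopology (zariski_open X C)"
  unfolding istopology_def
proof (intro conjI allI impI)
  fix S T assume "zariski_open X C S" "zariski_open X C T"
  then obtain P P' where P: "P \<subseteq> polyfun C" "S = {x\<in>X. \<exists>p\<in>P. p x \<noteq> 0}"
    and P': "P' \<subseteq> polyfun C" "T = {x\<in>X. \<exists>p\<in>P'. p x \<noteq> 0}"
    unfolding zariski_open_alt by blast
  let ?R = "{(\<lambda>x. p x * q x) | p q. p \<in> P \<and> q \<in> P'}"
  have "?R \<subseteq> polyfun C" using P(1) P'(1) by (auto intro: polyfun.mult)
  moreover have "S \<inter> T = {x\<in>X. \<exists>p\<in>?R. p x \<noteq> 0}"
    unfolding P(2) P'(2) by fastforce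
  ultimately show "zariski_open X C (S \<inter> T)" unfolding zariski_open_alt by blast
next
  fix \<K> assume op: "\<forall>K\<in>\<K>. zariski_open X C K"
  let ?P = "{p \<in> polyfun C. \<exists>K\<in>\<K>. \<forall>x\<in>X. p x \<noteq> 0 \<longrightarrow> x \<in> K}"
  have "x \<in> X \<and> (\<exists>p\<in>?P. p x \<noteq> 0)" if "x \<in> K" "K \<in> \<K>" for x K
  proof -
    from op that(2) have "zariski_open X C K" by simp
    then obtain P where P: "P \<subseteq> polyfun C" and K: "K = {x\<in>X. \<exists>p\<in>P. p x \<noteq> 0}"
      unfolding zariski_open_alt by auto
    from that(1) K obtain p where p: "p \<in> P" "p x \<noteq> 0" "x \<in> X" by auto
    have "\<forall>y\<in>X. p y \<noteq> 0 \<longrightarrow> y \<in> K" using K p(1) by auto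
    then have "p \<in> ?P" using P p(1) that(2) by auto
    then show ?thesis using p by auto
  qed
  then have "\<Union>\<K> = {x\<in>X. \<exists>p\<in>?P. p x \<noteq> 0}" by auto
  moreover have "?P \<subseteq> polyfun C" by auto
  ultimately show "zariski_open X C (\<Union>\<K>)"
    unfolding zariski_open_alt by (intro exI[of _ ?P] conjI)
qed

lemma openin_zariski: "openin (zariski X C) V \<longleftrightarrow> zariski_open X C V"
  by (simp add: zariski_def topology_inverse' istopology_zariski_open)

lemma topspace_zariski [simp]: "topspace (zariski X C) = X"
proof -
  have "zariski_open X C X"
    unfolding zariski_open_alt by (rule exI[of _ "{\<lambda>_. 1}"]) (auto intro: polyfun.const)
  then have "openin (zariski X C) X" by (simp add: openin_zariski)
  moreover have "topspace (zariski X C) \<subseteq> X"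
    using openin_topspace[of "zariski X C"] unfolding openin_zariski zariski_open_def by simp
  ultimately show ?thesis by (simp add: openin_subset subset_antisym)
qed

inductive constructible_in :: "'p topology \<Rightarrow> 'p set \<Rightarrow> bool" for T :: "'p topology" where
  opn: "openin T S \<Longrightarrow> constructible_in T S"
| cls: "closedin T S \<Longrightarrow> constructible_in T S"
| un: "constructible_in T A \<Longrightarrow> constructible_in T B \<Longrightarrow> constructible_in T (A \<union> B)"
| int: "constructible_in T A \<Longrightarrow> constructible_in T B \<Longrightarrow> constructible_in T (A \<inter> B)"

definition constructible_function :: "'p topology \<Rightarrow> ('p \<Rightarrow> int) \<Rightarrow> bool" where
  "constructible_function T f \<longleftrightarrow> finite (f ` topspace T) \<and>
     (\<forall>n. constructible_in T {x \<in> topspace T. f x = n})"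


section \<open>Varieties and regular maps\<close>

text \<open>Varieties are spaces with functions in the sense of Serre: a topological space with a sheaf
  of \<open>K\<close>-valued functions, finitely covered by open subspaces isomorphic to Zariski closed
  subsets of affine spaces, and separated. \<open>regular M V f\<close> says that the restriction of \<open>f\<close> to the
  open set \<open>V\<close> is a section of the sheaf; points are \<open>K\<close>-rational points.\<close>

record ('m, 'k) fspace =
  space_top :: "'m topology"
  regular :: "'m set \<Rightarrow> ('m \<Rightarrow> 'k) \<Rightarrow> bool"

definition sheaf_of_functions :: "('m, 'k) fspace \<Rightarrow> bool" where
  "sheaf_of_functions M \<longleftrightarrow>
     (\<forall>V f g. openin (space_top M) V \<and> regular M V f \<and> (\<forall>x\<in>V. f x = g x) \<longrightarrow> regular M V g) \<and>
     (\<forall>V W f. openin (space_top M) V \<and> openin (space_top M) W \<and> W \<subseteq> V \<and> regular M V f \<longrightarrow>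
        regular M W f) \<and>
     (\<forall>V f. openin (space_top M) V \<and>
        (\<forall>x\<in>V. \<exists>W. openin (space_top M) W \<and> x \<in> W \<and> W \<subseteq> V \<and> regular M W f) \<longrightarrow>
        regular M V f)"

definition regular_map :: "('m, 'k) fspace \<Rightarrow> ('n, 'k) fspace \<Rightarrow> ('m \<Rightarrow> 'n) \<Rightarrow> bool" where
  "regular_map A B h \<longleftrightarrow> continuous_map (space_top A) (space_top B) h \<and>
     (\<forall>V f. openin (space_top B) V \<and> regular B V f \<longrightarrow>
        regular A {x \<in> topspace (space_top A). h x \<in> V} (\<lambda>x. f (h x)))"

definition fspace_iso :: "('m, 'k) fspace \<Rightarrow> ('n, 'k) fspace \<Rightarrow> ('m \<Rightarrow> 'n) \<Rightarrow> bool" where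
  "fspace_iso A B h \<longleftrightarrow> regular_map A B h \<and>
     (\<exists>k. regular_map B A k \<and> (\<forall>x \<in> topspace (space_top A). k (h x) = x) \<and>
        (\<forall>y \<in> topspace (space_top B). h (k y) = y))"

definition restrict_fspace :: "('m, 'k) fspace \<Rightarrow> 'm set \<Rightarrow> ('m, 'k) fspace" where
  "restrict_fspace M V = \<lparr> space_top = subtopology (space_top M) V, regular = regular M \<rparr>"

text \<open>A subset \<open>X\<close> of an affine space with coordinates \<open>C\<close>: the Zariski topology of \<open>X\<close> is the
  subspace topology, and regular functions are locally quotients of polynomials.\<close>

definition zariski_fspace :: "'p set \<Rightarrow> ('p \<Rightarrow> 'k::field) set \<Rightarrow> ('p, 'k) fspace" where
  "zariski_fspace X C = \<lparr> space_top = zariski X C,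
     regular = (\<lambda>V f. \<forall>x\<in>V. \<exists>W p q. openin (zariski X C) W \<and> x \<in> W \<and> W \<subseteq> V \<and>
       p \<in> polyfun C \<and> q \<in> polyfun C \<and> (\<forall>y\<in>W. q y \<noteq> 0 \<and> f y = p y / q y)) \<rparr>"

definition vec_coords :: "nat \<Rightarrow> ('k vec \<Rightarrow> 'k) set" where
  "vec_coords n = (\<lambda>i v. v $ i) ` {..<n}"

definition affine_chart :: "('m, 'k::field) fspace \<Rightarrow> 'm set \<times> nat \<times> ('m \<Rightarrow> 'k vec) \<Rightarrow> bool" where
  "affine_chart M = (\<lambda>(V, n, h). openin (space_top M) V \<and>
     (\<exists>Z. closedin (zariski (carrier_vec n) (vec_coords n)) Z \<and>
        fspace_iso (restrict_fspace M V) (zariski_fspace Z (vec_coords n)) h))"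

text \<open>The last clause is separatedness: the diagonal is closed in the product, read in the
  products of the charts.\<close>

definition variety :: "('m, 'k::field) fspace \<Rightarrow> bool" where
  "variety M \<longleftrightarrow> sheaf_of_functions M \<and>
     (\<exists>A. finite A \<and> (\<forall>c\<in>A. affine_chart M c) \<and> (\<Union>(V, n, h)\<in>A. V) = topspace (space_top M) \<and>
        (\<forall>(V, n, h)\<in>A. \<forall>(V', n', h')\<in>A.
           closedin (zariski (carrier_vec (n + n')) (vec_coords (n + n')))
             {h x @\<^sub>v h' x | x. x \<in> V \<inter> V'}))"


section \<open>Representation spaces and moduli of indecomposables\<close>

definition rep_space :: "quiver \<Rightarrow> (nat \<Rightarrow> nat) \<Rightarrow> (nat \<Rightarrow> 'k mat) set" where
  "rep_space Q \<alpha> = (\<Pi>\<^sub>E a\<in>arcs Q. carrier_mat (\<alpha> (head Q a)) (\<alpha> (tail Q a)))"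

definition rep_coords :: "quiver \<Rightarrow> (nat \<Rightarrow> nat) \<Rightarrow> ((nat \<Rightarrow> 'k mat) \<Rightarrow> 'k) set" where
  "rep_coords Q \<alpha> =
     {(\<lambda>\<phi>. \<phi> a $$ (i, j)) | a i j. a \<in> arcs Q \<and> i < \<alpha> (head Q a) \<and> j < \<alpha> (tail Q a)}"

definition point_rep :: "(nat \<Rightarrow> nat) \<Rightarrow> (nat \<Rightarrow> 'k mat) \<Rightarrow> 'k rep" where
  "point_rep \<alpha> \<phi> = \<lparr> dimv = \<alpha>, mats = \<phi> \<rparr>"

definition indecomposables :: "quiver \<Rightarrow> (nat \<Rightarrow> nat) \<Rightarrow> (nat \<Rightarrow> 'k::field mat) set" where
  "indecomposables Q \<alpha> = {\<phi> \<in> rep_space Q \<alpha>. indecomposable Q (point_rep \<alpha> \<phi>)}"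

definition GL :: "quiver \<Rightarrow> (nat \<Rightarrow> nat) \<Rightarrow> (nat \<Rightarrow> 'k::field mat) set" where
  "GL Q \<alpha> = (\<Pi>\<^sub>E x\<in>verts Q. Units (ring_mat TYPE('k) (\<alpha> x) ()))"

definition GL_act :: "quiver \<Rightarrow> (nat \<Rightarrow> nat) \<Rightarrow> (nat \<Rightarrow> 'k::field mat) \<Rightarrow>
    (nat \<Rightarrow> 'k mat) \<Rightarrow> nat \<Rightarrow> 'k mat" where
  "GL_act Q \<alpha> g \<phi> = (\<lambda>a\<in>arcs Q. g (head Q a) * \<phi> a *
     inv\<^bsub>ring_mat TYPE('k) (\<alpha> (tail Q a)) ()\<^esub> (g (tail Q a)))"

definition GL_orbit :: "quiver \<Rightarrow> (nat \<Rightarrow> nat) \<Rightarrow> (nat \<Rightarrow> 'k::field mat) \<Rightarrow> (nat \<Rightarrow> 'k mat) set" where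
  "GL_orbit Q \<alpha> \<phi> = (\<lambda>g. GL_act Q \<alpha> g \<phi>) ` GL Q \<alpha>"

text \<open>A geometric quotient: a surjective regular map whose fibres are exactly the orbits. If \<open>K\<close>
  is not algebraically closed, these conditions on rational points are too weak, because they do
  not relate the topologies of \<open>U\<close> and \<open>M\<close>: over the 2-adic numbers the map
  \<open>x\<^sup>3 + 2 y\<^sup>3 + 4 z\<^sup>3\<close> takes the union of the three punctured coordinate axes bijectively to the
  punctured line, but the image of the first axis is the set of nonzero cubes, which is not
  constructible. For such \<open>K\<close> we therefore also ask for the clause of the usual definition of a
  geometric quotient that \<open>M\<close> carries the quotient topology.\<close>

definition geometric_quotient :: "quiver \<Rightarrow> (nat \<Rightarrow> nat) \<Rightarrow> (nat \<Rightarrow> 'k::field mat) set \<Rightarrow>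
    ('m, 'k) fspace \<Rightarrow> ((nat \<Rightarrow> 'k mat) \<Rightarrow> 'm) \<Rightarrow> bool" where
  "geometric_quotient Q \<alpha> U M \<pi> \<longleftrightarrow> variety M \<and>
     regular_map (zariski_fspace U (rep_coords Q \<alpha>)) M \<pi> \<and>
     \<pi> ` U = topspace (space_top M) \<and>
     (\<forall>\<phi>\<in>U. {\<psi>\<in>U. \<pi> \<psi> = \<pi> \<phi>} = GL_orbit Q \<alpha> \<phi>) \<and>
     ((\<forall>f :: 'k poly. degree f > 0 \<longrightarrow> (\<exists>c. poly f c = 0)) \<or>
      quotient_map (zariski U (rep_coords Q \<alpha>)) (space_top M) \<pi>)"

text \<open>The moduli space attached to a finite partition \<open>\<U>\<close> of the indecomposables is the disjoint
  union of the varieties \<open>M U\<close> for \<open>U \<in> \<U>\<close>; its points are the pairs \<open>(U, m)\<close> with \<open>m\<close> a point of \<open>M U\<close>.\<close>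

definition indecomposable_moduli :: "quiver \<Rightarrow> (nat \<Rightarrow> nat) \<Rightarrow> (nat \<Rightarrow> 'k::field mat) set set \<Rightarrow>
    ((nat \<Rightarrow> 'k mat) set \<Rightarrow> ('m, 'k) fspace) \<Rightarrow>
    ((nat \<Rightarrow> 'k mat) set \<Rightarrow> (nat \<Rightarrow> 'k mat) \<Rightarrow> 'm) \<Rightarrow> bool" where
  "indecomposable_moduli Q \<alpha> \<U> M \<pi> \<longleftrightarrow> finite \<U> \<and> partition_on (indecomposables Q \<alpha>) \<U> \<and>
     (\<forall>U\<in>\<U>. constructible_in (zariski (rep_space Q \<alpha>) (rep_coords Q \<alpha>)) U \<and>
        (\<forall>\<phi>\<in>U. GL_orbit Q \<alpha> \<phi> \<subseteq> U) \<and>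
        geometric_quotient Q \<alpha> U (M U) (\<pi> U))"

definition moduli_topology :: "'u set \<Rightarrow> ('u \<Rightarrow> ('m, 'k) fspace) \<Rightarrow> ('u \<times> 'm) topology" where
  "moduli_topology \<U> M = sum_topology (\<lambda>U. space_top (M U)) \<U>"

definition induced_on_moduli :: "(nat \<Rightarrow> nat) \<Rightarrow> (nat \<Rightarrow> 'k mat) set set \<Rightarrow>
    ((nat \<Rightarrow> 'k mat) set \<Rightarrow> (nat \<Rightarrow> 'k mat) \<Rightarrow> 'm) \<Rightarrow> ('k rep \<Rightarrow> nat) \<Rightarrow>
    ((nat \<Rightarrow> 'k mat) set \<times> 'm \<Rightarrow> int) \<Rightarrow> bool" where
  "induced_on_moduli \<alpha> \<U> \<pi> r \<rho> \<longleftrightarrow>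
     (\<forall>U\<in>\<U>. \<forall>\<phi>\<in>U. \<rho> (U, \<pi> U \<phi>) = int (r (point_rep \<alpha> \<phi>)))"

end

theory Submission
  imports Defs
begin

text \<open>A subspace of \<open>K\<close> to the power \<open>n\<close> that is cut out by linear conditions with polynomial
  coefficients, existential quantifiers over further vectors being allowed, has a constructible
  dimension: Gaussian elimination with case distinctions on the pivots removes the quantifiers. The
  image of the largest surjective subrepresentation and the kernel of the map to the largest
  injective quotient are of this kind, since they arise by iterating intersections, sums, images
  and preimages a bounded number of times. So the global rank is constructible on polynomial
  families of representations; pullbacks and pushforwards of polynomial families are again
  polynomial, hence every rank function is constructible on the representation space, and it is
  constant on orbits. If \<open>K\<close> is algebraically closed, Chevalley's theorem transports the level sets
  to the quotient. Otherwise the quotient topology does: the group acts by homeomorphisms, so an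
  orbit-stable constructible set contains a nonempty orbit-stable subset that is open in its
  closure, and noetherian induction applies.\<close>

section \<open>Polynomial functions and Boolean combinations of their zero sets\<close>

text \<open>The part on the representation space works over every field, because quantifiers are
  only eliminated over variables that enter linearly; the parameters may enter through arbitrary
  polynomials. To stay in this linear setting, dimensions are counted by leading positions: that a
  position occurs in a definable subspace is again a linear existential statement, and for nested
  subspaces the positions gained count the relative dimension. So no basis has to vary with the
  parameter. The number of rounds in the iterations is the total dimension, since a round that
  changes anything changes the sum of the dimensions. Polynomials are functions here, so different
  formal polynomials may coincide over a finite field, and a degree is the least length of an
  expansion. Hilbert's basis theorem is needed because closed sets may be cut out by infinitely many
  equations, while elimination handles finitely many; it also yields finite subcovers for local
  quotients and the well-foundedness behind the noetherian induction.\<close>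

lemma polyfun_sum:
  assumes "\<And>i. i \<in> I \<Longrightarrow> f i \<in> polyfun C"
  shows "(\<lambda>x. \<Sum>i\<in>I. f i x) \<in> polyfun C"
proof (cases "finite I")
  case True
  then show ?thesis using assms
    by (induction I) (auto intro: polyfun.const polyfun.add)
qed (simp add: polyfun.const)

lemma polyfun_uminus: "f \<in> polyfun C \<Longrightarrow> (\<lambda>x. - f x) \<in> polyfun C"
  using polyfun.mult[OF polyfun.const[of "- 1" C]] by simp

lemma polyfun_diff: "f \<in> polyfun C \<Longrightarrow> g \<in> polyfun C \<Longrightarrow> (\<lambda>x. f x - g x) \<in> polyfun C"
  using polyfun.add[OF _ polyfun_uminus] by fastforce

lemma polyfun_mono: "C \<subseteq> D \<Longrightarrow> f \<in> polyfun C \<Longrightarrow> f \<in> polyfun D"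
  by (rule polyfun.induct[of f C]) (auto intro: polyfun.intros)

text \<open>Testing the coordinates of the target is enough, since sums and products pull back
  termwise. Agreement is required on \<open>X\<close> only: outside \<open>X\<close>, matrix entries
  may lie out of range.\<close>

definition polynomial_map :: "'p set \<Rightarrow> ('p \<Rightarrow> 'k::comm_ring_1) set \<Rightarrow> ('q \<Rightarrow> 'k) set \<Rightarrow> ('p \<Rightarrow> 'q) \<Rightarrow> bool" where
  "polynomial_map X C D h \<longleftrightarrow> (\<forall>c\<in>D. \<exists>f\<in>polyfun C. \<forall>x\<in>X. c (h x) = f x)"

lemma polynomial_map_polyfun:
  assumes "polynomial_map X C D h" "p \<in> polyfun D"
  shows "\<exists>f\<in>polyfun C. \<forall>x\<in>X. p (h x) = f x"
  using assms(2)
proof induction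
  case (const c)
  show ?case by (rule bexI[OF _ polyfun.const[of c]]) simp
next
  case (coord f)
  then show ?case using assms(1) unfolding polynomial_map_def by blast
next
  case (add f g)
  then obtain f' g' where "f' \<in> polyfun C" "\<forall>x\<in>X. f (h x) = f' x"
    "g' \<in> polyfun C" "\<forall>x\<in>X. g (h x) = g' x" by blast
  then show ?case by (intro bexI[of _ "\<lambda>x. f' x + g' x"]) (auto intro: polyfun.add)
next
  case (mult f g)
  then obtain f' g' where "f' \<in> polyfun C" "\<forall>x\<in>X. f (h x) = f' x"
    "g' \<in> polyfun C" "\<forall>x\<in>X. g (h x) = g' x" by blast
  then show ?case by (intro bexI[of _ "\<lambda>x. f' x * g' x"]) (auto intro: polyfun.mult)
qed

text \<open>Boolean combinations of conditions on single polynomials are what elimination can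
  process; for finitely many coordinates they will turn out to be all constructible sets.
  Complements need no clause of their own, since the generators come in complementary pairs.\<close>

inductive constr :: "'p set \<Rightarrow> ('p \<Rightarrow> 'k::comm_ring_1) set \<Rightarrow> 'p set \<Rightarrow> bool" for X C where
  zero: "p \<in> polyfun C \<Longrightarrow> constr X C {x\<in>X. p x = 0}"
| nonzero: "p \<in> polyfun C \<Longrightarrow> constr X C {x\<in>X. p x \<noteq> 0}"
| un: "constr X C A \<Longrightarrow> constr X C B \<Longrightarrow> constr X C (A \<union> B)"
| int: "constr X C A \<Longrightarrow> constr X C B \<Longrightarrow> constr X C (A \<inter> B)"

lemma constr_subset: "constr X C S \<Longrightarrow> S \<subseteq> X"
  by (induction rule: constr.induct) auto

lemma constr_top: "constr X C X"
  using constr.zero[OF polyfun.const[of 0 C], of X] by simp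

lemma constr_bot: "constr X C {}"
  using constr.nonzero[OF polyfun.const[of 0 C], of X] by simp

lemma constr_compl: "constr X C S \<Longrightarrow> constr X C (X - S)"
proof (induction rule: constr.induct)
  case (zero p)
  have "X - {x \<in> X. p x = 0} = {x \<in> X. p x \<noteq> 0}" by auto
  then show ?case using constr.nonzero[OF zero] by simp
next
  case (nonzero p)
  have "X - {x \<in> X. p x \<noteq> 0} = {x \<in> X. p x = 0}" by auto
  then show ?case using constr.zero[OF nonzero] by simp
next
  case (un A B)
  then show ?case by (simp add: Diff_Un constr.int)
next
  case (int A B)
  then show ?case by (simp add: Diff_Int constr.un)
qed

lemma constr_UN: "finite I \<Longrightarrow> (\<And>i. i \<in> I \<Longrightarrow> constr X C (S i)) \<Longrightarrow> constr X C (\<Union>i\<in>I. S i)"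
  by (induction I rule: finite_induct) (auto intro: constr_bot constr.un)

lemma constr_Ball:
  assumes "finite I" "\<And>i. i \<in> I \<Longrightarrow> constr X C {x\<in>X. P i x}"
  shows "constr X C {x\<in>X. \<forall>i\<in>I. P i x}"
  using assms
proof (induction I rule: finite_induct)
  case empty
  then show ?case by (simp add: constr_top)
next
  case (insert i I)
  have "{x\<in>X. \<forall>j\<in>insert i I. P j x} = {x\<in>X. P i x} \<inter> {x\<in>X. \<forall>i\<in>I. P i x}" by auto
  then show ?case using insert by (simp add: constr.int)
qed

lemma constr_Bex:
  assumes "finite I" "\<And>i. i \<in> I \<Longrightarrow> constr X C {x\<in>X. P i x}"
  shows "constr X C {x\<in>X. \<exists>i\<in>I. P i x}"
proof -
  have "{x\<in>X. \<exists>i\<in>I. P i x} = (\<Union>i\<in>I. {x\<in>X. P i x})" by auto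
  then show ?thesis using constr_UN[OF assms] by simp
qed

lemma constr_conj: "constr X C {x\<in>X. P x} \<Longrightarrow> constr X C {x\<in>X. R x} \<Longrightarrow> constr X C {x\<in>X. P x \<and> R x}"
proof -
  assume "constr X C {x\<in>X. P x}" "constr X C {x\<in>X. R x}"
  moreover have "{x\<in>X. P x \<and> R x} = {x\<in>X. P x} \<inter> {x\<in>X. R x}" by auto
  ultimately show ?thesis using constr.int[of X C "{x\<in>X. P x}" "{x\<in>X. R x}"] by simp
qed

lemma constr_disj: "constr X C {x\<in>X. P x} \<Longrightarrow> constr X C {x\<in>X. R x} \<Longrightarrow> constr X C {x\<in>X. P x \<or> R x}"
proof -
  assume "constr X C {x\<in>X. P x}" "constr X C {x\<in>X. R x}"
  moreover have "{x\<in>X. P x \<or> R x} = {x\<in>X. P x} \<union> {x\<in>X. R x}" by auto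
  ultimately show ?thesis using constr.un[of X C "{x\<in>X. P x}" "{x\<in>X. R x}"] by simp
qed

lemma constr_not: "constr X C {x\<in>X. P x} \<Longrightarrow> constr X C {x\<in>X. \<not> P x}"
proof -
  assume "constr X C {x\<in>X. P x}"
  moreover have "{x\<in>X. \<not> P x} = X - {x\<in>X. P x}" by auto
  ultimately show ?thesis using constr_compl[of X C "{x\<in>X. P x}"] by simp
qed

lemma constr_vimage:
  assumes "constr Y D S" "polynomial_map X C D h" "h \<in> X \<rightarrow> Y"
  shows "constr X C {x\<in>X. h x \<in> S}"
  using assms(1)
proof (induction rule: constr.induct)
  case (zero p)
  obtain f where "f \<in> polyfun C" "\<forall>x\<in>X. p (h x) = f x"
    using polynomial_map_polyfun[OF assms(2) zero] by blast
  then have "{x \<in> X. h x \<in> {y \<in> Y. p y = 0}} = {x\<in>X. f x = 0}" using assms(3) by auto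
  then show ?case using constr.zero[OF \<open>f \<in> polyfun C\<close>, of X] by simp
next
  case (nonzero p)
  obtain f where "f \<in> polyfun C" "\<forall>x\<in>X. p (h x) = f x"
    using polynomial_map_polyfun[OF assms(2) nonzero] by blast
  then have "{x \<in> X. h x \<in> {y \<in> Y. p y \<noteq> 0}} = {x\<in>X. f x \<noteq> 0}" using assms(3) by auto
  then show ?case using constr.nonzero[OF \<open>f \<in> polyfun C\<close>, of X] by simp
next
  case (un A B)
  then show ?case using constr_disj[of X C "\<lambda>x. h x \<in> A" "\<lambda>x. h x \<in> B"] by simp
next
  case (int A B)
  then show ?case using constr_conj[of X C "\<lambda>x. h x \<in> A" "\<lambda>x. h x \<in> B"] by simp
qed

text \<open>Polynomials are functions on the whole type, so passing between \<open>U\<close> and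
  \<open>X\<close> merely cuts the generators by \<open>U\<close>.\<close>

lemma constr_subspace:
  assumes "constr U C S" "constr X C U"
  shows "constr X C S"
  using assms(1)
proof (induction rule: constr.induct)
  case (zero p)
  have "{x \<in> U. p x = 0} = U \<inter> {x\<in>X. p x = 0}" using constr_subset[OF assms(2)] by auto
  then show ?case using assms(2) constr.zero[OF zero] by (simp add: constr.int)
next
  case (nonzero p)
  have "{x \<in> U. p x \<noteq> 0} = U \<inter> {x\<in>X. p x \<noteq> 0}" using constr_subset[OF assms(2)] by auto
  then show ?case using assms(2) constr.nonzero[OF nonzero] by (simp add: constr.int)
qed (auto intro: constr.un constr.int)

lemma constr_restrict:
  assumes "constr X C S" "U \<subseteq> X"
  shows "constr U C (U \<inter> S)"
  using assms(1)
proof (induction rule: constr.induct)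
  case (zero p)
  have "U \<inter> {x \<in> X. p x = 0} = {x\<in>U. p x = 0}" using assms(2) by auto
  then show ?case using constr.zero[OF zero, of U] by simp
next
  case (nonzero p)
  have "U \<inter> {x \<in> X. p x \<noteq> 0} = {x\<in>U. p x \<noteq> 0}" using assms(2) by auto
  then show ?case using constr.nonzero[OF nonzero, of U] by simp
next
  case (un A B)
  then show ?case by (simp add: Int_Un_distrib constr.un)
next
  case (int A B)
  have "U \<inter> (A \<inter> B) = (U \<inter> A) \<inter> (U \<inter> B)" by auto
  then show ?case using constr.int[OF int(3,4)] by simp
qed

section \<open>Constructible sets of a topology, in particular the Zariski topology\<close>

lemma openin_nonzero:
  "p \<in> polyfun C \<Longrightarrow> openin (zariski X C) {x\<in>X. p x \<noteq> 0}"
  unfolding openin_zariski zariski_open_alt by (rule exI[of _ "{p}"]) auto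

lemma closedin_zariski:
  "closedin (zariski X C) Z \<longleftrightarrow> (\<exists>P \<subseteq> polyfun C. Z = {x\<in>X. \<forall>p\<in>P. p x = 0})"
proof -
  have "closedin (zariski X C) Z \<longleftrightarrow> Z \<subseteq> X \<and> (\<exists>P \<subseteq> polyfun C. X - (X - Z) = {x\<in>X. \<forall>p\<in>P. p x = 0})"
    unfolding closedin_def openin_zariski zariski_open_def topspace_zariski by simp
  also have "\<dots> \<longleftrightarrow> Z \<subseteq> X \<and> (\<exists>P \<subseteq> polyfun C. Z = {x\<in>X. \<forall>p\<in>P. p x = 0})"
    by (simp add: double_diff cong: conj_cong)
  also have "\<dots> \<longleftrightarrow> (\<exists>P \<subseteq> polyfun C. Z = {x\<in>X. \<forall>p\<in>P. p x = 0})"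
    by auto
  finally show ?thesis .
qed

lemma constructible_in_compl:
  "constructible_in T S \<Longrightarrow> constructible_in T (topspace T - S)"
proof (induction rule: constructible_in.induct)
  case (opn S)
  then show ?case by (simp add: closedin_diff constructible_in.cls)
next
  case (cls S)
  then show ?case by (simp add: constructible_in.opn openin_diff)
next
  case (un A B)
  then show ?case by (simp add: Diff_Un constructible_in.int)
next
  case (int A B)
  then show ?case by (simp add: Diff_Int constructible_in.un)
qed

lemma constructible_in_subset: "constructible_in T S \<Longrightarrow> S \<subseteq> topspace T"
  by (induction rule: constructible_in.induct) (auto dest: openin_subset closedin_subset)

lemma constructible_in_diff:
  assumes "constructible_in T A" "constructible_in T B"
  shows "constructible_in T (A - B)"
proof -
  have "A - B = A \<inter> (topspace T - B)" using constructible_in_subset[OF assms(1)] by auto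
  then show ?thesis using constructible_in.int[OF assms(1) constructible_in_compl[OF assms(2)]] by simp
qed

lemma constructible_in_UN:
  "finite I \<Longrightarrow> (\<And>i. i \<in> I \<Longrightarrow> constructible_in T (S i)) \<Longrightarrow> constructible_in T (\<Union>i\<in>I. S i)"
  by (induction I rule: finite_induct) (auto intro: constructible_in.opn constructible_in.un)

lemma constructible_in_vimage:
  assumes "constructible_in T S" "continuous_map T' T h"
  shows "constructible_in T' {x\<in>topspace T'. h x \<in> S}"
  using assms(1)
proof (induction rule: constructible_in.induct)
  case (opn S)
  then show ?case using openin_continuous_map_preimage[OF assms(2)] by (blast intro: constructible_in.opn)
next
  case (cls S)
  then show ?case using closedin_continuous_map_preimage[OF assms(2)] by (blast intro: constructible_in.cls)
next
  case (un A B)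
  have "{x \<in> topspace T'. h x \<in> A \<union> B} = {x \<in> topspace T'. h x \<in> A} \<union> {x \<in> topspace T'. h x \<in> B}" by auto
  then show ?case using un by (simp add: constructible_in.un)
next
  case (int A B)
  have "{x \<in> topspace T'. h x \<in> A \<inter> B} = {x \<in> topspace T'. h x \<in> A} \<inter> {x \<in> topspace T'. h x \<in> B}" by auto
  then show ?case using int by (simp add: constructible_in.int)
qed

text \<open>A set closed in the subspace is a closed set of \<open>T\<close> cut by the open set
  \<open>V\<close>; in \<open>T\<close> it is in general only locally closed.\<close>

lemma constructible_in_open_subspace:
  assumes "constructible_in (subtopology T V) S" "openin T V"
  shows "constructible_in T S"
  using assms(1)
proof (induction rule: constructible_in.induct)
  case (opn S)
  then show ?case using assms(2) openin_trans_full constructible_in.opn by blast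
next
  case (cls S)
  then show ?case unfolding closedin_subtopology
    using assms(2) by (auto intro: constructible_in.intros)
qed (auto intro: constructible_in.un constructible_in.int)

lemma constr_imp_constructible_in: "constr X C S \<Longrightarrow> constructible_in (zariski X C) S"
proof (induction rule: constr.induct)
  case (zero p)
  have "closedin (zariski X C) {x\<in>X. p x = 0}"
    unfolding closedin_zariski using zero by (intro exI[of _ "{p}"]) auto
  then show ?case by (rule constructible_in.cls)
qed (auto intro: constructible_in.intros openin_nonzero)

section \<open>Hilbert's basis theorem\<close>

text \<open>The ideal generated by \<open>G\<close>, built by adding one multiple at a time: every
  member visibly uses finitely many generators, and the closure properties follow by
  induction.\<close>

inductive_set idl :: "('p \<Rightarrow> 'k::comm_ring_1) set \<Rightarrow> ('p \<Rightarrow> 'k) set \<Rightarrow> ('p \<Rightarrow> 'k) set" for R G where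
  zero: "(\<lambda>_. 0) \<in> idl R G"
| step: "f \<in> idl R G \<Longrightarrow> r \<in> R \<Longrightarrow> g \<in> G \<Longrightarrow> (\<lambda>x. f x + r x * g x) \<in> idl R G"

text \<open>Stated for arbitrary sets \<open>G\<close> and with the generators taken from
  \<open>G\<close> itself. This is the form that extracts a finite subfamily from given equations,
  or an initial segment from a sequence.\<close>

definition noeth :: "('p \<Rightarrow> 'k::comm_ring_1) set \<Rightarrow> bool" where
  "noeth R \<longleftrightarrow> (\<forall>G\<subseteq>R. \<exists>F\<subseteq>G. finite F \<and> G \<subseteq> idl R F)"

lemma idl_mono: "F \<subseteq> G \<Longrightarrow> idl R F \<subseteq> idl R G"
proof
  fix f assume "f \<in> idl R F" "F \<subseteq> G"
  then show "f \<in> idl R G" by (induction rule: idl.induct) (auto intro: idl.intros)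
qed

lemma idl_finite:
  assumes "f \<in> idl R G"
  shows "\<exists>F\<subseteq>G. finite F \<and> f \<in> idl R F"
  using assms
proof induction
  case zero
  show ?case by (intro exI[of _ "{}"]) (auto intro: idl.zero)
next
  case (step f r g)
  then obtain F where F: "F \<subseteq> G" "finite F" "f \<in> idl R F" by blast
  have "f \<in> idl R (insert g F)" using F(3) idl_mono[of F "insert g F" R] by blast
  then show ?case using F step
    by (intro exI[of _ "insert g F"]) (auto intro: idl.step)
qed

lemma idl_add:
  assumes "f \<in> idl R G" "g \<in> idl R G"
  shows "(\<lambda>x. f x + g x) \<in> idl R G"
  using assms(2)
proof (induction g rule: idl.induct)
  case (step g r h)
  then have "(\<lambda>x. (f x + g x) + r x * h x) \<in> idl R G" by (intro idl.step) auto
  then show ?case by (simp add: add.assoc)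
qed (use assms(1) in simp)

lemma idl_mult:
  assumes "f \<in> idl (polyfun C) G" "r \<in> polyfun C"
  shows "(\<lambda>x. r x * f x) \<in> idl (polyfun C) G"
  using assms(1)
proof induction
  case (step f s g)
  have "(\<lambda>x. r x * f x + (r x * s x) * g x) \<in> idl (polyfun C) G"
    using step assms(2) by (intro idl.step) (auto intro: polyfun.mult)
  then show ?case by (simp add: algebra_simps)
qed (simp add: idl.zero)

lemma idl_own: "g \<in> G \<Longrightarrow> g \<in> idl (polyfun C) G"
  using idl.step[OF idl.zero polyfun.const[of 1 C], of g G] by simp

lemma idl_idl:
  assumes "F \<subseteq> idl (polyfun C) G"
  shows "idl (polyfun C) F \<subseteq> idl (polyfun C) G"
proof
  fix f assume "f \<in> idl (polyfun C) F"
  then show "f \<in> idl (polyfun C) G"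
  proof induction
    case (step f r g)
    then show ?case using assms by (intro idl_add idl_mult) auto
  qed (rule idl.zero)
qed

lemma idl_subset_polyfun: "G \<subseteq> polyfun C \<Longrightarrow> idl (polyfun C) G \<subseteq> polyfun C"
proof
  fix f assume "f \<in> idl (polyfun C) G" "G \<subseteq> polyfun C"
  then show "f \<in> polyfun C"
  proof induction
    case (step f r g)
    then show ?case by (intro polyfun.add polyfun.mult) auto
  qed (rule polyfun.const)
qed

lemma idl_zero_at:
  assumes "f \<in> idl R F" "\<forall>g\<in>F. g x = 0"
  shows "f x = 0"
  using assms by induction auto

text \<open>An expansion of length \<open>n\<close>, that is, of degree below \<open>n\<close> in
  \<open>c\<close>. It is not unique, since \<open>c\<close> may satisfy algebraic relations over
  \<open>polyfun C\<close>, for instance \<open>c ^ q = c\<close> over a field with \<open>q\<close>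
  elements.\<close>

definition poly_expansion :: "('p \<Rightarrow> 'k::comm_ring_1) \<Rightarrow> ('p \<Rightarrow> 'k) set \<Rightarrow> nat \<Rightarrow> (nat \<Rightarrow> 'p \<Rightarrow> 'k) \<Rightarrow> ('p \<Rightarrow> 'k) \<Rightarrow> bool" where
  "poly_expansion c C n a f \<longleftrightarrow> (\<forall>i. a i \<in> polyfun C) \<and> (\<forall>x. f x = (\<Sum>i<n. a i x * c x ^ i))"

lemma poly_expansion_mono:
  assumes "poly_expansion c C n a f" "n \<le> m"
  shows "\<exists>b. poly_expansion c C m b f"
proof -
  let ?b = "\<lambda>i. if i < n then a i else (\<lambda>_. 0)"
  have "(\<Sum>i<m. ?b i x * c x ^ i) = (\<Sum>i<n. a i x * c x ^ i)" for x
    using assms(2) by (intro sum.mono_neutral_cong_right) auto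
  then show ?thesis using assms(1) unfolding poly_expansion_def
    by (intro exI[of _ ?b]) (auto intro: polyfun.const)
qed

lemma poly_expansion_add:
  assumes "poly_expansion c C n a f" "poly_expansion c C n b g"
  shows "poly_expansion c C n (\<lambda>i x. a i x + b i x) (\<lambda>x. f x + g x)"
  using assms unfolding poly_expansion_def
  by (auto intro: polyfun.add simp: sum.distrib distrib_right)

lemma poly_expansion_mult_monom:
  assumes "poly_expansion c C n a f" "r \<in> polyfun C"
  shows "poly_expansion c C (n + k) (\<lambda>i. if i < k then (\<lambda>_. 0) else (\<lambda>x. r x * a (i - k) x)) (\<lambda>x. r x * c x ^ k * f x)"
proof -
  have "(\<Sum>i<n+k. (if i < k then (\<lambda>_. 0) else (\<lambda>x. r x * a (i - k) x)) x * c x ^ i) = r x * c x ^ k * (\<Sum>i<n. a i x * c x ^ i)" (is "?l = _") for x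
  proof -
    have "?l = (\<Sum>i\<in>{k..<n+k}. r x * a (i - k) x * c x ^ i)"
      by (rule sum.mono_neutral_cong_right) auto
    also have "\<dots> = (\<Sum>i<n. r x * a i x * c x ^ (i + k))"
      using sum.shift_bounds_nat_ivl[of "\<lambda>i. r x * a (i - k) x * c x ^ i" 0 k n]
      by (simp add: atLeast0LessThan)
    also have "\<dots> = r x * c x ^ k * (\<Sum>i<n. a i x * c x ^ i)"
      by (simp add: sum_distrib_left power_add mult_ac)
    finally show ?thesis .
  qed
  then show ?thesis using assms unfolding poly_expansion_def
    by (auto intro: polyfun.intros)
qed

lemma poly_expansion_mult:
  assumes "poly_expansion c C m b g" "poly_expansion c C n a f"
  shows "\<exists>m' b'. poly_expansion c C m' b' (\<lambda>x. g x * f x)"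
proof -
  have b: "\<And>i. b i \<in> polyfun C" and g: "g = (\<lambda>x. \<Sum>i<m. b i x * c x ^ i)"
    using assms(1) unfolding poly_expansion_def by auto
  \<comment> \<open>The monomials of \<open>g\<close> are multiplied in one at a time; every partial
    product is padded to the common length \<open>n + m\<close>.\<close>
  have "\<exists>d. poly_expansion c C (n + m) d (\<lambda>x. (\<Sum>i<k. b i x * c x ^ i) * f x)" if "k \<le> m" for k
    using that
  proof (induction k)
    case 0
    have "poly_expansion c C 0 (\<lambda>_ _. 0) (\<lambda>x. 0)" unfolding poly_expansion_def by (auto intro: polyfun.const)
    then show ?case using poly_expansion_mono by fastforce
  next
    case (Suc k)
    then obtain d where d: "poly_expansion c C (n + m) d (\<lambda>x. (\<Sum>i<k. b i x * c x ^ i) * f x)" by auto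
    obtain e where e: "poly_expansion c C (n + m) e (\<lambda>x. b k x * c x ^ k * f x)"
      using poly_expansion_mono[OF poly_expansion_mult_monom[OF assms(2) b], of k "n + m" k] Suc(2) by auto
    show ?case using poly_expansion_add[OF d e] by (auto simp: distrib_right)
  qed
  then show ?thesis unfolding g by blast
qed

lemma polyfun_insert_expansion:
  assumes "f \<in> polyfun (insert c C)"
  shows "\<exists>n a. poly_expansion c C n a f"
  using assms
proof induction
  case (const k)
  show ?case by (intro exI[of _ 1] exI[of _ "\<lambda>_ _. k"]) (simp add: poly_expansion_def polyfun.const)
next
  case (coord f)
  show ?case
  proof (cases "f \<in> C")
    case True
    then show ?thesis by (intro exI[of _ 1] exI[of _ "\<lambda>_. f"]) (simp add: poly_expansion_def polyfun.coord)
  next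
    case False
    then have "f = c" using coord by simp
    then show ?thesis
      by (intro exI[of _ 2] exI[of _ "\<lambda>i _. if i = 1 then 1 else 0"])
        (simp add: poly_expansion_def polyfun.const numeral_2_eq_2)
  qed
next
  case (add f g)
  then obtain n a m b where "poly_expansion c C n a f" "poly_expansion c C m b g" by blast
  then obtain a' b' where "poly_expansion c C (n + m) a' f" "poly_expansion c C (n + m) b' g"
    using poly_expansion_mono by (metis le_add1 le_add2)
  then show ?case using poly_expansion_add by blast
next
  case (mult f g)
  then show ?case using poly_expansion_mult by blast
qed

text \<open>The classical argument: if an ideal is not finitely generated, repeatedly choose an element
  of minimal degree outside the ideal generated by the previous choices; the leading coefficients
  then contradict the ascending chain condition for \<open>polyfun C\<close>.\<close>

lemma noeth_insert:
  assumes "noeth (polyfun C)"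
  shows "noeth (polyfun (insert c C))"
  unfolding noeth_def
proof (intro allI impI, rule ccontr)
  let ?R = "polyfun (insert c C)"
  fix G assume G: "G \<subseteq> ?R" and nf: "\<not> (\<exists>F\<subseteq>G. finite F \<and> G \<subseteq> idl ?R F)"
  define I where "I = idl ?R G"
  have IR: "I \<subseteq> ?R" unfolding I_def using idl_subset_polyfun[OF G] .
  \<comment> \<open>Failure of finite generation by elements of \<open>G\<close> passes to the whole
    ideal, because finitely many elements of \<open>I\<close> involve only finitely many elements of
    \<open>G\<close>.\<close>
  have ex: "\<exists>f. f \<in> I - idl ?R F" if "finite F" "F \<subseteq> I" for F
  proof (rule ccontr)
    assume "\<not> ?thesis"
    then have sub: "I \<subseteq> idl ?R F" by blast
    have "\<forall>f\<in>F. \<exists>H\<subseteq>G. finite H \<and> f \<in> idl ?R H"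
      using that(2) idl_finite unfolding I_def by blast
    then obtain H where H: "\<And>f. f \<in> F \<Longrightarrow> H f \<subseteq> G \<and> finite (H f) \<and> f \<in> idl ?R (H f)" by metis
    let ?H = "\<Union>f\<in>F. H f"
    have "F \<subseteq> idl ?R ?H" using H idl_mono[of _ ?H ?R] by blast
    then have "idl ?R F \<subseteq> idl ?R ?H" by (rule idl_idl)
    moreover have "G \<subseteq> I" unfolding I_def using idl_own by blast
    ultimately have "G \<subseteq> idl ?R ?H" using sub by blast
    moreover have "?H \<subseteq> G" "finite ?H" using H that(1) by auto
    ultimately show False using nf by blast
  qed
  \<comment> \<open>Least length of an expansion: one more than the lowest possible degree, and
    \<open>0\<close> exactly for the zero function.\<close>
  define deg where "deg f = (LEAST n. \<exists>a. poly_expansion c C n a f)" for f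
  have deg: "\<exists>a. poly_expansion c C (deg f) a f" if "f \<in> I" for f
    unfolding deg_def by (rule LeastI_ex, rule polyfun_insert_expansion) (use that IR in auto)
  have deg_le: "deg f \<le> n" if "poly_expansion c C n a f" for f n a
    unfolding deg_def by (rule Least_le, rule exI[of _ a], rule that)
  define nxt where "nxt F = (ARG_MIN deg f. f \<in> I - idl ?R F)" for F
  have nxt: "nxt F \<in> I - idl ?R F" "\<And>f. f \<in> I - idl ?R F \<Longrightarrow> deg (nxt F) \<le> deg f"
    if "finite F" "F \<subseteq> I" for F
  proof -
    note ex[OF that]
    then obtain f where "f \<in> I - idl ?R F" ..
    from arg_min_nat_lemma[of "\<lambda>f. f \<in> I - idl ?R F", OF this, of deg]
    show "nxt F \<in> I - idl ?R F" "\<And>f. f \<in> I - idl ?R F \<Longrightarrow> deg (nxt F) \<le> deg f"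
      unfolding nxt_def by auto
  qed
  define S where "S = rec_nat {} (\<lambda>_ F. insert (nxt F) F)"
  define g where "g k = nxt (S k)" for k
  have S0: "S 0 = {}" and SS: "S (Suc k) = insert (g k) (S k)" for k by (auto simp: S_def g_def)
  have SI: "finite (S k) \<and> S k \<subseteq> I" for k
    by (induction k) (use nxt(1) in \<open>auto simp: S0 SS g_def\<close>)
  have S_eq: "S k = g ` {..<k}" for k
    by (induction k) (auto simp: S0 SS lessThan_Suc)
  have g_nxt: "g k = nxt (g ` {..<k})" for k by (rule g_def[of k, unfolded S_eq])
  have g: "g k \<in> I" "g k \<notin> idl ?R (g ` {..<k})"
    "\<And>f. f \<in> I \<Longrightarrow> f \<notin> idl ?R (g ` {..<k}) \<Longrightarrow> deg (g k) \<le> deg f" for k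
    using nxt[of "g ` {..<k}"] SI[of k] unfolding S_eq g_nxt[symmetric] by auto
  define a where "a k = (SOME a. poly_expansion c C (deg (g k)) a (g k))" for k
  have a: "poly_expansion c C (deg (g k)) (a k) (g k)" for k
    unfolding a_def using deg[OF g(1)] by (rule someI_ex)
  have deg_pos: "deg (g k) > 0" for k
  proof (rule ccontr)
    assume "\<not> ?thesis"
    then have "g k = (\<lambda>_. 0)" using a[of k] unfolding poly_expansion_def by auto
    then show False using g(2)[of k] idl.zero[of ?R] by simp
  qed
  have deg_mono: "deg (g i) \<le> deg (g k)" if "i < k" for i k
  proof -
    have "idl ?R (g ` {..<i}) \<subseteq> idl ?R (g ` {..<k})" using that by (intro idl_mono) auto
    then show ?thesis using g(1,2)[of k] g(3)[of "g k" i] by auto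
  qed
  \<comment> \<open>Lengths exceed degrees by one, so this is the leading coefficient;
    \<open>deg_pos\<close> ensures that the subtraction does not truncate.\<close>
  define lc where "lc k = a k (deg (g k) - 1)" for k
  have "range lc \<subseteq> polyfun C" using a unfolding lc_def poly_expansion_def by auto
  then have "\<exists>F\<subseteq>range lc. finite F \<and> range lc \<subseteq> idl (polyfun C) F"
    using assms unfolding noeth_def by simp
  then obtain F where F: "F \<subseteq> range lc" "finite F" "range lc \<subseteq> idl (polyfun C) F"
    by (elim exE conjE)
  obtain J where J: "finite J" "F = lc ` J"
    using finite_subset_image[OF F(2,1)] by (elim exE conjE)
  \<comment> \<open>Any index beyond \<open>J\<close> will do; inserting \<open>0\<close> covers an
    empty \<open>J\<close>.\<close>
  define n where "n = Suc (Max (insert 0 J))"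
  have Jn: "J \<subseteq> {..<n}" unfolding n_def using J(1) by (auto simp: less_Suc_eq_le)
  have "lc n \<in> idl (polyfun C) (lc ` {..<n})"
  proof -
    have "F \<subseteq> lc ` {..<n}" using J(2) Jn by auto
    then have "idl (polyfun C) F \<subseteq> idl (polyfun C) (lc ` {..<n})" by (rule idl_mono)
    then show ?thesis using F(3) by auto
  qed
  \<comment> \<open>A combination of leading coefficients lifts to a combination of the
    \<open>g i\<close>: a power of \<open>c\<close> first raises each \<open>g i\<close> to the
    length of \<open>g n\<close>, which is possible by \<open>deg_mono\<close>.\<close>
  moreover have "\<exists>h e. h \<in> idl ?R (g ` {..<n}) \<and> poly_expansion c C (deg (g n)) e h \<and> e (deg (g n) - 1) = l"
    if "l \<in> idl (polyfun C) (lc ` {..<n})" for l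
    using that
  proof induction
    case zero
    show ?case by (rule exI[of _ "\<lambda>_. 0"], rule exI[of _ "\<lambda>_ _. 0"])
        (auto intro: idl.zero polyfun.const simp: poly_expansion_def)
  next
    case (step l r m)
    then obtain h e where h: "h \<in> idl ?R (g ` {..<n})" "poly_expansion c C (deg (g n)) e h"
      "e (deg (g n) - 1) = l" by blast
    obtain i where i: "i < n" "m = lc i" using step(3) by auto
    let ?k = "deg (g n) - deg (g i)"
    let ?e = "\<lambda>j. if j < ?k then (\<lambda>_. 0) else (\<lambda>x. r x * a i (j - ?k) x)"
    have k: "deg (g i) + ?k = deg (g n)" using deg_mono[OF i(1)] by simp
    have e: "poly_expansion c C (deg (g n)) ?e (\<lambda>x. r x * c x ^ ?k * g i x)"
      using poly_expansion_mult_monom[OF a[of i] step(2), of ?k] unfolding k .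
    have "(\<lambda>x. r x * c x ^ ?k) \<in> ?R"
    proof -
      have "(\<lambda>x. c x ^ j) \<in> ?R" for j by (induction j) (auto intro: polyfun.intros)
      moreover have "r \<in> ?R" using step(2) polyfun_mono[of C "insert c C"] by blast
      ultimately show ?thesis by (rule polyfun.mult[rotated])
    qed
    then have "(\<lambda>x. h x + r x * c x ^ ?k * g i x) \<in> idl ?R (g ` {..<n})"
      using h(1) i(1) by (intro idl.step) auto
    moreover have "?e (deg (g n) - 1) = (\<lambda>x. r x * m x)"
    proof -
      have "\<not> deg (g n) - 1 < ?k" "deg (g n) - 1 - ?k = deg (g i) - 1"
        using k deg_pos[of i] by linarith+
      then show ?thesis by (simp add: i(2) lc_def)
    qed
    ultimately show ?case
      using poly_expansion_add[OF h(2) e] h(3)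
      by (intro exI[of _ "\<lambda>x. h x + r x * c x ^ ?k * g i x"] exI[of _ "\<lambda>j x. e j x + ?e j x"]) (auto simp: fun_eq_iff)
  qed
  ultimately obtain h e where h: "h \<in> idl ?R (g ` {..<n})" "poly_expansion c C (deg (g n)) e h"
      "e (deg (g n) - 1) = lc n" by blast
  \<comment> \<open>The leading terms cancel, so \<open>f\<close> is shorter than
    \<open>g n\<close>, yet it stays outside the ideal of the earlier choices, against the
    minimality of \<open>g n\<close>.\<close>
  define f where "f = (\<lambda>x. g n x + (- 1) * h x)"
  have "h \<in> I" using h(1) idl_idl[of "g ` {..<n}" "insert c C" G] g(1) unfolding I_def by blast
  then have "f \<in> I" unfolding f_def I_def using g(1)[of n]
    by (intro idl_add idl_mult[of _ _ _ "\<lambda>_. - 1"]) (auto simp: I_def intro: polyfun.const)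
  moreover have "f \<notin> idl ?R (g ` {..<n})"
  proof
    assume "f \<in> idl ?R (g ` {..<n})"
    then have "(\<lambda>x. f x + h x) \<in> idl ?R (g ` {..<n})" using h(1) by (rule idl_add)
    moreover have "(\<lambda>x. f x + h x) = g n" by (auto simp: f_def)
    ultimately show False using g(2)[of n] by simp
  qed
  ultimately have "deg (g n) \<le> deg f" using g(3) by blast
  moreover have "poly_expansion c C (deg (g n) - 1) (\<lambda>i x. a n i x - e i x) f"
  proof -
    obtain d where d: "deg (g n) = Suc d" using deg_pos[of n] by (cases "deg (g n)") auto
    have "f x = (\<Sum>i<d. (a n i x - e i x) * c x ^ i)" for x
      using a[of n] h(2,3) unfolding f_def d poly_expansion_def lc_def
      by (simp add: sum_subtractf left_diff_distrib)
    then show ?thesis using a[of n] h(2) unfolding d poly_expansion_def by (auto intro: polyfun_diff)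
  qed
  then have "deg f \<le> deg (g n) - 1" by (rule deg_le)
  ultimately show False using deg_pos[of n] by linarith
qed

text \<open>Without coordinates the polynomial functions are the constants, and any nonzero constant
  generates everything; this base case is where division enters.\<close>

lemma noeth_polyfun:
  fixes C :: "('p \<Rightarrow> 'k::field) set"
  assumes "finite C"
  shows "noeth (polyfun C)"
  using assms
proof induction
  case empty
  show ?case unfolding noeth_def
  proof (intro allI impI)
    fix G assume G: "G \<subseteq> polyfun ({} :: ('p \<Rightarrow> 'k) set)"
    have c: "\<exists>k. f = (\<lambda>_. k)" if "f \<in> polyfun {}" for f :: "'p \<Rightarrow> 'k"
      using that by induction auto
    show "\<exists>F\<subseteq>G. finite F \<and> G \<subseteq> idl (polyfun {}) F"
    proof (cases "G \<subseteq> {\<lambda>_. 0}")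
      case True
      then show ?thesis by (intro exI[of _ "{}"]) (auto intro: idl.zero)
    next
      case False
      then obtain f where f: "f \<in> G" "f \<noteq> (\<lambda>_. 0)" by blast
      then obtain k where k: "f = (\<lambda>_. k)" "k \<noteq> 0" using c[of f] G by auto
      have "g \<in> idl (polyfun {}) {f}" if g: "g \<in> G" for g
      proof -
        obtain l where l: "g = (\<lambda>_. l)" using c[of g] G g by auto
        have "(\<lambda>x. 0 + (\<lambda>_. l / k) x * f x) \<in> idl (polyfun {}) {f}"
          by (intro idl.step idl.zero polyfun.const) auto
        then show ?thesis using k l by simp
      qed
      then show ?thesis using f by (intro exI[of _ "{f}"]) auto
    qed
  qed
qed (rule noeth_insert)

section \<open>The Zariski topology is noetherian\<close>

text \<open>Common zeros of generators are zeros of the whole ideal, and the generators are found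
  inside \<open>P\<close>.\<close>

lemma finite_equations:
  fixes C :: "('p \<Rightarrow> 'k::field) set"
  assumes "finite C" "P \<subseteq> polyfun C"
  shows "\<exists>F\<subseteq>P. finite F \<and> (\<forall>x. (\<forall>p\<in>F. p x = 0) \<longrightarrow> (\<forall>p\<in>P. p x = 0))"
proof -
  obtain F where F: "F \<subseteq> P" "finite F" "P \<subseteq> idl (polyfun C) F"
    using noeth_polyfun[OF assms(1), unfolded noeth_def, rule_format, OF assms(2)] by (elim exE conjE)
  have "p x = 0" if "\<forall>q\<in>F. q x = 0" "p \<in> P" for p x
    using idl_zero_at[of p "polyfun C" F x] F(3) that by auto
  then show ?thesis using F by blast
qed

lemma constr_closed:
  fixes C :: "('p \<Rightarrow> 'k::field) set"
  assumes "finite C" "closedin (zariski X C) Z"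
  shows "constr X C Z"
proof -
  obtain P where P: "P \<subseteq> polyfun C" "Z = {x\<in>X. \<forall>p\<in>P. p x = 0}"
    using assms(2) unfolding closedin_zariski by blast
  obtain F where F: "F \<subseteq> P" "finite F" "\<forall>x. (\<forall>p\<in>F. p x = 0) \<longrightarrow> (\<forall>p\<in>P. p x = 0)"
    using finite_equations[OF assms(1) P(1)] by blast
  have "Z = {x\<in>X. \<forall>p\<in>F. p x = 0}" using P(2) F by blast
  then show ?thesis using F P(1) by (auto intro!: constr_Ball constr.zero)
qed

text \<open>The bridge between the topological notion of the theorem and the finite Boolean
  combinations on which elimination works.\<close>

lemma constructible_in_zariski:
  fixes C :: "('p \<Rightarrow> 'k::field) set"
  assumes "finite C"
  shows "constructible_in (zariski X C) S \<longleftrightarrow> constr X C S"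
proof
  assume "constructible_in (zariski X C) S"
  then show "constr X C S"
  proof induction
    case (opn S)
    then have "constr X C (X - (X - S))"
      by (intro constr_compl constr_closed[OF assms]) (metis closedin_diff closedin_topspace topspace_zariski)
    moreover have "S \<subseteq> X" using openin_subset[OF opn] by simp
    ultimately show ?case by (simp add: double_diff)
  qed (auto intro: constr_closed[OF assms] constr.un constr.int)
qed (rule constr_imp_constructible_in)

text \<open>In a strictly descending sequence, each step is witnessed by a polynomial
  \<open>p i\<close> that vanishes on the next set but not on the present one. Once finitely many of
  these have the zeros of all, every later point is a zero of all of them, including its own
  witness.\<close>

lemma wf_closed_zariski:
  fixes C :: "('p \<Rightarrow> 'k::field) set"
  assumes "finite C"
  shows "wf {(A, B). closedin (zariski X C) A \<and> closedin (zariski X C) B \<and> A \<subset> B}" (is "wf ?r")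
  unfolding wf_iff_no_infinite_down_chain
proof
  assume "\<exists>f. \<forall>i. (f (Suc i), f i) \<in> ?r"
  then obtain Z where "\<forall>i. (Z (Suc i), Z i) \<in> ?r" by blast
  then have Z: "closedin (zariski X C) (Z i)" "Z (Suc i) \<subset> Z i" for i by auto
  have "\<exists>p\<in>polyfun C. (\<forall>x\<in>Z (Suc i). p x = 0) \<and> (\<exists>x\<in>Z i. p x \<noteq> 0)" for i
  proof -
    obtain P where P: "P \<subseteq> polyfun C" "Z (Suc i) = {x\<in>X. \<forall>p\<in>P. p x = 0}"
      using Z(1)[of "Suc i"] unfolding closedin_zariski by blast
    obtain x where x: "x \<in> Z i" "x \<notin> Z (Suc i)" using Z(2) by blast
    have "x \<in> X" using x(1) closedin_subset[OF Z(1)[of i]] by auto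
    then show ?thesis using P x by blast
  qed
  then obtain p where p: "\<And>i. p i \<in> polyfun C" "\<And>i x. x \<in> Z (Suc i) \<Longrightarrow> p i x = 0"
    "\<And>i. \<exists>x\<in>Z i. p i x \<noteq> 0" by metis
  obtain F where F: "F \<subseteq> range p" "finite F" "\<forall>x. (\<forall>p\<in>F. p x = 0) \<longrightarrow> (\<forall>p\<in>range p. p x = 0)"
    using finite_equations[OF assms, of "range p"] p(1) by blast
  obtain J where J: "finite J" "F = p ` J"
    using finite_subset_image[OF F(2,1)] by (elim exE conjE)
  define n where "n = Suc (Max (insert 0 J))"
  have Jn: "j < n" if "j \<in> J" for j unfolding n_def using J(1) that by (auto simp: less_Suc_eq_le)
  have anti: "Z m \<subseteq> Z k" if "k \<le> m" for k m
    using lift_Suc_antimono_le[of Z, OF _ that] Z(2) by blast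
  obtain x where x: "x \<in> Z n" "p n x \<noteq> 0" using p(3) by blast
  have "p j x = 0" if "j \<in> J" for j
  proof -
    have "Z n \<subseteq> Z (Suc j)" using anti[of "Suc j" n] Jn[OF that] by simp
    then show ?thesis using p(2)[of x j] x(1) by auto
  qed
  then have "\<forall>q\<in>F. q x = 0" using J(2) by simp
  then have "p n x = 0" using F(3) by simp
  then show False using x(2) by simp
qed

text \<open>Every union of open sets is quasi-compact: a point missed by the finite union would be a
  common zero of a finite family of equations that already implies all the others.\<close>

lemma finite_subcover:
  fixes C :: "('p \<Rightarrow> 'k::field) set"
  assumes "finite C" "\<And>W. W \<in> \<W> \<Longrightarrow> openin (zariski X C) W"
  shows "\<exists>\<F>\<subseteq>\<W>. finite \<F> \<and> \<Union>\<F> = \<Union>\<W>"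
proof -
  have "\<forall>W\<in>\<W>. \<exists>P \<subseteq> polyfun C. W = {x\<in>X. \<exists>p\<in>P. p x \<noteq> 0}"
    using assms(2) unfolding openin_zariski zariski_open_alt by blast
  then obtain P where P: "\<forall>W\<in>\<W>. P W \<subseteq> polyfun C \<and> W = {x\<in>X. \<exists>p\<in>P W. p x \<noteq> 0}"
    by (elim bchoice[THEN exE])
  have P1: "P W \<subseteq> polyfun C" and P2: "x \<in> W \<longleftrightarrow> x \<in> X \<and> (\<exists>p\<in>P W. p x \<noteq> 0)"
    if "W \<in> \<W>" for W x
  proof -
    note PW = P[THEN bspec, OF that]
    show "P W \<subseteq> polyfun C" by (rule conjunct1[OF PW])
    show "x \<in> W \<longleftrightarrow> x \<in> X \<and> (\<exists>p\<in>P W. p x \<noteq> 0)"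
      using eqset_imp_iff[OF conjunct2[OF PW], of x] by simp
  qed
  have PC: "(\<Union>W\<in>\<W>. P W) \<subseteq> polyfun C" by (rule UN_least) (rule P1)
  obtain F where F: "F \<subseteq> (\<Union>W\<in>\<W>. P W)" "finite F"
    "\<forall>x. (\<forall>p\<in>F. p x = 0) \<longrightarrow> (\<forall>p\<in>(\<Union>W\<in>\<W>. P W). p x = 0)"
    using finite_equations[OF assms(1) PC] by (elim exE conjE)
  have "\<forall>p\<in>F. \<exists>W. W \<in> \<W> \<and> p \<in> P W" using F(1) by auto
  then obtain w where w: "\<forall>p\<in>F. w p \<in> \<W> \<and> p \<in> P (w p)" by (elim bchoice[THEN exE])
  have "\<Union>\<W> \<subseteq> \<Union>(w ` F)"
  proof
    fix x assume "x \<in> \<Union>\<W>"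
    then obtain W where W: "W \<in> \<W>" "x \<in> W" by blast
    have x: "x \<in> X" "\<exists>p\<in>P W. p x \<noteq> 0" using W P2 by auto
    then have "\<not> (\<forall>p\<in>(\<Union>W\<in>\<W>. P W). p x = 0)" using W(1) by auto
    then have "\<not> (\<forall>p\<in>F. p x = 0)" using F(3) by metis
    then obtain p where p: "p \<in> F" "p x \<noteq> 0" by auto
    have "x \<in> w p" using P2[of "w p" x] w p x by auto
    then show "x \<in> \<Union>(w ` F)" using p(1) by auto
  qed
  moreover have "w ` F \<subseteq> \<W>" using w by auto
  ultimately show ?thesis using F(2) by (intro exI[of _ "w ` F"]) auto
qed

section \<open>Linear conditions with polynomial coefficients\<close>

text \<open>Affine functions of the environment \<open>u\<close> with coefficients polynomial in the
  parameter \<open>x\<close>. Variables are numbered like de Bruijn indices: a quantifier binds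
  variable \<open>0\<close>, inserted by \<open>case_nat\<close>, and shifts the others.\<close>

inductive_set affine :: "('p \<Rightarrow> 'k::field) set \<Rightarrow> ('p \<Rightarrow> (nat \<Rightarrow> 'k) \<Rightarrow> 'k) set" for C where
  const: "b \<in> polyfun C \<Longrightarrow> (\<lambda>x u. b x) \<in> affine C"
| var: "(\<lambda>x u. u j) \<in> affine C"
| scale: "b \<in> polyfun C \<Longrightarrow> l \<in> affine C \<Longrightarrow> (\<lambda>x u. b x * l x u) \<in> affine C"
| add: "l \<in> affine C \<Longrightarrow> l' \<in> affine C \<Longrightarrow> (\<lambda>x u. l x u + l' x u) \<in> affine C"

lemma affine_diff:
  assumes "l \<in> affine C" "l' \<in> affine C"
  shows "(\<lambda>x u. l x u - l' x u) \<in> affine C"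
  using affine.add[OF assms(1) affine.scale[OF polyfun.const[of "- 1"] assms(2)]] by simp

lemma affine_sum:
  assumes "\<And>i. i \<in> I \<Longrightarrow> l i \<in> affine C"
  shows "(\<lambda>x u. \<Sum>i\<in>I. l i x u) \<in> affine C"
proof (cases "finite I")
  case True
  then show ?thesis using assms
    by (induction I) (simp_all add: affine.add affine.const polyfun.const)
qed (simp add: affine.const polyfun.const)

lemma affine_subst:
  assumes "l \<in> affine C" "\<And>j. L j \<in> affine C"
  shows "(\<lambda>x u. l x (\<lambda>j. L j x u)) \<in> affine C"
  using assms(1) by induction (auto intro: affine.intros assms(2))

lemma affine_eval: "l \<in> affine C \<Longrightarrow> (\<lambda>x. l x u) \<in> polyfun C"
proof (induction rule: affine.induct)
  case (scale b l)
  then show ?case by (simp add: polyfun.mult)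
next
  case (add l l')
  then show ?case by (simp add: polyfun.add)
qed (simp_all add: polyfun.const)

text \<open>Isolates the variable to be eliminated. Its coefficient depends on the parameter only,
  which is why a pivot can be selected by a constructible case distinction on
  \<open>x\<close>.\<close>

lemma affine_split:
  assumes "l \<in> affine C"
  shows "\<exists>a l'. a \<in> polyfun C \<and> l' \<in> affine C \<and> (\<forall>x t u. l x (case_nat t u) = a x * t + l' x u)"
  using assms
proof induction
  case (const b)
  then show ?case
    by (intro exI[of _ "\<lambda>_. 0"] exI[of _ "\<lambda>x u. b x"]) (simp add: affine.const polyfun.const)
next
  case (var j)
  show ?case
  proof (cases j)
    case 0
    then show ?thesis
      by (intro exI[of _ "\<lambda>_. 1"] exI[of _ "\<lambda>x u. 0"]) (simp add: affine.const polyfun.const)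
  next
    case (Suc i)
    then show ?thesis
      by (intro exI[of _ "\<lambda>_. 0"] exI[of _ "\<lambda>x u. u i"]) (simp add: affine.var polyfun.const)
  qed
next
  case (scale b l)
  then obtain a l' where "a \<in> polyfun C" "l' \<in> affine C" "\<forall>x t u. l x (case_nat t u) = a x * t + l' x u"
    by (elim exE conjE)
  then show ?case using scale(1)
    by (intro exI[of _ "\<lambda>x. b x * a x"] exI[of _ "\<lambda>x u. b x * l' x u"])
      (simp add: affine.scale polyfun.mult algebra_simps)
next
  case (add l m)
  then obtain a l' b m' where "a \<in> polyfun C" "l' \<in> affine C" "\<forall>x t u. l x (case_nat t u) = a x * t + l' x u"
    "b \<in> polyfun C" "m' \<in> affine C" "\<forall>x t u. m x (case_nat t u) = b x * t + m' x u"
    by (elim exE conjE)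
  then show ?case
    by (intro exI[of _ "\<lambda>x. a x + b x"] exI[of _ "\<lambda>x u. l' x u + m' x u"])
      (simp add: affine.add polyfun.add algebra_simps)
qed

text \<open>Finite unions of parametrized linear systems. Disjunctions are needed because the choice
  of pivots depends on the parameter; inequations constrain the parameter only, through
  \<open>S\<close>, so that solving for a variable never has to avoid values. The last clause
  identifies predicates that agree over \<open>X\<close>.\<close>

inductive lindef :: "'p set \<Rightarrow> ('p \<Rightarrow> 'k::field) set \<Rightarrow> ('p \<Rightarrow> (nat \<Rightarrow> 'k) \<Rightarrow> bool) \<Rightarrow> bool" for X C where
  basic: "constr X C S \<Longrightarrow> set ls \<subseteq> affine C \<Longrightarrow> lindef X C (\<lambda>x u. x \<in> S \<and> (\<forall>l\<in>set ls. l x u = 0))"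
| disj: "lindef X C R \<Longrightarrow> lindef X C R' \<Longrightarrow> lindef X C (\<lambda>x u. R x u \<or> R' x u)"
| cong: "lindef X C R \<Longrightarrow> (\<And>x u. x \<in> X \<Longrightarrow> R x u \<longleftrightarrow> R' x u) \<Longrightarrow> lindef X C R'"

lemma lindef_False: "lindef X C (\<lambda>x u. False)"
  using lindef.basic[OF constr_bot[of X C], of "[]"] by simp

lemma lindef_Bex_list:
  assumes "\<And>i. i \<in> set I \<Longrightarrow> lindef X C (R i)"
  shows "lindef X C (\<lambda>x u. \<exists>i\<in>set I. R i x u)"
  using assms by (induction I) (simp_all add: lindef_False lindef.disj)

lemma lindef_conj:
  assumes "lindef X C R" "lindef X C R'"
  shows "lindef X C (\<lambda>x u. R x u \<and> R' x u)"
  using assms(1)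
proof induction
  case (basic S ls)
  show ?case using assms(2)
  proof induction
    case (basic S' ls')
    have "lindef X C (\<lambda>x u. x \<in> S \<inter> S' \<and> (\<forall>l\<in>set (ls @ ls'). l x u = 0))"
      using basic \<open>constr X C S\<close> \<open>set ls \<subseteq> affine C\<close> by (intro lindef.basic constr.int) auto
    then show ?case by (rule lindef.cong) auto
  next
    case (disj Q Q')
    from lindef.disj[OF disj(3,4)] show ?case by (rule lindef.cong) auto
  next
    case (cong Q Q')
    from cong(3) show ?case by (rule lindef.cong) (use cong(2) in auto)
  qed
next
  case (disj Q Q')
  from lindef.disj[OF disj(3,4)] show ?case by (rule lindef.cong) auto
next
  case (cong Q Q')
  from cong(3) show ?case by (rule lindef.cong) (use cong(2) in auto)
qed

lemma lindef_equations:
  assumes "\<And>i. i \<in> set I \<Longrightarrow> l i \<in> affine C"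
  shows "lindef X C (\<lambda>x u. \<forall>i\<in>set I. l i x u = 0)"
proof -
  have "lindef X C (\<lambda>x u. x \<in> X \<and> (\<forall>m\<in>set (map l I). m x u = 0))"
    using assms by (intro lindef.basic constr_top) auto
  then show ?thesis by (rule lindef.cong) auto
qed

lemma lindef_subst:
  assumes "lindef X C R" "\<And>j. L j \<in> affine C"
  shows "lindef X C (\<lambda>x u. R x (\<lambda>j. L j x u))"
  using assms(1)
proof induction
  case (basic S ls)
  have "lindef X C (\<lambda>x u. x \<in> S \<and> (\<forall>m\<in>set (map (\<lambda>l x u. l x (\<lambda>j. L j x u)) ls). m x u = 0))"
    using basic affine_subst[of _ C L, OF _ assms(2)] by (intro lindef.basic) auto
  then show ?case by (rule lindef.cong) auto
next
  case (disj Q Q')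
  from lindef.disj[OF disj(3,4)] show ?case .
next
  case (cong Q Q')
  from cong(3) show ?case by (rule lindef.cong) (use cong(2) in auto)
qed

lemma lindef_eval:
  assumes "lindef X C R"
  shows "constr X C {x\<in>X. R x u}"
  using assms
proof induction
  case (basic S ls)
  have "constr X C {x\<in>X. \<forall>l\<in>set ls. l x u = 0}"
    using basic affine_eval by (intro constr_Ball constr.zero) auto
  then have "constr X C (S \<inter> {x\<in>X. \<forall>l\<in>set ls. l x u = 0})" using basic by (intro constr.int)
  moreover have "S \<inter> {x\<in>X. \<forall>l\<in>set ls. l x u = 0} = {x\<in>X. x \<in> S \<and> (\<forall>l\<in>set ls. l x u = 0)}"
    using constr_subset[OF basic(1)] by auto
  ultimately show ?case by simp
next
  case (disj Q Q')
  then show ?case by (simp add: constr_disj)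
next
  case (cong Q Q')
  have "{x\<in>X. Q' x u} = {x\<in>X. Q x u}" using cong(2) by auto
  then show ?case using cong(3) by simp
qed

text \<open>Gaussian elimination of the variable \<open>t\<close>: either its coefficient vanishes in all equations,
  or some equation with nonzero coefficient is used as a pivot.\<close>

lemma lindef_ex:
  assumes "lindef X C R"
  shows "lindef X C (\<lambda>x u. \<exists>t. R x (case_nat t u))"
  using assms
proof induction
  case (basic S ls)
  have "\<forall>l\<in>set ls. \<exists>a l'. a \<in> polyfun C \<and> l' \<in> affine C \<and> (\<forall>x t u. l x (case_nat t u) = a x * t + l' x u)"
    by (intro ballI affine_split) (use basic(2) in auto)
  then obtain a m where am: "\<forall>l\<in>set ls. a l \<in> polyfun C \<and> m l \<in> affine C \<and> (\<forall>x t u. l x (case_nat t u) = a l x * t + m l x u)"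
    by (elim bchoice[THEN exE])
  let ?Z = "S \<inter> {x\<in>X. \<forall>l\<in>set ls. a l x = 0}"
  let ?P = "\<lambda>l0. S \<inter> {x\<in>X. a l0 x \<noteq> 0}"
  \<comment> \<open>What remains of \<open>l\<close> after solving \<open>l0\<close> for
    \<open>t\<close> and clearing the denominator \<open>a l0 x\<close>.\<close>
  let ?e = "\<lambda>l0 l x u. a l0 x * m l x u - a l x * m l0 x u"
  have 0: "lindef X C (\<lambda>x u. x \<in> ?Z \<and> (\<forall>l\<in>set (map m ls). l x u = 0))"
    using basic am by (intro lindef.basic constr.int constr_Ball constr.zero) auto
  have 1: "lindef X C (\<lambda>x u. x \<in> ?P l0 \<and> (\<forall>l\<in>set (map (?e l0) ls). l x u = 0))" if "l0 \<in> set ls" for l0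
    using basic am that
    by (intro lindef.basic constr.int constr.nonzero) (auto intro!: affine_diff affine.scale)
  have "lindef X C (\<lambda>x u. (x \<in> ?Z \<and> (\<forall>l\<in>set (map m ls). l x u = 0)) \<or>
     (\<exists>l0\<in>set ls. x \<in> ?P l0 \<and> (\<forall>l\<in>set (map (?e l0) ls). l x u = 0)))" (is "lindef X C ?Q")
    by (intro lindef.disj lindef_Bex_list 0 1)
  then show ?case
  proof (rule lindef.cong)
    fix x u assume x: "x \<in> X"
    have eq: "l x (case_nat t u) = a l x * t + m l x u" if "l \<in> set ls" for l t using am that by simp
    show "?Q x u \<longleftrightarrow> (\<exists>t. x \<in> S \<and> (\<forall>l\<in>set ls. l x (case_nat t u) = 0))"
    proof
      assume "?Q x u"
      then show "\<exists>t. x \<in> S \<and> (\<forall>l\<in>set ls. l x (case_nat t u) = 0)"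
      proof (elim disjE bexE conjE)
        assume "x \<in> ?Z" "\<forall>l\<in>set (map m ls). l x u = 0"
        then show ?thesis using eq by (intro exI[of _ 0]) simp
      next
        fix l0 assume l0: "l0 \<in> set ls" "x \<in> ?P l0" "\<forall>l\<in>set (map (?e l0) ls). l x u = 0"
        have "l x (case_nat (- m l0 x u / a l0 x) u) = 0" if l: "l \<in> set ls" for l
        proof -
          have "a l0 x * m l x u = a l x * m l0 x u" "a l0 x \<noteq> 0" using l0 l by auto
          then show ?thesis unfolding eq[OF l] by (simp add: field_simps)
        qed
        then show ?thesis using l0(2) by blast
      qed
    next
      assume "\<exists>t. x \<in> S \<and> (\<forall>l\<in>set ls. l x (case_nat t u) = 0)"
      then obtain t where t: "x \<in> S" "\<forall>l\<in>set ls. a l x * t + m l x u = 0" using eq by auto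
      show "?Q x u"
      proof (cases "\<forall>l\<in>set ls. a l x = 0")
        case True
        then show ?thesis using t x by auto
      next
        case False
        then obtain l0 where l0: "l0 \<in> set ls" "a l0 x \<noteq> 0" by auto
        have "?e l0 l x u = 0" if "l \<in> set ls" for l
        proof -
          have "m l x u = - (a l x * t)" "m l0 x u = - (a l0 x * t)"
            using t(2) that l0(1) by (simp_all add: eq_neg_iff_add_eq_0 add.commute)
          then show ?thesis by simp
        qed
        then show ?thesis using l0 t(1) x by auto
      qed
    qed
  qed
next
  case (disj Q Q')
  from lindef.disj[OF disj(3,4)] show ?case by (rule lindef.cong) auto
next
  case (cong Q Q')
  from cong(3) show ?case by (rule lindef.cong) (use cong(2) in auto)
qed

text \<open>Each quantifier shifts the environment by one, so a block of \<open>n\<close> witnesses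
  occupies the indices below \<open>n\<close> and the free variables move up by
  \<open>n\<close>.\<close>

lemma lindef_exs:
  fixes R :: "'p \<Rightarrow> (nat \<Rightarrow> 'k::field) \<Rightarrow> bool"
  assumes "lindef X C R"
  shows "lindef X C (\<lambda>x u. \<exists>w. R x (\<lambda>i. if i < n then w i else u (i - n)))"
  using assms
proof (induction n arbitrary: R)
  case 0
  then show ?case by simp
next
  case (Suc n)
  from Suc.IH[OF lindef_ex[OF Suc.prems]] show ?case
  proof (rule lindef.cong)
    fix x :: 'p and u :: "nat \<Rightarrow> 'k"
    have eq: "case_nat t (\<lambda>i. if i < n then w i else u (i - n)) =
      (\<lambda>i. if i < Suc n then case_nat t w i else u (i - Suc n))" for t w
      by (auto simp: fun_eq_iff split: nat.splits)
    have surj: "case_nat (w 0) (\<lambda>i. w (Suc i)) = w" for w :: "nat \<Rightarrow> 'k"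
      by (auto simp: fun_eq_iff split: nat.splits)
    show "(\<exists>w t. R x (case_nat t (\<lambda>i. if i < n then w i else u (i - n)))) \<longleftrightarrow>
      (\<exists>w. R x (\<lambda>i. if i < Suc n then w i else u (i - Suc n)))"
      unfolding eq
    proof
      assume "\<exists>w. R x (\<lambda>i. if i < Suc n then w i else u (i - Suc n))"
      then obtain w where "R x (\<lambda>i. if i < Suc n then w i else u (i - Suc n))" ..
      then show "\<exists>w t. R x (\<lambda>i. if i < Suc n then case_nat t w i else u (i - Suc n))"
        by (intro exI[of _ "\<lambda>i. w (Suc i)"] exI[of _ "w 0"]) (simp only: surj)
    qed auto
  qed
qed

section \<open>Definable families of sets of vectors\<close>

lemma vec_vec_index: "v \<in> carrier_vec n \<Longrightarrow> vec n (vec_index v) = v"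
  by (intro eq_vecI) auto

text \<open>A vector is encoded by the first \<open>n\<close> values of an environment. Being a
  subspace is not part of the notion; it is tracked separately by \<open>subsp\<close>.\<close>

definition definable :: "'p set \<Rightarrow> ('p \<Rightarrow> 'k::field) set \<Rightarrow> nat \<Rightarrow> ('p \<Rightarrow> 'k vec set) \<Rightarrow> bool" where
  "definable X C n W \<longleftrightarrow> (\<forall>x\<in>X. W x \<subseteq> carrier_vec n) \<and> lindef X C (\<lambda>x u. vec n u \<in> W x)"

definition polymat :: "'p set \<Rightarrow> ('p \<Rightarrow> 'k::field) set \<Rightarrow> nat \<Rightarrow> nat \<Rightarrow> ('p \<Rightarrow> 'k mat) \<Rightarrow> bool" where
  "polymat X C m n A \<longleftrightarrow> (\<forall>x\<in>X. A x \<in> carrier_mat m n) \<and>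
     (\<forall>i<m. \<forall>j<n. \<exists>f\<in>polyfun C. \<forall>x\<in>X. A x $$ (i, j) = f x)"

lemma polymat_mult_vec:
  assumes "polymat X C m n A"
  shows "\<exists>f. (\<forall>i j. f i j \<in> polyfun C) \<and>
    (\<forall>x\<in>X. \<forall>u. A x *\<^sub>v vec n u = vec m (\<lambda>i. \<Sum>j<n. f i j x * u j))"
proof -
  \<comment> \<open>Entries outside the matrix are set to zero, so that every \<open>f i j\<close>
    is a polynomial function.\<close>
  define f where "f i j = (if i < m \<and> j < n then SOME f. f \<in> polyfun C \<and> (\<forall>x\<in>X. A x $$ (i, j) = f x) else (\<lambda>_. 0))" for i j
  have f: "f i j \<in> polyfun C \<and> (\<forall>x\<in>X. A x $$ (i, j) = f i j x)" if "i < m" "j < n" for i j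
  proof -
    have "\<exists>f. f \<in> polyfun C \<and> (\<forall>x\<in>X. A x $$ (i, j) = f x)"
      using assms that unfolding polymat_def Bex_def by simp
    then show ?thesis unfolding f_def if_P[OF conjI[OF that]] by (rule someI_ex)
  qed
  show ?thesis
  proof (intro exI[of _ f] conjI allI ballI)
    show "f i j \<in> polyfun C" for i j
      using f[of i j] by (cases "i < m \<and> j < n") (auto simp: f_def intro: polyfun.const)
    fix x u assume x: "x \<in> X"
    then have A: "A x \<in> carrier_mat m n" using assms unfolding polymat_def by simp
    show "A x *\<^sub>v vec n u = vec m (\<lambda>i. \<Sum>j<n. f i j x * u j)"
    proof
      fix i assume "i < dim_vec (vec m (\<lambda>i. \<Sum>j<n. f i j x * u j))"
      then show "(A x *\<^sub>v vec n u) $ i = vec m (\<lambda>i. \<Sum>j<n. f i j x * u j) $ i"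
        using A f x by (simp add: scalar_prod_def atLeast0LessThan)
    qed (use A in simp)
  qed
qed

lemma definable_carrier: "definable X C n (\<lambda>_. carrier_vec n)"
  unfolding definable_def using lindef_equations[of "[]" _ C X] by simp

lemma definable_zero: "definable X C n (\<lambda>_. {0\<^sub>v n})"
proof -
  have "lindef X C (\<lambda>x u. \<forall>i\<in>set [0..<n]. u i = 0)"
    by (rule lindef_equations) (rule affine.var)
  then have "lindef X C (\<lambda>x u. vec n u \<in> {0\<^sub>v n})"
    by (rule lindef.cong) (auto simp: vec_eq_iff)
  then show ?thesis unfolding definable_def by simp
qed

lemma definable_int:
  assumes "definable X C n W" "definable X C n W'"
  shows "definable X C n (\<lambda>x. W x \<inter> W' x)"
  using assms unfolding definable_def by (auto intro: lindef_conj)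

text \<open>The coordinates of \<open>A x *\<^sub>v v\<close> are linear in those of
  \<open>v\<close>, so substitution suffices and nothing has to be eliminated.\<close>

lemma definable_preimage:
  assumes "definable X C m W" "polymat X C m n A"
  shows "definable X C n (\<lambda>x. {v\<in>carrier_vec n. A x *\<^sub>v v \<in> W x})"
proof -
  obtain f where "\<forall>i j. f i j \<in> polyfun C"
    "\<forall>x\<in>X. \<forall>u. A x *\<^sub>v vec n u = vec m (\<lambda>i. \<Sum>j<n. f i j x * u j)"
    using polymat_mult_vec[OF assms(2)] by (elim exE conjE)
  note f = this[rule_format]
  have "lindef X C (\<lambda>x u. vec m (\<lambda>i. \<Sum>j<n. f i j x * u j) \<in> W x)"
    using assms(1) f(1) unfolding definable_def
    by (intro lindef_subst[of X C "\<lambda>x u. vec m u \<in> W x" "\<lambda>i x u. \<Sum>j<n. f i j x * u j"]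
      affine_sum affine.scale affine.var) auto
  then have "lindef X C (\<lambda>x u. vec n u \<in> {v\<in>carrier_vec n. A x *\<^sub>v v \<in> W x})"
    by (rule lindef.cong) (simp add: f(2))
  then show ?thesis unfolding definable_def by auto
qed

lemma definable_image:
  fixes W :: "'p \<Rightarrow> 'k::field vec set"
  assumes "definable X C n W" "polymat X C m n A"
  shows "definable X C m (\<lambda>x. (*\<^sub>v) (A x) ` W x)"
proof -
  obtain f where "\<forall>i j. f i j \<in> polyfun C"
    "\<forall>x\<in>X. \<forall>u. A x *\<^sub>v vec n u = vec m (\<lambda>i. \<Sum>j<n. f i j x * u j)"
    using polymat_mult_vec[OF assms(2)] by (elim exE conjE)
  note f = this[rule_format]
  \<comment> \<open>The preimage occupies the variables below \<open>n\<close>, the image vector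
    those from \<open>n\<close> on; the former are then quantified away.\<close>
  let ?R = "\<lambda>x z. vec n z \<in> W x \<and> (\<forall>i\<in>set [0..<m]. z (n + i) - (\<Sum>j<n. f i j x * z j) = 0)"
  have "lindef X C ?R"
    using assms(1) f(1) unfolding definable_def
    by (intro lindef_conj lindef_equations affine_diff affine_sum affine.scale affine.var) auto
  from lindef_exs[OF this, of n]
  have "lindef X C (\<lambda>x u. vec m u \<in> (*\<^sub>v) (A x) ` W x)"
  proof (rule lindef.cong)
    fix x :: 'p and u :: "nat \<Rightarrow> 'k" assume x: "x \<in> X"
    have W: "W x \<subseteq> carrier_vec n" using assms(1) x unfolding definable_def by simp
    have 1: "vec n (\<lambda>i. if i < n then w i else u (i - n)) = vec n w" for w by auto
    have 2: "(\<Sum>j<n. f i j x * (if j < n then w j else u (j - n))) = (\<Sum>j<n. f i j x * w j)" for w i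
      by simp
    have "?R x (\<lambda>i. if i < n then w i else u (i - n)) \<longleftrightarrow> vec n w \<in> W x \<and> vec m u = A x *\<^sub>v vec n w" for w
      unfolding 1 2 f(2)[OF x] by (auto simp: vec_eq_iff)
    moreover have "vec m u \<in> (*\<^sub>v) (A x) ` W x \<longleftrightarrow> (\<exists>w. vec n w \<in> W x \<and> vec m u = A x *\<^sub>v vec n w)"
    proof
      assume "vec m u \<in> (*\<^sub>v) (A x) ` W x"
      then obtain v where v: "v \<in> W x" "vec m u = A x *\<^sub>v v" by auto
      have "vec n (vec_index v) = v" using v(1) W by (intro vec_vec_index) auto
      then show "\<exists>w. vec n w \<in> W x \<and> vec m u = A x *\<^sub>v vec n w"
        using v by (intro exI[of _ "vec_index v"]) simp
    qed auto
    ultimately show "(\<exists>w. ?R x (\<lambda>i. if i < n then w i else u (i - n))) \<longleftrightarrow> vec m u \<in> (*\<^sub>v) (A x) ` W x"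
      by simp
  qed
  moreover have "(*\<^sub>v) (A x) ` W x \<subseteq> carrier_vec m" if "x \<in> X" for x
  proof -
    have A: "A x \<in> carrier_mat m n" using assms(2) that unfolding polymat_def by simp
    have W: "W x \<subseteq> carrier_vec n" using assms(1) that unfolding definable_def by simp
    show ?thesis by (intro image_subsetI mult_mat_vec_carrier[OF A]) (rule subsetD[OF W])
  qed
  ultimately show ?thesis unfolding definable_def by simp
qed

definition vsum :: "'k::field vec set \<Rightarrow> 'k vec set \<Rightarrow> 'k vec set" where
  "vsum V W = {v + w | v w. v \<in> V \<and> w \<in> W}"

lemma definable_vsum:
  fixes W :: "'p \<Rightarrow> 'k::field vec set"
  assumes "definable X C n W" "definable X C n W'"
  shows "definable X C n (\<lambda>x. vsum (W x) (W' x))"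
proof -
  \<comment> \<open>Only the first summand is quantified; the second one is forced to be the
    difference.\<close>
  let ?R = "\<lambda>x z. vec n z \<in> W x \<and> vec n (\<lambda>i. z (n + i) - z i) \<in> W' x"
  have "lindef X C (\<lambda>x z. vec n (\<lambda>i. z (n + i) - z i) \<in> W' x)"
    using assms(2) unfolding definable_def
    by (intro lindef_subst[of X C "\<lambda>x u. vec n u \<in> W' x" "\<lambda>i x z. z (n + i) - z i"] affine_diff affine.var) auto
  then have "lindef X C ?R"
    using assms(1) unfolding definable_def by (intro lindef_conj) auto
  from lindef_exs[OF this, of n]
  have "lindef X C (\<lambda>x u. vec n u \<in> vsum (W x) (W' x))"
  proof (rule lindef.cong)
    fix x :: 'p and u :: "nat \<Rightarrow> 'k" assume x: "x \<in> X"
    have W: "W x \<subseteq> carrier_vec n" "W' x \<subseteq> carrier_vec n" using assms x unfolding definable_def by auto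
    have 1: "vec n (\<lambda>i. if i < n then w i else u (i - n)) = vec n w" for w by auto
    have 2: "vec n (\<lambda>i. (if n + i < n then w (n + i) else u (n + i - n)) - (if i < n then w i else u (i - n))) = vec n (\<lambda>i. u i - w i)" for w
      by auto
    have "vec n u \<in> vsum (W x) (W' x) \<longleftrightarrow> (\<exists>w. vec n w \<in> W x \<and> vec n (\<lambda>i. u i - w i) \<in> W' x)"
    proof
      assume "vec n u \<in> vsum (W x) (W' x)"
      then obtain v v' where v: "v \<in> W x" "v' \<in> W' x" "vec n u = v + v'" unfolding vsum_def by auto
      have d: "dim_vec v = n" "dim_vec v' = n" using v W by auto
      have "vec n (vec_index v) = v" using v(1) W by (intro vec_vec_index) auto
      moreover have "u i = v $ i + v' $ i" if "i < n" for i
        using arg_cong[OF v(3), of "\<lambda>v. v $ i"] that d by simp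
      then have "vec n (\<lambda>i. u i - v $ i) = v'" using d by auto
      ultimately show "\<exists>w. vec n w \<in> W x \<and> vec n (\<lambda>i. u i - w i) \<in> W' x"
        using v by (intro exI[of _ "vec_index v"]) simp
    next
      assume "\<exists>w. vec n w \<in> W x \<and> vec n (\<lambda>i. u i - w i) \<in> W' x"
      then obtain w where w: "vec n w \<in> W x" "vec n (\<lambda>i. u i - w i) \<in> W' x" by auto
      have "vec n u = vec n w + vec n (\<lambda>i. u i - w i)" by auto
      then show "vec n u \<in> vsum (W x) (W' x)" using w unfolding vsum_def
        by (intro CollectI exI[of _ "vec n w"] exI[of _ "vec n (\<lambda>i. u i - w i)"]) simp
    qed
    then show "(\<exists>w. ?R x (\<lambda>i. if i < n then w i else u (i - n))) \<longleftrightarrow> vec n u \<in> vsum (W x) (W' x)"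
      unfolding 1 2 by simp
  qed
  moreover have "vsum (W x) (W' x) \<subseteq> carrier_vec n" if "x \<in> X" for x
  proof -
    have "W x \<subseteq> carrier_vec n" "W' x \<subseteq> carrier_vec n" using assms that unfolding definable_def by auto
    then show ?thesis unfolding vsum_def by (auto intro!: add_carrier_vec)
  qed
  ultimately show ?thesis unfolding definable_def by simp
qed

section \<open>Leading positions of a subspace\<close>

text \<open>The leading position of a vector is that of its last nonzero entry.\<close>

definition piv :: "nat \<Rightarrow> 'k::field vec set \<Rightarrow> nat set" where
  "piv n W = {j. j < n \<and> (\<exists>v\<in>W. v $ j = 1 \<and> (\<forall>i<n. j < i \<longrightarrow> v $ i = 0))}"

text \<open>Normalizing the leading entry to \<open>1\<close> turns the requirement that it be
  nonzero into an equation, so that linear elimination applies.\<close>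

lemma constr_piv:
  assumes "definable X C n W"
  shows "constr X C {x\<in>X. j \<in> piv n (W x)}"
proof (cases "j < n")
  case True
  let ?R = "\<lambda>x z. (vec n z \<in> W x \<and> (\<forall>i\<in>set [j]. z i - 1 = 0)) \<and> (\<forall>i\<in>set [Suc j..<n]. z i = 0)"
  have "lindef X C ?R"
    using assms unfolding definable_def
    by (intro lindef_conj lindef_equations affine_diff affine.var affine.const polyfun.const) auto
  \<comment> \<open>All variables that occur are bound by now, so any environment can be
    inserted.\<close>
  from lindef_eval[OF lindef_exs[OF this, of n], of "\<lambda>_. 0"]
  have "constr X C {x\<in>X. \<exists>w. ?R x (\<lambda>i. if i < n then w i else 0)}" .
  moreover have "j \<in> piv n (W x) \<longleftrightarrow> (\<exists>w. ?R x (\<lambda>i. if i < n then w i else 0))" if x: "x \<in> X" for x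
  proof -
    have W: "W x \<subseteq> carrier_vec n" using assms x unfolding definable_def by simp
    have 1: "vec n (\<lambda>i. if i < n then w i else 0) = vec n w" for w by auto
    have "j \<in> piv n (W x) \<longleftrightarrow> (\<exists>w. vec n w \<in> W x \<and> w j = 1 \<and> (\<forall>i<n. j < i \<longrightarrow> w i = 0))"
    proof
      assume "j \<in> piv n (W x)"
      then obtain v where v: "v \<in> W x" "v $ j = 1" "\<forall>i<n. j < i \<longrightarrow> v $ i = 0" unfolding piv_def by auto
      moreover have "vec n (vec_index v) = v" using v(1) W by (intro vec_vec_index) auto
      ultimately show "\<exists>w. vec n w \<in> W x \<and> w j = 1 \<and> (\<forall>i<n. j < i \<longrightarrow> w i = 0)"
        by (intro exI[of _ "vec_index v"]) simp
    next
      assume "\<exists>w. vec n w \<in> W x \<and> w j = 1 \<and> (\<forall>i<n. j < i \<longrightarrow> w i = 0)"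
      then obtain w where w: "vec n w \<in> W x" "w j = 1" "\<forall>i<n. j < i \<longrightarrow> w i = 0" by auto
      then show "j \<in> piv n (W x)" unfolding piv_def using True by (auto intro!: bexI[of _ "vec n w"])
    qed
    then show ?thesis unfolding 1 using True by auto
  qed
  then have "{x\<in>X. j \<in> piv n (W x)} = {x\<in>X. \<exists>w. ?R x (\<lambda>i. if i < n then w i else 0)}"
    by (intro Collect_cong conj_cong refl)
  ultimately show ?thesis by simp
next
  case False
  then have "{x\<in>X. j \<in> piv n (W x)} = {}" unfolding piv_def by auto
  then show ?thesis using constr_bot[of X C] by (simp only:)
qed

section \<open>Subspaces of coordinate spaces and the number of their leading positions\<close>

definition subsp :: "nat \<Rightarrow> 'k::field vec set \<Rightarrow> bool" where
  "subsp n W \<longleftrightarrow> W \<subseteq> carrier_vec n \<and> 0\<^sub>v n \<in> W \<and> (\<forall>v\<in>W. \<forall>w\<in>W. v + w \<in> W) \<and> (\<forall>c. \<forall>v\<in>W. c \<cdot>\<^sub>v v \<in> W)"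

lemma subspD:
  assumes "subsp n W"
  shows "v \<in> W \<Longrightarrow> v \<in> carrier_vec n" "0\<^sub>v n \<in> W" "v \<in> W \<Longrightarrow> w \<in> W \<Longrightarrow> v + w \<in> W"
    "v \<in> W \<Longrightarrow> c \<cdot>\<^sub>v v \<in> W"
  using assms unfolding subsp_def by auto

lemma subspI:
  assumes "\<And>v. v \<in> W \<Longrightarrow> v \<in> carrier_vec n" "0\<^sub>v n \<in> W" "\<And>v w. v \<in> W \<Longrightarrow> w \<in> W \<Longrightarrow> v + w \<in> W"
    "\<And>c v. v \<in> W \<Longrightarrow> c \<cdot>\<^sub>v v \<in> W"
  shows "subsp n W"
  using assms unfolding subsp_def by auto

lemma subsp_minus:
  assumes "subsp n W" "v \<in> W" "w \<in> W"
  shows "v - w \<in> W"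
proof -
  have "v + (- 1) \<cdot>\<^sub>v w \<in> W" using subspD[OF assms(1)] assms(2,3) by simp
  moreover have "v + (- 1) \<cdot>\<^sub>v w = v - w"
    using subspD(1)[OF assms(1) assms(2)] subspD(1)[OF assms(1) assms(3)] by (intro eq_vecI) auto
  ultimately show ?thesis by simp
qed

lemma subsp_carrier: "subsp n (carrier_vec n)"
  by (intro subspI) auto

lemma subsp_zero: "subsp n {0\<^sub>v n}"
  by (intro subspI) auto

lemma subsp_int: "subsp n V \<Longrightarrow> subsp n W \<Longrightarrow> subsp n (V \<inter> W)"
  by (intro subspI) (auto dest: subspD)

lemma subsp_image:
  assumes "subsp n W" "A \<in> carrier_mat m n"
  shows "subsp m ((*\<^sub>v) A ` W)"
proof (rule subspI)
  show "v \<in> carrier_vec m" if "v \<in> (*\<^sub>v) A ` W" for v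
    using that assms by (auto intro!: mult_mat_vec_carrier dest: subspD(1))
  have "A *\<^sub>v 0\<^sub>v n = 0\<^sub>v m" using assms(2) by (intro eq_vecI) auto
  then show "0\<^sub>v m \<in> (*\<^sub>v) A ` W" using subspD(2)[OF assms(1)] by (metis imageI)
  show "v + w \<in> (*\<^sub>v) A ` W" if vw: "v \<in> (*\<^sub>v) A ` W" "w \<in> (*\<^sub>v) A ` W" for v w
  proof -
    obtain v' w' where v': "v' \<in> W" "v = A *\<^sub>v v'" "w' \<in> W" "w = A *\<^sub>v w'" using vw by auto
    then have "v + w = A *\<^sub>v (v' + w')"
      using mult_add_distrib_mat_vec[OF assms(2)] subspD(1)[OF assms(1)] by simp
    then show ?thesis using v' subspD(3)[OF assms(1)] by simp
  qed
  show "c \<cdot>\<^sub>v v \<in> (*\<^sub>v) A ` W" if v: "v \<in> (*\<^sub>v) A ` W" for c v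
  proof -
    obtain v' where v': "v' \<in> W" "v = A *\<^sub>v v'" using v by auto
    then have "c \<cdot>\<^sub>v v = A *\<^sub>v (c \<cdot>\<^sub>v v')"
      using mult_mat_vec[OF assms(2)] subspD(1)[OF assms(1)] by simp
    then show ?thesis using v' subspD(4)[OF assms(1)] by simp
  qed
qed

lemma subsp_preimage:
  assumes "subsp m W" "A \<in> carrier_mat m n"
  shows "subsp n {v\<in>carrier_vec n. A *\<^sub>v v \<in> W}"
proof (rule subspI)
  have "A *\<^sub>v 0\<^sub>v n = 0\<^sub>v m" using assms(2) by (intro eq_vecI) auto
  then show "0\<^sub>v n \<in> {v\<in>carrier_vec n. A *\<^sub>v v \<in> W}" using subspD(2)[OF assms(1)] by simp
qed (use mult_add_distrib_mat_vec[OF assms(2)] mult_mat_vec[OF assms(2)] subspD[OF assms(1)] in auto)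

lemma subsp_vsum:
  assumes "subsp n V" "subsp n W"
  shows "subsp n (vsum V W)"
proof (rule subspI)
  show "v \<in> carrier_vec n" if "v \<in> vsum V W" for v
    using that subspD(1)[OF assms(1)] subspD(1)[OF assms(2)] unfolding vsum_def by auto
  show "0\<^sub>v n \<in> vsum V W"
    unfolding vsum_def using subspD(2)[OF assms(1)] subspD(2)[OF assms(2)]
    by (intro CollectI exI[of _ "0\<^sub>v n"]) simp
  show "v + w \<in> vsum V W" if vw: "v \<in> vsum V W" "w \<in> vsum V W" for v w
  proof -
    obtain v1 v2 w1 w2 where *: "v = v1 + v2" "v1 \<in> V" "v2 \<in> W" "w = w1 + w2" "w1 \<in> V" "w2 \<in> W"
      using vw unfolding vsum_def by auto
    have "v1 \<in> carrier_vec n" "w1 \<in> carrier_vec n" "v2 \<in> carrier_vec n" "w2 \<in> carrier_vec n"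
      using * subspD(1)[OF assms(1)] subspD(1)[OF assms(2)] by auto
    then have "v + w = (v1 + w1) + (v2 + w2)" unfolding * by (intro eq_vecI) auto
    then show ?thesis unfolding vsum_def using * subspD(3)[OF assms(1)] subspD(3)[OF assms(2)]
      by (intro CollectI exI[of _ "v1 + w1"] exI[of _ "v2 + w2"]) simp
  qed
  show "c \<cdot>\<^sub>v v \<in> vsum V W" if v: "v \<in> vsum V W" for c v
  proof -
    obtain v1 v2 where *: "v = v1 + v2" "v1 \<in> V" "v2 \<in> W" using v unfolding vsum_def by auto
    have "v1 \<in> carrier_vec n" "v2 \<in> carrier_vec n"
      using * subspD(1)[OF assms(1)] subspD(1)[OF assms(2)] by auto
    then have "c \<cdot>\<^sub>v v = c \<cdot>\<^sub>v v1 + c \<cdot>\<^sub>v v2" unfolding * by (simp add: smult_add_distrib_vec)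
    then show ?thesis unfolding vsum_def using * subspD(4)[OF assms(1)] subspD(4)[OF assms(2)]
      by (intro CollectI exI[of _ "c \<cdot>\<^sub>v v1"] exI[of _ "c \<cdot>\<^sub>v v2"]) simp
  qed
qed

lemma piv_lessThan: "piv n W \<subseteq> {..<n}"
  unfolding piv_def by auto

lemma finite_piv: "finite (piv n W)"
  using finite_subset[OF piv_lessThan] by simp

lemma piv_mono: "V \<subseteq> W \<Longrightarrow> piv n V \<subseteq> piv n W"
  unfolding piv_def by auto

lemma pivI:
  assumes "subsp n W" "w \<in> W" "k < n" "w $ k \<noteq> 0" "\<And>i. i < n \<Longrightarrow> k < i \<Longrightarrow> w $ i = 0"
  shows "k \<in> piv n W"
proof -
  have "dim_vec w = n" using subspD(1)[OF assms(1,2)] by simp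
  then show ?thesis unfolding piv_def using assms subspD(4)[OF assms(1,2), of "inverse (w $ k)"]
    by (intro CollectI conjI bexI[of _ "inverse (w $ k) \<cdot>\<^sub>v w"]) auto
qed

text \<open>Echelon reduction: the leading entry of a vector of \<open>W'\<close> is cleared by a
  vector of \<open>W\<close> with the same leading position, and the leading position drops. The
  induction is on a bound \<open>k\<close> for the positions of nonzero entries.\<close>

lemma piv_subset_imp_subset:
  assumes W: "subsp n W" and W': "subsp n W'" and "W \<subseteq> W'" "piv n W' \<subseteq> piv n W"
  shows "W' \<subseteq> W"
proof -
  have "v \<in> W" if "k \<le> n" "v \<in> W'" "\<And>i. i < n \<Longrightarrow> k \<le> i \<Longrightarrow> v $ i = 0" for k v
    using that
  proof (induction k arbitrary: v)
    case 0
    then have "v = 0\<^sub>v n" using subspD(1)[OF W' 0(2)] by (intro eq_vecI) auto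
    then show ?case using subspD(2)[OF W] by simp
  next
    case (Suc k)
    have dv: "dim_vec v = n" using subspD(1)[OF W' Suc.prems(2)] by simp
    show ?case
    proof (cases "v $ k = 0")
      case True
      show ?thesis
      proof (rule Suc.IH)
        show "v $ i = 0" if "i < n" "k \<le> i" for i
          using that Suc.prems(3)[of i] True by (cases "i = k") auto
      qed (use Suc.prems in auto)
    next
      case False
      have "k \<in> piv n W'" by (rule pivI[OF W' Suc.prems(2)]) (use Suc.prems False in auto)
      then have "k \<in> piv n W" using assms(4) by auto
      then obtain w where w: "w \<in> W" "w $ k = 1" "\<forall>i<n. k < i \<longrightarrow> w $ i = 0" unfolding piv_def by auto
      have dw: "dim_vec w = n" using subspD(1)[OF W w(1)] by simp
      let ?u = "v - v $ k \<cdot>\<^sub>v w"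
      have uW: "?u \<in> W"
      proof (rule Suc.IH)
        show "?u \<in> W'" using w(1) assms(3) Suc.prems(2) subspD(4)[OF W'] by (intro subsp_minus[OF W']) auto
        show "?u $ i = 0" if "i < n" "k \<le> i" for i
          using that Suc.prems(3)[of i] w dv dw by (cases "i = k") auto
      qed (use Suc.prems in auto)
      have "v = ?u + v $ k \<cdot>\<^sub>v w" using dv dw by (intro eq_vecI) auto
      then show ?thesis using subspD(3)[OF W uW subspD(4)[OF W w(1)]] by metis
    qed
  qed
  from this[of n] show ?thesis by auto
qed

text \<open>\<open>card (piv n W)\<close> serves as the dimension of \<open>W\<close>. For the
  stabilization of the iterations, this strict monotonicity and the bound \<open>n\<close> are what
  counts.\<close>

lemma card_piv_less:
  assumes "subsp n W" "subsp n W'" "W \<subset> W'"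
  shows "card (piv n W) < card (piv n W')"
proof (rule psubset_card_mono[OF finite_piv])
  have "piv n W \<subseteq> piv n W'" using assms(3) by (intro piv_mono) auto
  moreover have "\<not> piv n W' \<subseteq> piv n W"
    using piv_subset_imp_subset[OF assms(1,2)] assms(3) by auto
  ultimately show "piv n W \<subset> piv n W'" by auto
qed

lemma card_piv_le: "card (piv n W) \<le> n"
  using card_mono[OF _ piv_lessThan[of n W]] by simp

section \<open>Bases, ranks and factorizations of matrices\<close>

lemma mult_mat_vec_index_sum:
  "A \<in> carrier_mat m n \<Longrightarrow> c \<in> carrier_vec n \<Longrightarrow> i < m \<Longrightarrow> (A *\<^sub>v c) $ i = (\<Sum>j<n. A $$ (i, j) * c $ j)"
  by (simp add: scalar_prod_def atLeast0LessThan)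

lemma col_mat_vec:
  assumes "e j \<in> carrier_vec n" "j < d"
  shows "col (mat n d (\<lambda>(i, l). e l $ i)) j = e j"
proof (rule eq_vecI)
  have "dim_vec (e j) = n" using assms(1) by simp
  then show "dim_vec (col (mat n d (\<lambda>(i, l). e l $ i)) j) = dim_vec (e j)"
    "\<And>i. i < dim_vec (e j) \<Longrightarrow> col (mat n d (\<lambda>(i, l). e l $ i)) j $ i = e j $ i"
    using assms(2) by auto
qed

lemma mult_mat_unit_vec:
  fixes A :: "'k::field mat"
  assumes "A \<in> carrier_mat m n" "j < n"
  shows "A *\<^sub>v unit_vec n j = col A j"
proof (rule eq_vecI)
  fix i assume i: "i < dim_vec (col A j)"
  then have "(A *\<^sub>v unit_vec n j) $ i = (\<Sum>l<n. A $$ (i, l) * unit_vec n j $ l)"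
    using assms by (intro mult_mat_vec_index_sum) auto
  also have "\<dots> = (\<Sum>l<n. if l = j then A $$ (i, l) else 0)"
    by (intro sum.cong) (auto simp: unit_vec_def)
  finally show "(A *\<^sub>v unit_vec n j) $ i = col A j $ i" using assms i by simp
qed (use assms in auto)

lemma mat_eqI_vec:
  fixes A :: "'k::field mat"
  assumes "A \<in> carrier_mat m n" "B \<in> carrier_mat m n" "\<And>v. v \<in> carrier_vec n \<Longrightarrow> A *\<^sub>v v = B *\<^sub>v v"
  shows "A = B"
proof (rule mat_col_eqI)
  fix j assume "j < dim_col B"
  then show "col A j = col B j"
    using assms(3)[of "unit_vec n j"] mult_mat_unit_vec[OF assms(1)] mult_mat_unit_vec[OF assms(2)] assms(2)
    by simp
qed (use assms in auto)

lemma subsp_mult_mat_vec: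
  fixes W :: "'k::field vec set"
  assumes "subsp n W" "B \<in> carrier_mat n d" "\<And>l. l < d \<Longrightarrow> col B l \<in> W" "c \<in> carrier_vec d"
  shows "B *\<^sub>v c \<in> W"
proof -
  have "vec n (\<lambda>i. \<Sum>l<k. B $$ (i, l) * c $ l) \<in> W" if "k \<le> d" for k
    using that
  proof (induction k)
    case 0
    have "vec n (\<lambda>i. 0) = (0\<^sub>v n :: 'k vec)" by (intro eq_vecI) auto
    then show ?case using subspD(2)[OF assms(1)] by simp
  next
    case (Suc k)
    have "vec n (\<lambda>i. \<Sum>l<Suc k. B $$ (i, l) * c $ l) = vec n (\<lambda>i. \<Sum>l<k. B $$ (i, l) * c $ l) + c $ k \<cdot>\<^sub>v col B k"
      using assms(2) Suc.prems by (intro eq_vecI) auto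
    then show ?case using Suc subspD(3,4)[OF assms(1)] assms(3)[of k] by simp
  qed
  from this[of d] have "vec n (\<lambda>i. \<Sum>l<d. B $$ (i, l) * c $ l) \<in> W" by simp
  moreover have "vec n (\<lambda>i. \<Sum>l<d. B $$ (i, l) * c $ l) = B *\<^sub>v c"
    using assms(2,4) mult_mat_vec_index_sum[OF assms(2,4)] by (intro eq_vecI) auto
  ultimately show ?thesis by simp
qed

text \<open>A basis of \<open>E\<close> modulo \<open>N\<close>, made of vectors of \<open>E\<close> with leading positions outside \<open>piv n N\<close>.\<close>

lemma relative_basis:
  assumes N: "subsp n N" and E: "subsp n E" and "N \<subseteq> E" and d: "d = card (piv n E - piv n N)"
  shows "\<exists>B\<in>carrier_mat n d. (\<forall>c\<in>carrier_vec d. B *\<^sub>v c \<in> E) \<and>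
    (\<forall>v\<in>E. \<exists>c\<in>carrier_vec d. v - B *\<^sub>v c \<in> N) \<and> (\<forall>c\<in>carrier_vec d. B *\<^sub>v c \<in> N \<longrightarrow> c = 0\<^sub>v d)"
proof -
  \<comment> \<open>Listing the positions in increasing order puts the matrix \<open>B\<close> below
    into echelon form.\<close>
  define js where "js = sorted_list_of_set (piv n E - piv n N)"
  have fin: "finite (piv n E - piv n N)" using finite_piv by auto
  have js: "length js = d" "set js = piv n E - piv n N" "sorted_wrt (<) js"
    using fin unfolding js_def d by auto
  have js_less: "js ! l < js ! l'" if "l < l'" "l' < d" for l l'
    using sorted_wrt_nth_less[OF js(3) that(1)] that(2) js(1) by simp
  have js_mem: "js ! l \<in> piv n E - piv n N" if "l < d" for l
    using nth_mem[of l js] that js(1,2) by simp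
  have "\<forall>l\<in>{..<d}. \<exists>v. v \<in> E \<and> v $ (js ! l) = 1 \<and> (\<forall>i<n. js ! l < i \<longrightarrow> v $ i = 0)"
  proof
    fix l assume "l \<in> {..<d}"
    then have "js ! l \<in> piv n E" using js_mem[of l] by simp
    then show "\<exists>v. v \<in> E \<and> v $ (js ! l) = 1 \<and> (\<forall>i<n. js ! l < i \<longrightarrow> v $ i = 0)"
      unfolding piv_def Bex_def by simp
  qed
  then obtain e where "\<forall>l\<in>{..<d}. e l \<in> E \<and> e l $ (js ! l) = 1 \<and> (\<forall>i<n. js ! l < i \<longrightarrow> e l $ i = 0)"
    by (elim bchoice[THEN exE])
  then have e: "e l \<in> E" "e l $ (js ! l) = 1" "\<And>i. i < n \<Longrightarrow> js ! l < i \<Longrightarrow> e l $ i = 0" if "l < d" for l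
    using that by auto
  define B where "B = mat n d (\<lambda>(i, l). e l $ i)"
  have B: "B \<in> carrier_mat n d" unfolding B_def by simp
  have col: "col B l = e l" if "l < d" for l
    unfolding B_def by (rule col_mat_vec[of e l n d, OF subspD(1)[OF E e(1)[OF that]] that])
  have BE: "B *\<^sub>v c \<in> E" if "c \<in> carrier_vec d" for c
    using subsp_mult_mat_vec[OF E B _ that] col e(1) by simp
  \<comment> \<open>The last nonzero coefficient \<open>c $ m\<close> makes \<open>js ! m\<close>
    the leading position of \<open>B *\<^sub>v c\<close>; this position was chosen outside
    \<open>piv n N\<close>.\<close>
  have inj: "c = 0\<^sub>v d" if c: "c \<in> carrier_vec d" "B *\<^sub>v c \<in> N" for c
  proof (rule ccontr)
    assume "c \<noteq> 0\<^sub>v d"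
    then have "\<exists>l<d. c $ l \<noteq> 0" using c(1) by (auto simp: vec_eq_iff)
    then have ne: "{l. l < d \<and> c $ l \<noteq> 0} \<noteq> {}" by auto
    define m where "m = Max {l. l < d \<and> c $ l \<noteq> 0}"
    have m: "m < d" "c $ m \<noteq> 0" using Max_in[OF _ ne] unfolding m_def by auto
    have m_max: "c $ l = 0" if "l < d" "m < l" for l
    proof (rule ccontr)
      assume "c $ l \<noteq> 0"
      then have "l \<le> m" unfolding m_def using that(1) by (intro Max_ge) auto
      then show False using that(2) by simp
    qed
    have jm: "js ! m < n" using js_mem[OF m(1)] piv_lessThan[of n E] by auto
    have Bc: "(B *\<^sub>v c) $ i = (\<Sum>l<d. e l $ i * c $ l)" if "i < n" for i
      using mult_mat_vec_index_sum[OF B c(1) that] that unfolding B_def by simp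
    have term0: "e l $ i * c $ l = 0" if "l < d" "l \<noteq> m" "i < n" "js ! m \<le> i" for l i
    proof (cases "l < m")
      case True
      then show ?thesis using e(3)[OF that(1,3)] js_less[OF True m(1)] that(4) by simp
    next
      case False
      then show ?thesis using m_max[OF that(1)] that(2) by simp
    qed
    have Bc_m: "(B *\<^sub>v c) $ i = e m $ i * c $ m" if "i < n" "js ! m \<le> i" for i
    proof -
      have "(\<Sum>l<d. e l $ i * c $ l) = (\<Sum>l\<in>{m}. e l $ i * c $ l)"
        using m(1) term0[OF _ _ that] by (intro sum.mono_neutral_right) auto
      then show ?thesis using Bc[OF that(1)] by simp
    qed
    have "js ! m \<in> piv n N"
    proof (rule pivI[OF N c(2) jm])
      show "(B *\<^sub>v c) $ (js ! m) \<noteq> 0" using Bc_m[OF jm] e(2)[OF m(1)] m(2) by simp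
      show "(B *\<^sub>v c) $ i = 0" if "i < n" "js ! m < i" for i
        using Bc_m[of i] e(3)[OF m(1), of i] that by simp
    qed
    then show False using js_mem[OF m(1)] by simp
  qed
  \<comment> \<open>Reduction from the last nonzero entry downwards: a leading position in
    \<open>piv n N\<close> is cleared by a vector of \<open>N\<close>, any other one by a column of
    \<open>B\<close>, whose coefficient is recorded in \<open>c\<close>.\<close>
  have "\<exists>c\<in>carrier_vec d. v - B *\<^sub>v c \<in> N" if "k \<le> n" "v \<in> E" "\<And>i. i < n \<Longrightarrow> k \<le> i \<Longrightarrow> v $ i = 0" for k v
    using that
  proof (induction k arbitrary: v)
    case 0
    then have "v - B *\<^sub>v 0\<^sub>v d = 0\<^sub>v n" using subspD(1)[OF E 0(2)] B by (intro eq_vecI) auto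
    then show ?case using subspD(2)[OF N] by (intro bexI[of _ "0\<^sub>v d"]) auto
  next
    case (Suc k)
    have dv: "v \<in> carrier_vec n" using subspD(1)[OF E Suc.prems(2)] .
    show ?case
    proof (cases "v $ k = 0")
      case True
      show ?thesis
      proof (rule Suc.IH)
        show "v $ i = 0" if "i < n" "k \<le> i" for i
          using that Suc.prems(3)[of i] True by (cases "i = k") auto
      qed (use Suc.prems in auto)
    next
      case False
      have kE: "k \<in> piv n E" by (rule pivI[OF E Suc.prems(2)]) (use Suc.prems False in auto)
      have step: "\<exists>c\<in>carrier_vec d. (v - v $ k \<cdot>\<^sub>v w) - B *\<^sub>v c \<in> N"
        if w: "w \<in> E" "w $ k = 1" "\<And>i. i < n \<Longrightarrow> k < i \<Longrightarrow> w $ i = 0" for w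
      proof (rule Suc.IH)
        show "v - v $ k \<cdot>\<^sub>v w \<in> E" using w(1) Suc.prems(2) subspD(4)[OF E] by (intro subsp_minus[OF E]) auto
        show "(v - v $ k \<cdot>\<^sub>v w) $ i = 0" if "i < n" "k \<le> i" for i
          using that Suc.prems(3)[of i] w dv subspD(1)[OF E w(1)] by (cases "i = k") auto
      qed (use Suc.prems in auto)
      show ?thesis
      proof (cases "k \<in> piv n N")
        case True
        then obtain w where w: "w \<in> N" "w $ k = 1" "\<forall>i<n. k < i \<longrightarrow> w $ i = 0" unfolding piv_def by auto
        obtain c where c: "c \<in> carrier_vec d" "(v - v $ k \<cdot>\<^sub>v w) - B *\<^sub>v c \<in> N"
          using step[of w] w assms(3) by auto
        have "v - B *\<^sub>v c = ((v - v $ k \<cdot>\<^sub>v w) - B *\<^sub>v c) + v $ k \<cdot>\<^sub>v w"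
          using dv subspD(1)[OF N w(1)] B c(1) by (intro eq_vecI) auto
        then have "v - B *\<^sub>v c \<in> N" using subspD(3)[OF N c(2) subspD(4)[OF N w(1)]] by simp
        then show ?thesis using c(1) by blast
      next
        case False
        then obtain l where l: "l < d" "js ! l = k"
          using kE js(1,2) in_set_conv_nth[of k js] by auto
        obtain c where c: "c \<in> carrier_vec d" "(v - v $ k \<cdot>\<^sub>v e l) - B *\<^sub>v c \<in> N"
          using step[of "e l"] e[OF l(1)] l(2) by auto
        let ?c = "c + v $ k \<cdot>\<^sub>v unit_vec d l"
        have "B *\<^sub>v ?c = B *\<^sub>v c + v $ k \<cdot>\<^sub>v e l"
          using mult_add_distrib_mat_vec[OF B c(1)] mult_mat_vec[OF B unit_vec_carrier]
            mult_mat_unit_vec[OF B l(1)] col[OF l(1)] by simp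
        then have "v - B *\<^sub>v ?c = (v - v $ k \<cdot>\<^sub>v e l) - B *\<^sub>v c"
          using dv subspD(1)[OF E e(1)[OF l(1)]] B c(1) by (intro eq_vecI) auto
        then show ?thesis using c by (intro bexI[of _ ?c]) auto
      qed
    qed
  qed
  from this[of n] have "\<forall>v\<in>E. \<exists>c\<in>carrier_vec d. v - B *\<^sub>v c \<in> N" by simp
  then show ?thesis using B BE inj by blast
qed

text \<open>Connects the rank of the library with explicit bases: the rank depends only on the
  column space, and \<open>J\<close> has \<open>d\<close> independent columns spanning the same
  space.\<close>

lemma rank_eq_dim_col:
  assumes A: "A \<in> carrier_mat m k" and J: "J \<in> carrier_mat m d"
    and inj: "\<And>c. c \<in> carrier_vec d \<Longrightarrow> J *\<^sub>v c = 0\<^sub>v m \<Longrightarrow> c = (0\<^sub>v d :: 'k::field vec)"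
    and eq: "(*\<^sub>v) A ` carrier_vec k = (*\<^sub>v) J ` carrier_vec d"
  shows "vec_space.rank m A = d"
proof -
  interpret vec_space "TYPE('k)" m .
  have "{y\<in>carrier_vec (dim_row M). \<exists>x\<in>carrier_vec (dim_col M). M *\<^sub>v x = y} = (*\<^sub>v) M ` carrier_vec q"
    if "M \<in> carrier_mat m q" for M :: "'k mat" and q
    using that by (auto intro: mult_mat_vec_carrier)
  note range_eq = this
  have "col_space A = col_space J"
    unfolding col_space_eq[OF A] col_space_eq[OF J] range_eq[OF A] range_eq[OF J] by (rule eq)
  then have "rank A = rank J" unfolding rank_def col_space_def by simp
  also have "rank J = d"
  proof -
    have dist: "distinct (cols J)"
    proof (rule ccontr)
      assume "\<not> distinct (cols J)"
      then obtain i j where ij: "i < d" "j < d" "i \<noteq> j" "col J i = col J j"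
        using J unfolding distinct_conv_nth by auto
      have "J *\<^sub>v (unit_vec d i - unit_vec d j) = J *\<^sub>v unit_vec d i - J *\<^sub>v unit_vec d j"
        using mult_minus_distrib_mat_vec[OF J] by simp
      also have "\<dots> = 0\<^sub>v m"
        using mult_mat_unit_vec[OF J] ij J by simp
      finally have "unit_vec d i - unit_vec d j = (0\<^sub>v d :: 'k vec)" by (intro inj) auto
      then have "(unit_vec d i - unit_vec d j) $ i = (0 :: 'k)" using ij by simp
      then show False using ij by (simp add: unit_vec_def)
    qed
    have "lin_indpt (set (cols J))"
    proof
      assume "lin_dep (set (cols J))"
      then show False by (rule lin_depE[OF J _ dist]) (use inj in auto)
    qed
    then show ?thesis by (rule lin_indpt_full_rank[OF J dist])
  qed
  finally show ?thesis .
qed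

text \<open>The image of \<open>p * i\<close> is isomorphic to \<open>E\<close> modulo
  \<open>E \<inter> N\<close>: applying \<open>p\<close> to a basis of \<open>E\<close> modulo
  \<open>E \<inter> N\<close> gives a basis of the image.\<close>

lemma rank_mult:
  assumes p: "p \<in> carrier_mat m n" and i: "i \<in> carrier_mat n k"
    and "E = (*\<^sub>v) i ` carrier_vec k" and "N = {v\<in>carrier_vec n. p *\<^sub>v v = (0\<^sub>v m :: 'k::field vec)}"
  shows "vec_space.rank m (p * i) = card (piv n E - piv n (E \<inter> N))"
proof -
  let ?d = "card (piv n E - piv n (E \<inter> N))"
  have E: "subsp n E" unfolding assms(3) by (rule subsp_image[OF subsp_carrier i])
  have N: "subsp n N" using subsp_preimage[OF subsp_zero p] unfolding assms(4) by simp
  obtain B where B: "B \<in> carrier_mat n ?d" and BE: "\<forall>c\<in>carrier_vec ?d. B *\<^sub>v c \<in> E"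
    and ex: "\<forall>v\<in>E. \<exists>c\<in>carrier_vec ?d. v - B *\<^sub>v c \<in> E \<inter> N"
    and inj: "\<forall>c\<in>carrier_vec ?d. B *\<^sub>v c \<in> E \<inter> N \<longrightarrow> c = 0\<^sub>v ?d"
    using relative_basis[OF subsp_int[OF E N] E _ refl] by auto
  show ?thesis
  proof (rule rank_eq_dim_col)
    show "p * i \<in> carrier_mat m k" "p * B \<in> carrier_mat m ?d" using p i B by auto
    show "c = 0\<^sub>v ?d" if "c \<in> carrier_vec ?d" "p * B *\<^sub>v c = 0\<^sub>v m" for c
    proof -
      have "B *\<^sub>v c \<in> E" using BE that(1) by simp
      moreover have "p *\<^sub>v (B *\<^sub>v c) = 0\<^sub>v m" using that assoc_mult_mat_vec[OF p B that(1)] by simp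
      ultimately have "B *\<^sub>v c \<in> E \<inter> N" unfolding assms(4) using subspD(1)[OF E] by auto
      then show ?thesis using inj that(1) by simp
    qed
    show "(*\<^sub>v) (p * i) ` carrier_vec k = (*\<^sub>v) (p * B) ` carrier_vec ?d"
    proof (intro equalityI image_subsetI)
      fix u :: "'k vec" assume u: "u \<in> carrier_vec k"
      have iu: "i *\<^sub>v u \<in> E" unfolding assms(3) using u by simp
      then obtain c where c: "c \<in> carrier_vec ?d" "i *\<^sub>v u - B *\<^sub>v c \<in> E \<inter> N" using ex by auto
      have "p *\<^sub>v (i *\<^sub>v u) - p *\<^sub>v (B *\<^sub>v c) = 0\<^sub>v m"
        using c(2) mult_minus_distrib_mat_vec[OF p subspD(1)[OF E iu], of "B *\<^sub>v c"] B c(1)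
        unfolding assms(4) by simp
      then have *: "(p *\<^sub>v (i *\<^sub>v u) - p *\<^sub>v (B *\<^sub>v c)) $ j = 0" if "j < m" for j using that by simp
      have "p *\<^sub>v (i *\<^sub>v u) = p *\<^sub>v (B *\<^sub>v c)"
      proof (rule eq_vecI)
        fix j assume "j < dim_vec (p *\<^sub>v (B *\<^sub>v c))"
        then show "(p *\<^sub>v (i *\<^sub>v u)) $ j = (p *\<^sub>v (B *\<^sub>v c)) $ j" using *[of j] p by simp
      qed (use p in simp)
      then have "(p * i) *\<^sub>v u = (p * B) *\<^sub>v c"
        using assoc_mult_mat_vec[OF p i u] assoc_mult_mat_vec[OF p B c(1)] by simp
      then show "(p * i) *\<^sub>v u \<in> (*\<^sub>v) (p * B) ` carrier_vec ?d" using c(1) by auto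
    next
      fix c :: "'k vec" assume c: "c \<in> carrier_vec ?d"
      then obtain u where u: "u \<in> carrier_vec k" "B *\<^sub>v c = i *\<^sub>v u" using BE assms(3) by auto
      then have "(p * B) *\<^sub>v c = (p * i) *\<^sub>v u"
        using assoc_mult_mat_vec[OF p i u(1)] assoc_mult_mat_vec[OF p B c] by simp
      then show "(p * B) *\<^sub>v c \<in> (*\<^sub>v) (p * i) ` carrier_vec k" using u(1) by auto
    qed
  qed
qed

text \<open>The columns of \<open>H\<close> are preimages under \<open>C\<close> of the columns of
  \<open>B\<close>.\<close>

lemma factor_left:
  assumes B: "B \<in> carrier_mat n k" and C: "C \<in> carrier_mat n m"
    and ex: "\<And>v. v \<in> carrier_vec k \<Longrightarrow> \<exists>w\<in>carrier_vec m. B *\<^sub>v v = C *\<^sub>v (w :: 'k::field vec)"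
  shows "\<exists>H\<in>carrier_mat m k. B = C * H"
proof -
  have "\<forall>j. \<exists>w. w \<in> carrier_vec m \<and> B *\<^sub>v unit_vec k j = C *\<^sub>v w"
    using ex[OF unit_vec_carrier] unfolding Bex_def by blast
  then obtain w where "\<forall>j. w j \<in> carrier_vec m \<and> B *\<^sub>v unit_vec k j = C *\<^sub>v w j"
    by (elim choice[THEN exE])
  then have w: "\<And>j. w j \<in> carrier_vec m" "\<And>j. B *\<^sub>v unit_vec k j = C *\<^sub>v w j" by auto
  define H where "H = mat m k (\<lambda>(i, j). w j $ i)"
  have H: "H \<in> carrier_mat m k" unfolding H_def by simp
  have "B = C * H"
  proof (rule mat_col_eqI)
    fix j assume "j < dim_col (C * H)"
    then have j: "j < k" using H by simp
    have "col H j = w j" unfolding H_def by (rule col_mat_vec[of w j m k, OF w(1) j])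
    then have "col (C * H) j = C *\<^sub>v w j" using col_mult2[OF C H j] by simp
    then show "col B j = col (C * H) j" using w(2)[of j] mult_mat_unit_vec[OF B j] by simp
  qed (use B C H in auto)
  then show ?thesis using H by blast
qed

text \<open>Take a right inverse \<open>s\<close> of \<open>p\<close>. Then \<open>v\<close> and
  \<open>s *\<^sub>v (p *\<^sub>v v)\<close> differ by an element of the kernel of \<open>p\<close>,
  which \<open>B\<close> kills, so \<open>B * s\<close> is the required factor.\<close>

lemma factor_right:
  assumes p: "p \<in> carrier_mat m n" and B: "B \<in> carrier_mat k n"
    and surj: "\<And>w. w \<in> carrier_vec m \<Longrightarrow> \<exists>v\<in>carrier_vec n. w = p *\<^sub>v v"
    and ker: "\<And>v. v \<in> carrier_vec n \<Longrightarrow> p *\<^sub>v v = 0\<^sub>v m \<Longrightarrow> B *\<^sub>v v = (0\<^sub>v k :: 'k::field vec)"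
  shows "\<exists>H\<in>carrier_mat k m. B = H * p"
proof -
  have "\<exists>s\<in>carrier_mat n m. 1\<^sub>m m = p * s"
    using surj by (intro factor_left[OF one_carrier_mat p]) simp
  then obtain s where s: "s \<in> carrier_mat n m" "1\<^sub>m m = p * s" by blast
  have "B = (B * s) * p"
  proof (rule mat_eqI_vec)
    show "B \<in> carrier_mat k n" "(B * s) * p \<in> carrier_mat k n" using B s p by auto
    fix v :: "'k vec" assume v: "v \<in> carrier_vec n"
    have pv: "p *\<^sub>v v \<in> carrier_vec m" and spv: "s *\<^sub>v (p *\<^sub>v v) \<in> carrier_vec n" using p s(1) v by auto
    have "p *\<^sub>v (s *\<^sub>v (p *\<^sub>v v)) = p *\<^sub>v v"
      using assoc_mult_mat_vec[OF p s(1) pv] one_mult_mat_vec[OF pv] by (simp add: s(2)[symmetric])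
    then have "p *\<^sub>v (v - s *\<^sub>v (p *\<^sub>v v)) = 0\<^sub>v m"
      using mult_minus_distrib_mat_vec[OF p v spv] pv by simp
    then have "B *\<^sub>v (v - s *\<^sub>v (p *\<^sub>v v)) = 0\<^sub>v k" using v spv by (intro ker) auto
    then have *: "B *\<^sub>v v - B *\<^sub>v (s *\<^sub>v (p *\<^sub>v v)) = 0\<^sub>v k" using mult_minus_distrib_mat_vec[OF B v spv] by simp
    have "B *\<^sub>v v = B *\<^sub>v (s *\<^sub>v (p *\<^sub>v v))"
    proof (rule eq_vecI)
      fix j assume "j < dim_vec (B *\<^sub>v (s *\<^sub>v (p *\<^sub>v v)))"
      then show "(B *\<^sub>v v) $ j = (B *\<^sub>v (s *\<^sub>v (p *\<^sub>v v))) $ j" using arg_cong[OF *, of "\<lambda>x. x $ j"] B by simp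
    qed simp
    also have "\<dots> = ((B * s) * p) *\<^sub>v v"
      using assoc_mult_mat_vec[OF B s(1) pv] assoc_mult_mat_vec[OF mult_carrier_mat[OF B s(1)] p v] by simp
    finally show "B *\<^sub>v v = ((B * s) * p) *\<^sub>v v" .
  qed
  then show ?thesis using B s(1) by (intro bexI[of _ "B * s"]) auto
qed

lemma mat_inj_iff:
  assumes "A \<in> carrier_mat m n"
  shows "mat_inj A \<longleftrightarrow> (\<forall>v\<in>carrier_vec n. A *\<^sub>v v = 0\<^sub>v m \<longrightarrow> v = (0\<^sub>v n :: 'k::field vec))"
proof
  assume inj: "mat_inj A"
  show "\<forall>v\<in>carrier_vec n. A *\<^sub>v v = 0\<^sub>v m \<longrightarrow> v = 0\<^sub>v n"
  proof (intro ballI impI)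
    fix v assume v: "v \<in> carrier_vec n" "A *\<^sub>v v = 0\<^sub>v m"
    have "A *\<^sub>v 0\<^sub>v n = 0\<^sub>v m" using assms by (intro eq_vecI) auto
    then show "v = 0\<^sub>v n" using inj v assms unfolding mat_inj_def inj_on_def by auto
  qed
next
  assume ker: "\<forall>v\<in>carrier_vec n. A *\<^sub>v v = 0\<^sub>v m \<longrightarrow> v = 0\<^sub>v n"
  show "mat_inj A" unfolding mat_inj_def
  proof (rule inj_onI)
    fix v w assume "v \<in> carrier_vec (dim_col A)" "w \<in> carrier_vec (dim_col A)" and eq: "A *\<^sub>v v = A *\<^sub>v w"
    then have vw: "v \<in> carrier_vec n" "w \<in> carrier_vec n" using assms by auto
    have "A *\<^sub>v (v - w) = 0\<^sub>v m"
      using mult_minus_distrib_mat_vec[OF assms vw] eq assms vw by simp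
    then have *: "v - w = 0\<^sub>v n" using ker vw by simp
    show "v = w"
    proof (rule eq_vecI)
      fix j assume "j < dim_vec w"
      then show "v $ j = w $ j" using arg_cong[OF *, of "\<lambda>x. x $ j"] vw by simp
    qed (use vw in simp)
  qed
qed

lemma mat_surj_iff:
  assumes "A \<in> carrier_mat m n"
  shows "mat_surj A \<longleftrightarrow> (\<forall>w\<in>carrier_vec m. \<exists>v\<in>carrier_vec n. w = A *\<^sub>v v)"
proof -
  have "(*\<^sub>v) A ` carrier_vec n \<subseteq> carrier_vec m" using assms by (intro image_subsetI mult_mat_vec_carrier)
  moreover have "dim_row A = m" "dim_col A = n" using assms by auto
  ultimately show ?thesis unfolding mat_surj_def by auto
qed

lemma ex_mat_inj_range:
  assumes "subsp n E"
  shows "\<exists>d. \<exists>i\<in>carrier_mat n d. mat_inj i \<and> (*\<^sub>v) i ` carrier_vec d = E"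
proof -
  obtain d where d: "d = card (piv n E - piv n {0\<^sub>v n :: 'a vec})" by simp
  obtain B where B: "B \<in> carrier_mat n d" and BE: "\<forall>c\<in>carrier_vec d. B *\<^sub>v c \<in> E"
    and ex: "\<forall>v\<in>E. \<exists>c\<in>carrier_vec d. v - B *\<^sub>v c \<in> {0\<^sub>v n}"
    and inj: "\<forall>c\<in>carrier_vec d. B *\<^sub>v c \<in> {0\<^sub>v n} \<longrightarrow> c = 0\<^sub>v d"
    using relative_basis[OF subsp_zero assms _ d] subspD(2)[OF assms] by auto
  have "v \<in> (*\<^sub>v) B ` carrier_vec d" if v: "v \<in> E" for v
  proof -
    obtain c where c: "c \<in> carrier_vec d" "v - B *\<^sub>v c = 0\<^sub>v n" using ex v by auto
    have "v = B *\<^sub>v c"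
    proof (rule eq_vecI)
      fix j assume "j < dim_vec (B *\<^sub>v c)"
      then show "v $ j = (B *\<^sub>v c) $ j" using arg_cong[OF c(2), of "\<lambda>x. x $ j"] subspD(1)[OF assms v] B by simp
    qed (use subspD(1)[OF assms v] B in simp)
    then show ?thesis using c(1) by simp
  qed
  then have "(*\<^sub>v) B ` carrier_vec d = E" using BE by auto
  then show ?thesis using B inj mat_inj_iff[OF B] by auto
qed

text \<open>\<open>J\<close> is a basis of a complement of \<open>N\<close>, and \<open>p\<close>
  reads off the coordinates with respect to \<open>J\<close> of a vector modulo
  \<open>N\<close>.\<close>

lemma ex_mat_surj_kernel:
  fixes N :: "'k::field vec set"
  assumes N: "subsp n N"
  shows "\<exists>d. \<exists>p\<in>carrier_mat d n. mat_surj p \<and> N = {v\<in>carrier_vec n. p *\<^sub>v v = 0\<^sub>v d}"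
proof -
  obtain d where d: "d = card (piv n (carrier_vec n :: 'k vec set) - piv n N)" by simp
  have "N \<subseteq> carrier_vec n" using subspD(1)[OF N] by auto
  then obtain J where J: "J \<in> carrier_mat n d"
    and ex: "\<forall>v\<in>carrier_vec n. \<exists>c\<in>carrier_vec d. v - J *\<^sub>v c \<in> N"
    and inj: "\<forall>c\<in>carrier_vec d. J *\<^sub>v c \<in> N \<longrightarrow> c = 0\<^sub>v d"
    using relative_basis[OF N subsp_carrier _ d] by auto
  have "\<forall>j. \<exists>c. c \<in> carrier_vec d \<and> unit_vec n j - J *\<^sub>v c \<in> N"
    using ex unit_vec_carrier unfolding Bex_def by blast
  then obtain c where "\<forall>j. c j \<in> carrier_vec d \<and> unit_vec n j - J *\<^sub>v c j \<in> N"
    by (elim choice[THEN exE])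
  then have c: "c j \<in> carrier_vec d" "unit_vec n j - J *\<^sub>v c j \<in> N" for j by auto
  define p where "p = mat d n (\<lambda>(i, j). c j $ i)"
  have p: "p \<in> carrier_mat d n" unfolding p_def by simp
  have col: "col p j = c j" if "j < n" for j
    unfolding p_def by (rule col_mat_vec[of c j d n, OF c(1) that])
  \<comment> \<open>The projection onto \<open>N\<close> along the range of \<open>J\<close>; by
    linearity its range lies in \<open>N\<close> as soon as its columns do.\<close>
  let ?D = "1\<^sub>m n - J * p"
  have D: "?D \<in> carrier_mat n n" by (rule minus_carrier_mat[OF mult_carrier_mat[OF J p]])
  have Dv: "?D *\<^sub>v v = v - J *\<^sub>v (p *\<^sub>v v)" if "v \<in> carrier_vec n" for v
    using minus_mult_distrib_mat_vec[OF one_carrier_mat mult_carrier_mat[OF J p] that]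
      assoc_mult_mat_vec[OF J p that] that by simp
  have colD: "col ?D j \<in> N" if j: "j < n" for j
    using mult_mat_unit_vec[OF D j] Dv[OF unit_vec_carrier, of j] mult_mat_unit_vec[OF p j] col[OF j] c(2)[of j] by simp
  have DN: "v - J *\<^sub>v (p *\<^sub>v v) \<in> N" if "v \<in> carrier_vec n" for v
    using subsp_mult_mat_vec[OF N D colD that] Dv[OF that] by simp
  have pJ: "p *\<^sub>v (J *\<^sub>v e) = e" if e: "e \<in> carrier_vec d" for e
  proof -
    have Je: "J *\<^sub>v e \<in> carrier_vec n" and pJe: "p *\<^sub>v (J *\<^sub>v e) \<in> carrier_vec d" using J p e by auto
    have "J *\<^sub>v (e - p *\<^sub>v (J *\<^sub>v e)) = J *\<^sub>v e - J *\<^sub>v (p *\<^sub>v (J *\<^sub>v e))"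
      by (rule mult_minus_distrib_mat_vec[OF J e pJe])
    then have *: "e - p *\<^sub>v (J *\<^sub>v e) = 0\<^sub>v d" using DN[OF Je] inj e pJe by simp
    show ?thesis
    proof (rule eq_vecI)
      fix j assume "j < dim_vec e"
      then show "(p *\<^sub>v (J *\<^sub>v e)) $ j = e $ j" using arg_cong[OF *, of "\<lambda>x. x $ j"] p e by simp
    qed (use p e in simp)
  qed
  have "mat_surj p" unfolding mat_surj_iff[OF p]
  proof
    fix w :: "'k vec" assume w: "w \<in> carrier_vec d"
    show "\<exists>v\<in>carrier_vec n. w = p *\<^sub>v v"
      by (rule bexI[of _ "J *\<^sub>v w"]) (use pJ[OF w] mult_mat_vec_carrier[OF J w] in auto)
  qed
  moreover have "N = {v\<in>carrier_vec n. p *\<^sub>v v = 0\<^sub>v d}"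
  proof (intro equalityI subsetI)
    fix v assume v: "v \<in> N"
    have vn: "v \<in> carrier_vec n" using subspD(1)[OF N v] .
    have pv: "p *\<^sub>v v \<in> carrier_vec d" and Jpv: "J *\<^sub>v (p *\<^sub>v v) \<in> carrier_vec n" using J p vn by auto
    have "v - (v - J *\<^sub>v (p *\<^sub>v v)) = J *\<^sub>v (p *\<^sub>v v)" using vn Jpv by (intro eq_vecI) auto
    then have "J *\<^sub>v (p *\<^sub>v v) \<in> N" using subsp_minus[OF N v DN[OF vn]] by simp
    then show "v \<in> {v\<in>carrier_vec n. p *\<^sub>v v = 0\<^sub>v d}" using inj pv vn by simp
  next
    fix v assume v: "v \<in> {v\<in>carrier_vec n. p *\<^sub>v v = 0\<^sub>v d}"
    have "J *\<^sub>v 0\<^sub>v d = 0\<^sub>v n" using J by (intro eq_vecI) auto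
    then have "v - J *\<^sub>v (p *\<^sub>v v) = v" using v by simp
    then show "v \<in> N" using DN[of v] v by simp
  qed
  ultimately show ?thesis by (intro exI[of _ d] bexI[OF _ p] conjI)
qed

section \<open>The largest surjective subrepresentation and the largest injective quotient\<close>

lemma quiverD:
  assumes "quiver Q"
  shows "finite (arcs Q)" "finite (verts Q)" "verts Q \<noteq> {}"
    "a \<in> arcs Q \<Longrightarrow> head Q a \<in> verts Q" "a \<in> arcs Q \<Longrightarrow> tail Q a \<in> verts Q"
proof -
  interpret fin_digraph Q using assms unfolding quiver_def by simp
  show "finite (arcs Q)" "finite (verts Q)" by auto
  show "a \<in> arcs Q \<Longrightarrow> head Q a \<in> verts Q" "a \<in> arcs Q \<Longrightarrow> tail Q a \<in> verts Q" by auto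
  have "Digraph_Component.connected Q" using assms unfolding quiver_def by simp
  then show "verts Q \<noteq> {}"
    unfolding Digraph_Component.connected_def strongly_connected_def by simp
qed

lemma connected_constant:
  assumes "quiver Q" "\<And>a. a \<in> arcs Q \<Longrightarrow> f (tail Q a) = f (head Q a)" "u \<in> verts Q" "v \<in> verts Q"
  shows "f u = f v"
proof -
  interpret fin_digraph Q using assms(1) unfolding quiver_def by simp
  have "Digraph_Component.connected Q" using assms(1) unfolding quiver_def by simp
  then have "u \<rightarrow>\<^sup>*\<^bsub>mk_symmetric Q\<^esub> v"
    using assms(3,4) unfolding Digraph_Component.connected_def strongly_connected_def by simp
  then have "(u, v) \<in> rtrancl_on (verts Q) (arcs_ends (mk_symmetric Q))"
    unfolding reachable_def by simp
  then show ?thesis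
  proof (induction rule: rtrancl_on_induct)
    case (step y z)
    then have "\<exists>a\<in>arcs Q. {y, z} = {tail Q a, head Q a}"
      unfolding mk_symmetric_def by (auto simp: arcs_ends_def arc_to_ends_def)
    then show ?case using step.IH assms(2) by (auto simp: doubleton_eq_iff)
  qed simp
qed

section \<open>Iteration to a common fixed point and the two kinds of steps\<close>

lemma fold_funpow_invariant:
  assumes "\<And>s W. s \<in> set os \<Longrightarrow> I W \<Longrightarrow> I (st s W)" "I W0"
  shows "I ((fold st os ^^ n) W0)"
proof -
  have "I (fold st os W)" if "I W" for W
    using that assms(1) by (induction os arbitrary: W) auto
  then show ?thesis using assms(2) by (induction n) auto
qed

text \<open>A round that changes anything lowers \<open>m\<close>, since after the first strict step
  the rest of the round cannot raise it again. The number of rounds is fixed in advance, instead of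
  iterating until nothing changes, because the same number has to serve all points of a
  family.\<close>

lemma fold_funpow_stable:
  fixes m :: "'w \<Rightarrow> nat"
  assumes inv: "\<And>s W. s \<in> set os \<Longrightarrow> I W \<Longrightarrow> I (st s W)"
    and strict: "\<And>s W. s \<in> set os \<Longrightarrow> I W \<Longrightarrow> st s W = W \<or> m (st s W) < m W"
    and "I W0" "m W0 \<le> n"
  shows "\<forall>s\<in>set os. st s ((fold st os ^^ n) W0) = (fold st os ^^ n) W0"
proof -
  have fold: "(\<forall>s\<in>set os'. st s W = W) \<or> m (fold st os' W) < m W"
    if "I W" "set os' \<subseteq> set os" for W os'
    using that
  proof (induction os' arbitrary: W)
    case (Cons s os')
    show ?case
    proof (cases "st s W = W")
      case True
      then show ?thesis using Cons.IH[of W] Cons.prems by auto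
    next
      case False
      then have "m (st s W) < m W" using strict[of s W] Cons.prems by auto
      moreover have "m (fold st os' (st s W)) \<le> m (st s W)"
      proof -
        have "fold st os' W' = W'" if "\<forall>s\<in>set os'. st s W' = W'" for W'
          using that by (induction os') auto
        then show ?thesis using Cons.IH[of "st s W"] inv[of s W] Cons.prems by fastforce
      qed
      ultimately show ?thesis by simp
    qed
  qed simp
  have fix_pow: "(fold st os ^^ n) W = W" if "\<forall>s\<in>set os. st s W = W" for n W
  proof -
    have "fold st os' W = W" if "set os' \<subseteq> set os" for os'
      using that \<open>\<forall>s\<in>set os. st s W = W\<close> by (induction os') auto
    then show ?thesis by (induction n) auto
  qed
  have I_fold: "I (fold st os W)" if "I W" for W
    using fold_funpow_invariant[of os I st W 1] inv that by simp
  show ?thesis using assms(3,4)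
  proof (induction n arbitrary: W0)
    case 0
    then show ?case using strict[of _ W0] by auto
  next
    case (Suc n)
    show ?case
    proof (cases "\<forall>s\<in>set os. st s W0 = W0")
      case True
      show ?thesis unfolding fix_pow[OF True] by (rule True)
    next
      case False
      then have "m (fold st os W0) \<le> n" using fold[OF Suc.prems(1) subset_refl] Suc.prems(2) by auto
      from Suc.IH[OF I_fold[OF Suc.prems(1)] this] show ?thesis by (simp add: funpow_swap1)
    qed
  qed
qed

type_synonym 'k family = "nat \<Rightarrow> 'k vec set"

text \<open>The flag says where the step for an arrow acts: \<open>True\<close> at the tail,
  \<open>False\<close> at the head.\<close>

definition arc_ops :: "quiver \<Rightarrow> (nat \<times> bool) list" where
  "arc_ops Q = List.product (sorted_list_of_set (arcs Q)) [True, False]"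

text \<open>For each arrow the two steps enforce the two inclusions between the image of
  \<open>W (tail Q a)\<close> and \<open>W (head Q a)\<close>. A common fixed point is a
  subrepresentation with surjective arrow maps.\<close>

definition down_step :: "quiver \<Rightarrow> 'k::field rep \<Rightarrow> nat \<times> bool \<Rightarrow> 'k family \<Rightarrow> 'k family" where
  "down_step Q \<phi> = (\<lambda>(a, b) W. if b
     then W(tail Q a := W (tail Q a) \<inter> {v\<in>carrier_vec (dimv \<phi> (tail Q a)). mats \<phi> a *\<^sub>v v \<in> W (head Q a)})
     else W(head Q a := W (head Q a) \<inter> (*\<^sub>v) (mats \<phi> a) ` W (tail Q a)))"

text \<open>The dual enlargement. At a common fixed point a vector at the tail lies in the family
  exactly if its image at the head does, which says that the quotient has injective arrow
  maps.\<close>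

definition up_step :: "quiver \<Rightarrow> 'k::field rep \<Rightarrow> nat \<times> bool \<Rightarrow> 'k family \<Rightarrow> 'k family" where
  "up_step Q \<phi> = (\<lambda>(a, b) W. if b
     then W(tail Q a := vsum (W (tail Q a)) {v\<in>carrier_vec (dimv \<phi> (tail Q a)). mats \<phi> a *\<^sub>v v \<in> W (head Q a)})
     else W(head Q a := vsum (W (head Q a)) ((*\<^sub>v) (mats \<phi> a) ` W (tail Q a))))"

text \<open>The image of the largest surjective subrepresentation, and the kernel of the map to the
  largest injective quotient.\<close>

definition surj_part :: "quiver \<Rightarrow> 'k::field rep \<Rightarrow> 'k family" where
  "surj_part Q \<phi> = (fold (down_step Q \<phi>) (arc_ops Q) ^^ (\<Sum>x\<in>verts Q. dimv \<phi> x)) (\<lambda>x. carrier_vec (dimv \<phi> x))"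

definition inj_kernel :: "quiver \<Rightarrow> 'k::field rep \<Rightarrow> 'k family" where
  "inj_kernel Q \<phi> = (fold (up_step Q \<phi>) (arc_ops Q) ^^ (\<Sum>x\<in>verts Q. dimv \<phi> x)) (\<lambda>x. {0\<^sub>v (dimv \<phi> x)})"

definition subfam :: "quiver \<Rightarrow> 'k::field rep \<Rightarrow> 'k family \<Rightarrow> bool" where
  "subfam Q \<phi> W \<longleftrightarrow> (\<forall>x\<in>verts Q. subsp (dimv \<phi> x) (W x))"

lemma set_arc_ops: "finite (arcs Q) \<Longrightarrow> set (arc_ops Q) = arcs Q \<times> UNIV"
  unfolding arc_ops_def by auto

lemma subfam_upd: "subfam Q \<phi> W \<Longrightarrow> subsp (dimv \<phi> y) S \<Longrightarrow> subfam Q \<phi> (W(y := S))"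
  unfolding subfam_def by auto

lemma upd_smaller:
  assumes "subfam Q \<phi> W" "finite (verts Q)" "y \<in> verts Q" "subsp (dimv \<phi> y) S" "S \<subseteq> W y"
  shows "W(y := S) = W \<or> (\<Sum>x\<in>verts Q. card (piv (dimv \<phi> x) ((W(y := S)) x))) < (\<Sum>x\<in>verts Q. card (piv (dimv \<phi> x) (W x)))"
proof (cases "S = W y")
  case False
  have "card (piv (dimv \<phi> y) S) < card (piv (dimv \<phi> y) (W y))"
    using card_piv_less[OF assms(4), of "W y"] assms(1,3,5) False unfolding subfam_def by auto
  then have "(\<Sum>x\<in>verts Q. card (piv (dimv \<phi> x) ((W(y := S)) x))) < (\<Sum>x\<in>verts Q. card (piv (dimv \<phi> x) (W x)))"
    using assms(2,3) by (intro sum_strict_mono_ex1) auto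
  then show ?thesis by simp
qed simp

text \<open>Growing families are measured by their total codimension, so that both iterations
  decrease a natural number.\<close>

lemma upd_larger:
  assumes "subfam Q \<phi> W" "finite (verts Q)" "y \<in> verts Q" "subsp (dimv \<phi> y) S" "W y \<subseteq> S"
  shows "W(y := S) = W \<or> (\<Sum>x\<in>verts Q. dimv \<phi> x - card (piv (dimv \<phi> x) ((W(y := S)) x))) < (\<Sum>x\<in>verts Q. dimv \<phi> x - card (piv (dimv \<phi> x) (W x)))"
proof (cases "S = W y")
  case False
  have "card (piv (dimv \<phi> y) (W y)) < card (piv (dimv \<phi> y) S)"
    using card_piv_less[OF _ assms(4), of "W y"] assms(1,3,5) False unfolding subfam_def by auto
  moreover have "card (piv (dimv \<phi> y) S) \<le> dimv \<phi> y" by (rule card_piv_le)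
  ultimately have "dimv \<phi> y - card (piv (dimv \<phi> y) S) < dimv \<phi> y - card (piv (dimv \<phi> y) (W y))" by simp
  then have "(\<Sum>x\<in>verts Q. dimv \<phi> x - card (piv (dimv \<phi> x) ((W(y := S)) x))) < (\<Sum>x\<in>verts Q. dimv \<phi> x - card (piv (dimv \<phi> x) (W x)))"
    using assms(2,3) by (intro sum_strict_mono_ex1) auto
  then show ?thesis by simp
qed simp

lemma vsum_upper1:
  assumes "subsp n V" "subsp n W"
  shows "V \<subseteq> vsum V W"
proof
  fix v assume v: "v \<in> V"
  then have "v = v + 0\<^sub>v n" using subspD(1)[OF assms(1) v] by simp
  then show "v \<in> vsum V W" unfolding vsum_def using v subspD(2)[OF assms(2)] by blast
qed

lemma vsum_upper2:
  assumes "subsp n V" "subsp n W"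
  shows "W \<subseteq> vsum V W"
proof
  fix v assume v: "v \<in> W"
  then have "v = 0\<^sub>v n + v" using subspD(1)[OF assms(2) v] by simp
  then show "v \<in> vsum V W" unfolding vsum_def using v subspD(2)[OF assms(1)] by blast
qed

lemma vsum_least: "subsp n U \<Longrightarrow> V \<subseteq> U \<Longrightarrow> W \<subseteq> U \<Longrightarrow> vsum V W \<subseteq> U"
  unfolding vsum_def by (auto intro: subspD(3))

section \<open>Extremal properties of \<open>surj_part\<close> and \<open>inj_kernel\<close>\<close>

context
  fixes Q :: quiver and \<phi> :: "'k::field rep"
  assumes Q: "quiver Q" and rep: "is_rep Q \<phi>"
begin

private lemma rep_mat: "a \<in> arcs Q \<Longrightarrow> mats \<phi> a \<in> carrier_mat (dimv \<phi> (head Q a)) (dimv \<phi> (tail Q a))"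
  using rep unfolding is_rep_def by simp

private lemma parts_subsp:
  assumes "subfam Q \<phi> W" "a \<in> arcs Q"
  shows "subsp (dimv \<phi> (head Q a)) (W (head Q a))" "subsp (dimv \<phi> (tail Q a)) (W (tail Q a))"
    "subsp (dimv \<phi> (head Q a)) ((*\<^sub>v) (mats \<phi> a) ` W (tail Q a))"
    "subsp (dimv \<phi> (tail Q a)) {v\<in>carrier_vec (dimv \<phi> (tail Q a)). mats \<phi> a *\<^sub>v v \<in> W (head Q a)}"
proof -
  show 1: "subsp (dimv \<phi> (head Q a)) (W (head Q a))" and 2: "subsp (dimv \<phi> (tail Q a)) (W (tail Q a))"
    using assms quiverD(4,5)[OF Q] unfolding subfam_def by auto
  show "subsp (dimv \<phi> (head Q a)) ((*\<^sub>v) (mats \<phi> a) ` W (tail Q a))"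
    by (rule subsp_image[OF 2 rep_mat[OF assms(2)]])
  show "subsp (dimv \<phi> (tail Q a)) {v\<in>carrier_vec (dimv \<phi> (tail Q a)). mats \<phi> a *\<^sub>v v \<in> W (head Q a)}"
    by (rule subsp_preimage[OF 1 rep_mat[OF assms(2)]])
qed

lemma subfam_down_step: "s \<in> set (arc_ops Q) \<Longrightarrow> subfam Q \<phi> W \<Longrightarrow> subfam Q \<phi> (down_step Q \<phi> s W)"
  using parts_subsp[of W "fst s"] unfolding set_arc_ops[OF quiverD(1)[OF Q]] down_step_def
  by (cases s) (auto intro!: subfam_upd subsp_int)

lemma subfam_up_step: "s \<in> set (arc_ops Q) \<Longrightarrow> subfam Q \<phi> W \<Longrightarrow> subfam Q \<phi> (up_step Q \<phi> s W)"
  using parts_subsp[of W "fst s"] unfolding set_arc_ops[OF quiverD(1)[OF Q]] up_step_def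
  by (cases s) (auto intro!: subfam_upd subsp_vsum)

lemma subfam_surj_part: "subfam Q \<phi> (surj_part Q \<phi>)"
  unfolding surj_part_def
  by (rule fold_funpow_invariant[where I = "subfam Q \<phi>", OF subfam_down_step]) (auto simp: subfam_def subsp_carrier)

lemma subfam_inj_kernel: "subfam Q \<phi> (inj_kernel Q \<phi>)"
  unfolding inj_kernel_def
  by (rule fold_funpow_invariant[where I = "subfam Q \<phi>", OF subfam_up_step]) (auto simp: subfam_def subsp_zero)

lemma down_step_surj_part:
  assumes "a \<in> arcs Q"
  shows "down_step Q \<phi> (a, b) (surj_part Q \<phi>) = surj_part Q \<phi>"
proof -
  let ?m = "\<lambda>W. \<Sum>x\<in>verts Q. card (piv (dimv \<phi> x) (W x))"
  have "\<forall>s\<in>set (arc_ops Q). down_step Q \<phi> s (surj_part Q \<phi>) = surj_part Q \<phi>"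
    unfolding surj_part_def
  proof (rule fold_funpow_stable[where I = "subfam Q \<phi>" and m = ?m, OF subfam_down_step])
    fix s W assume s: "s \<in> set (arc_ops Q)" and W: "subfam Q \<phi> W"
    obtain a b where ab: "s = (a, b)" "a \<in> arcs Q" using s unfolding set_arc_ops[OF quiverD(1)[OF Q]] by auto
    note p = parts_subsp[OF W ab(2)]
    show "down_step Q \<phi> s W = W \<or> ?m (down_step Q \<phi> s W) < ?m W"
      using upd_smaller[OF W quiverD(2)[OF Q] quiverD(4)[OF Q ab(2)] subsp_int[OF p(1,3)]]
        upd_smaller[OF W quiverD(2)[OF Q] quiverD(5)[OF Q ab(2)] subsp_int[OF p(2,4)]]
      unfolding ab(1) down_step_def by (cases b) auto
  qed (auto simp: subfam_def subsp_carrier intro!: sum_mono card_piv_le)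
  then show ?thesis using assms unfolding set_arc_ops[OF quiverD(1)[OF Q]] by auto
qed

lemma surj_part_arrow:
  assumes "a \<in> arcs Q"
  shows "(*\<^sub>v) (mats \<phi> a) ` surj_part Q \<phi> (tail Q a) = surj_part Q \<phi> (head Q a)"
proof
  have "surj_part Q \<phi> (tail Q a) \<subseteq> {v. mats \<phi> a *\<^sub>v v \<in> surj_part Q \<phi> (head Q a)}"
    using fun_cong[OF down_step_surj_part[OF assms, of True], of "tail Q a"] unfolding down_step_def by auto
  then show "(*\<^sub>v) (mats \<phi> a) ` surj_part Q \<phi> (tail Q a) \<subseteq> surj_part Q \<phi> (head Q a)" by auto
  show "surj_part Q \<phi> (head Q a) \<subseteq> (*\<^sub>v) (mats \<phi> a) ` surj_part Q \<phi> (tail Q a)"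
    using fun_cong[OF down_step_surj_part[OF assms, of False], of "head Q a"] unfolding down_step_def by auto
qed

text \<open>The iteration starts with the whole spaces, and no step removes a vector of a family
  that the arrows map onto itself.\<close>

lemma surj_part_greatest:
  assumes F: "\<And>x. x \<in> verts Q \<Longrightarrow> F x \<subseteq> carrier_vec (dimv \<phi> x)"
    and arrow: "\<And>a. a \<in> arcs Q \<Longrightarrow> (*\<^sub>v) (mats \<phi> a) ` F (tail Q a) = F (head Q a)"
    and x: "x \<in> verts Q"
  shows "F x \<subseteq> surj_part Q \<phi> x"
proof -
  have "\<forall>x\<in>verts Q. F x \<subseteq> surj_part Q \<phi> x"
    unfolding surj_part_def
  proof (rule fold_funpow_invariant[where I = "\<lambda>W. \<forall>x\<in>verts Q. F x \<subseteq> W x"])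
    fix s W assume s: "s \<in> set (arc_ops Q)" and W: "\<forall>x\<in>verts Q. F x \<subseteq> W x"
    obtain a b where ab: "s = (a, b)" "a \<in> arcs Q" using s unfolding set_arc_ops[OF quiverD(1)[OF Q]] by auto
    have h: "F (head Q a) \<subseteq> W (head Q a)" and t: "F (tail Q a) \<subseteq> W (tail Q a)"
      using W quiverD(4,5)[OF Q ab(2)] by auto
    have "F (head Q a) \<subseteq> W (head Q a) \<inter> (*\<^sub>v) (mats \<phi> a) ` W (tail Q a)"
      using h image_mono[OF t, of "(*\<^sub>v) (mats \<phi> a)"] arrow[OF ab(2)] by auto
    moreover have "F (tail Q a) \<subseteq> W (tail Q a) \<inter> {v\<in>carrier_vec (dimv \<phi> (tail Q a)). mats \<phi> a *\<^sub>v v \<in> W (head Q a)}"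
      using h t arrow[OF ab(2)] F[OF quiverD(5)[OF Q ab(2)]] by auto
    ultimately show "\<forall>x\<in>verts Q. F x \<subseteq> down_step Q \<phi> s W x"
      using W unfolding ab(1) down_step_def by (cases b) auto
  qed (use F in auto)
  then show ?thesis using x by simp
qed

lemma up_step_inj_kernel:
  assumes "a \<in> arcs Q"
  shows "up_step Q \<phi> (a, b) (inj_kernel Q \<phi>) = inj_kernel Q \<phi>"
proof -
  let ?m = "\<lambda>W. \<Sum>x\<in>verts Q. dimv \<phi> x - card (piv (dimv \<phi> x) (W x))"
  have "\<forall>s\<in>set (arc_ops Q). up_step Q \<phi> s (inj_kernel Q \<phi>) = inj_kernel Q \<phi>"
    unfolding inj_kernel_def
  proof (rule fold_funpow_stable[where I = "subfam Q \<phi>" and m = ?m, OF subfam_up_step])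
    fix s W assume s: "s \<in> set (arc_ops Q)" and W: "subfam Q \<phi> W"
    obtain a b where ab: "s = (a, b)" "a \<in> arcs Q" using s unfolding set_arc_ops[OF quiverD(1)[OF Q]] by auto
    note p = parts_subsp[OF W ab(2)]
    show "up_step Q \<phi> s W = W \<or> ?m (up_step Q \<phi> s W) < ?m W"
      using upd_larger[OF W quiverD(2)[OF Q] quiverD(4)[OF Q ab(2)] subsp_vsum[OF p(1,3)] vsum_upper1[OF p(1,3)]]
        upd_larger[OF W quiverD(2)[OF Q] quiverD(5)[OF Q ab(2)] subsp_vsum[OF p(2,4)] vsum_upper1[OF p(2,4)]]
      unfolding ab(1) up_step_def by (cases b) auto
  qed (auto simp: subfam_def subsp_zero intro!: sum_mono)
  then show ?thesis using assms unfolding set_arc_ops[OF quiverD(1)[OF Q]] by auto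
qed

lemma inj_kernel_arrow:
  assumes "a \<in> arcs Q" "v \<in> carrier_vec (dimv \<phi> (tail Q a))"
  shows "mats \<phi> a *\<^sub>v v \<in> inj_kernel Q \<phi> (head Q a) \<longleftrightarrow> v \<in> inj_kernel Q \<phi> (tail Q a)"
proof
  note p = parts_subsp[OF subfam_inj_kernel assms(1)]
  have "{v\<in>carrier_vec (dimv \<phi> (tail Q a)). mats \<phi> a *\<^sub>v v \<in> inj_kernel Q \<phi> (head Q a)} \<subseteq> inj_kernel Q \<phi> (tail Q a)"
  proof -
    have "vsum (inj_kernel Q \<phi> (tail Q a)) {v\<in>carrier_vec (dimv \<phi> (tail Q a)). mats \<phi> a *\<^sub>v v \<in> inj_kernel Q \<phi> (head Q a)} = inj_kernel Q \<phi> (tail Q a)"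
      using fun_cong[OF up_step_inj_kernel[OF assms(1), of True], of "tail Q a"] unfolding up_step_def by simp
    with vsum_upper2[OF p(2,4)] show ?thesis by (simp only:)
  qed
  then show "v \<in> inj_kernel Q \<phi> (tail Q a)" if "mats \<phi> a *\<^sub>v v \<in> inj_kernel Q \<phi> (head Q a)"
    using that assms(2) by auto
  have "(*\<^sub>v) (mats \<phi> a) ` inj_kernel Q \<phi> (tail Q a) \<subseteq> inj_kernel Q \<phi> (head Q a)"
  proof -
    have "vsum (inj_kernel Q \<phi> (head Q a)) ((*\<^sub>v) (mats \<phi> a) ` inj_kernel Q \<phi> (tail Q a)) = inj_kernel Q \<phi> (head Q a)"
      using fun_cong[OF up_step_inj_kernel[OF assms(1), of False], of "head Q a"] unfolding up_step_def by simp
    with vsum_upper2[OF p(1,3)] show ?thesis by (simp only:)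
  qed
  then show "mats \<phi> a *\<^sub>v v \<in> inj_kernel Q \<phi> (head Q a)" if "v \<in> inj_kernel Q \<phi> (tail Q a)"
    using that by auto
qed

text \<open>The iteration starts with zero and never leaves \<open>F\<close>; as the steps form
  sums, \<open>F\<close> has to consist of subspaces.\<close>

lemma inj_kernel_least:
  assumes F: "subfam Q \<phi> F"
    and arrow: "\<And>a v. a \<in> arcs Q \<Longrightarrow> v \<in> carrier_vec (dimv \<phi> (tail Q a)) \<Longrightarrow>
      mats \<phi> a *\<^sub>v v \<in> F (head Q a) \<longleftrightarrow> v \<in> F (tail Q a)"
    and x: "x \<in> verts Q"
  shows "inj_kernel Q \<phi> x \<subseteq> F x"
proof -
  have "\<forall>x\<in>verts Q. inj_kernel Q \<phi> x \<subseteq> F x"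
    unfolding inj_kernel_def
  proof (rule fold_funpow_invariant[where I = "\<lambda>W. \<forall>x\<in>verts Q. W x \<subseteq> F x"])
    fix s W assume s: "s \<in> set (arc_ops Q)" and W: "\<forall>x\<in>verts Q. W x \<subseteq> F x"
    obtain a b where ab: "s = (a, b)" "a \<in> arcs Q" using s unfolding set_arc_ops[OF quiverD(1)[OF Q]] by auto
    note p = parts_subsp[OF F ab(2)]
    have h: "W (head Q a) \<subseteq> F (head Q a)" and t: "W (tail Q a) \<subseteq> F (tail Q a)"
      using W quiverD(4,5)[OF Q ab(2)] by auto
    have "vsum (W (head Q a)) ((*\<^sub>v) (mats \<phi> a) ` W (tail Q a)) \<subseteq> F (head Q a)"
      using t arrow[OF ab(2)] subspD(1)[OF p(2)] by (intro vsum_least[OF p(1) h]) auto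
    moreover have "vsum (W (tail Q a)) {v\<in>carrier_vec (dimv \<phi> (tail Q a)). mats \<phi> a *\<^sub>v v \<in> W (head Q a)} \<subseteq> F (tail Q a)"
      using h arrow[OF ab(2)] by (intro vsum_least[OF p(2) t]) auto
    ultimately show "\<forall>x\<in>verts Q. up_step Q \<phi> s W x \<subseteq> F x"
      using W unfolding ab(1) up_step_def by (cases b) auto
  qed (use F subspD(2) in \<open>auto simp: subfam_def\<close>)
  then show ?thesis using x by simp
qed

end

section \<open>Matrix realizations of the largest subrepresentation and the largest quotient\<close>

lemma rep_homD:
  assumes "rep_hom Q \<phi> \<psi> g"
  shows "x \<in> verts Q \<Longrightarrow> g x \<in> carrier_mat (dimv \<psi> x) (dimv \<phi> x)"
    "a \<in> arcs Q \<Longrightarrow> g (head Q a) * mats \<phi> a = mats \<psi> a * g (tail Q a)"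
  using assms unfolding rep_hom_def by auto

lemma is_repD: "is_rep Q \<phi> \<Longrightarrow> a \<in> arcs Q \<Longrightarrow> mats \<phi> a \<in> carrier_mat (dimv \<phi> (head Q a)) (dimv \<phi> (tail Q a))"
  unfolding is_rep_def by simp

lemma rep_hom_mult_vec:
  assumes Q: "quiver Q" and "is_rep Q \<phi>" "is_rep Q \<psi>" and g: "rep_hom Q \<phi> \<psi> g" and a: "a \<in> arcs Q"
    and v: "v \<in> carrier_vec (dimv \<phi> (tail Q a))"
  shows "g (head Q a) *\<^sub>v (mats \<phi> a *\<^sub>v v) = mats \<psi> a *\<^sub>v (g (tail Q a) *\<^sub>v v)"
proof -
  have "g (head Q a) *\<^sub>v (mats \<phi> a *\<^sub>v v) = (g (head Q a) * mats \<phi> a) *\<^sub>v v"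
    using assoc_mult_mat_vec[OF rep_homD(1)[OF g quiverD(4)[OF Q a]] is_repD[OF assms(2) a] v] by simp
  also have "\<dots> = (mats \<psi> a * g (tail Q a)) *\<^sub>v v" by (simp only: rep_homD(2)[OF g a])
  also have "\<dots> = mats \<psi> a *\<^sub>v (g (tail Q a) *\<^sub>v v)"
    by (rule assoc_mult_mat_vec[OF is_repD[OF assms(3) a] rep_homD(1)[OF g quiverD(5)[OF Q a]] v])
  finally show ?thesis .
qed

lemma mat_inj_cancel:
  assumes "mat_inj i" "i \<in> carrier_mat n k" "A \<in> carrier_mat k m" "B \<in> carrier_mat k m" "i * A = i * B"
  shows "A = B"
proof (rule mat_eqI_vec[OF assms(3,4)])
  fix v :: "'a vec" assume v: "v \<in> carrier_vec m"
  have "i *\<^sub>v (A *\<^sub>v v) = i *\<^sub>v (B *\<^sub>v v)"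
    using assoc_mult_mat_vec[OF assms(2,3) v] assoc_mult_mat_vec[OF assms(2,4) v] assms(5) by simp
  then show "A *\<^sub>v v = B *\<^sub>v v"
    using assms(1) mult_mat_vec_carrier[OF assms(3) v] mult_mat_vec_carrier[OF assms(4) v] assms(2)
    unfolding mat_inj_def inj_on_def by simp
qed

lemma mat_surj_cancel:
  assumes "mat_surj p" "p \<in> carrier_mat k n" "A \<in> carrier_mat m k" "B \<in> carrier_mat m k" "A * p = B * p"
  shows "A = B"
proof (rule mat_eqI_vec[OF assms(3,4)])
  fix w :: "'a vec" assume "w \<in> carrier_vec k"
  then obtain v where v: "v \<in> carrier_vec n" "w = p *\<^sub>v v"
    using assms(1) unfolding mat_surj_iff[OF assms(2)] by auto
  then show "A *\<^sub>v w = B *\<^sub>v w"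
    using assoc_mult_mat_vec[OF assms(3,2) v(1)] assoc_mult_mat_vec[OF assms(4,2) v(1)] assms(5) by simp
qed

context
  fixes Q :: quiver and \<phi> :: "'k::field rep"
  assumes Q: "quiver Q" and rep: "is_rep Q \<phi>"
begin

lemma surj_sub_range_subset:
  assumes i: "surj_sub Q \<phi> \<epsilon> i" and x: "x \<in> verts Q"
  shows "(*\<^sub>v) (i x) ` carrier_vec (dimv \<epsilon> x) \<subseteq> surj_part Q \<phi> x"
proof -
  have rep_\<epsilon>: "is_rep Q \<epsilon>" and hom: "rep_hom Q \<epsilon> \<phi> i" using i unfolding surj_sub_def by auto
  let ?F = "\<lambda>x. (*\<^sub>v) (i x) ` carrier_vec (dimv \<epsilon> x)"
  show ?thesis
  proof (rule surj_part_greatest[OF Q rep _ _ x, of ?F])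
    show "?F x \<subseteq> carrier_vec (dimv \<phi> x)" if "x \<in> verts Q" for x
      by (intro image_subsetI mult_mat_vec_carrier[OF rep_homD(1)[OF hom that]])
    show "(*\<^sub>v) (mats \<phi> a) ` ?F (tail Q a) = ?F (head Q a)" if a: "a \<in> arcs Q" for a
    proof -
      have "(*\<^sub>v) (mats \<phi> a) ` ?F (tail Q a) = (\<lambda>v. i (head Q a) *\<^sub>v (mats \<epsilon> a *\<^sub>v v)) ` carrier_vec (dimv \<epsilon> (tail Q a))"
        using rep_hom_mult_vec[OF Q rep_\<epsilon> rep hom a] by (simp add: image_image)
      also have "\<dots> = (*\<^sub>v) (i (head Q a)) ` ((*\<^sub>v) (mats \<epsilon> a) ` carrier_vec (dimv \<epsilon> (tail Q a)))"
        by (simp add: image_image)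
      also have "(*\<^sub>v) (mats \<epsilon> a) ` carrier_vec (dimv \<epsilon> (tail Q a)) = carrier_vec (dimv \<epsilon> (head Q a))"
        using i a is_repD[OF rep_\<epsilon> a] unfolding surj_sub_def mat_surj_def by auto
      finally show ?thesis .
    qed
  qed
qed

lemma inj_quot_kernel_supset:
  assumes p: "inj_quot Q \<phi> \<mu> p" and x: "x \<in> verts Q"
  shows "inj_kernel Q \<phi> x \<subseteq> {v\<in>carrier_vec (dimv \<phi> x). p x *\<^sub>v v = 0\<^sub>v (dimv \<mu> x)}"
proof -
  have rep_\<mu>: "is_rep Q \<mu>" and hom: "rep_hom Q \<phi> \<mu> p" using p unfolding inj_quot_def by auto
  let ?F = "\<lambda>x. {v\<in>carrier_vec (dimv \<phi> x). p x *\<^sub>v v = 0\<^sub>v (dimv \<mu> x)}"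
  show ?thesis
  proof (rule inj_kernel_least[OF Q rep _ _ x, of ?F])
    show "subfam Q \<phi> ?F" unfolding subfam_def
      using subsp_preimage[OF subsp_zero rep_homD(1)[OF hom]] by simp
    show "mats \<phi> a *\<^sub>v v \<in> ?F (head Q a) \<longleftrightarrow> v \<in> ?F (tail Q a)"
      if a: "a \<in> arcs Q" and v: "v \<in> carrier_vec (dimv \<phi> (tail Q a))" for a v
    proof -
      have pv: "p (tail Q a) *\<^sub>v v \<in> carrier_vec (dimv \<mu> (tail Q a))"
        by (rule mult_mat_vec_carrier[OF rep_homD(1)[OF hom quiverD(5)[OF Q a]] v])
      have "mats \<phi> a *\<^sub>v v \<in> ?F (head Q a) \<longleftrightarrow> p (head Q a) *\<^sub>v (mats \<phi> a *\<^sub>v v) = 0\<^sub>v (dimv \<mu> (head Q a))"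
        using mult_mat_vec_carrier[OF is_repD[OF rep a] v] by simp
      also have "\<dots> \<longleftrightarrow> mats \<mu> a *\<^sub>v (p (tail Q a) *\<^sub>v v) = 0\<^sub>v (dimv \<mu> (head Q a))"
        unfolding rep_hom_mult_vec[OF Q rep rep_\<mu> hom a v] ..
      also have "\<dots> \<longleftrightarrow> p (tail Q a) *\<^sub>v v = 0\<^sub>v (dimv \<mu> (tail Q a))"
      proof
        assume "mats \<mu> a *\<^sub>v (p (tail Q a) *\<^sub>v v) = 0\<^sub>v (dimv \<mu> (head Q a))"
        moreover have "mat_inj (mats \<mu> a)" using p a unfolding inj_quot_def by simp
        ultimately show "p (tail Q a) *\<^sub>v v = 0\<^sub>v (dimv \<mu> (tail Q a))"
          using pv unfolding mat_inj_iff[OF is_repD[OF rep_\<mu> a]] by simp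
      next
        assume *: "p (tail Q a) *\<^sub>v v = 0\<^sub>v (dimv \<mu> (tail Q a))"
        show "mats \<mu> a *\<^sub>v (p (tail Q a) *\<^sub>v v) = 0\<^sub>v (dimv \<mu> (head Q a))"
          unfolding * using is_repD[OF rep_\<mu> a] by (intro eq_vecI) auto
      qed
      finally show ?thesis using v by simp
    qed
  qed
qed

text \<open>Choose a basis \<open>i x\<close> of each space. As arrows map these spaces into each
  other, \<open>mats \<phi> a * i (tail Q a)\<close> factors through \<open>i (head Q a)\<close>;
  the factor is the arrow map in the chosen bases, surjective because the spaces are mapped onto
  each other.\<close>

lemma ex_surj_part_sub:
  "\<exists>\<epsilon> i. surj_sub Q \<phi> \<epsilon> i \<and> (\<forall>x\<in>verts Q. (*\<^sub>v) (i x) ` carrier_vec (dimv \<epsilon> x) = surj_part Q \<phi> x)"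
proof -
  let ?E = "surj_part Q \<phi>"
  have "\<forall>x\<in>verts Q. \<exists>d. \<exists>i. i \<in> carrier_mat (dimv \<phi> x) d \<and> mat_inj i \<and> (*\<^sub>v) i ` carrier_vec d = ?E x"
  proof
    fix x assume "x \<in> verts Q"
    then have "subsp (dimv \<phi> x) (?E x)" using subfam_surj_part[OF Q rep] unfolding subfam_def by simp
    from ex_mat_inj_range[OF this]
    show "\<exists>d. \<exists>i. i \<in> carrier_mat (dimv \<phi> x) d \<and> mat_inj i \<and> (*\<^sub>v) i ` carrier_vec d = ?E x"
      unfolding Bex_def .
  qed
  then obtain d i where "\<forall>x\<in>verts Q. i x \<in> carrier_mat (dimv \<phi> x) (d x) \<and> mat_inj (i x) \<and> (*\<^sub>v) (i x) ` carrier_vec (d x) = ?E x"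
    by (elim bchoice[THEN exE])
  then have i: "i x \<in> carrier_mat (dimv \<phi> x) (d x)" "mat_inj (i x)" "(*\<^sub>v) (i x) ` carrier_vec (d x) = ?E x"
    if "x \<in> verts Q" for x using that by auto
  have "\<forall>a\<in>arcs Q. \<exists>H. H \<in> carrier_mat (d (head Q a)) (d (tail Q a)) \<and> mats \<phi> a * i (tail Q a) = i (head Q a) * H"
  proof
    fix a assume a: "a \<in> arcs Q"
    note h = quiverD(4)[OF Q a] and t = quiverD(5)[OF Q a]
    have "\<exists>H\<in>carrier_mat (d (head Q a)) (d (tail Q a)). mats \<phi> a * i (tail Q a) = i (head Q a) * H"
    proof (rule factor_left[OF mult_carrier_mat[OF is_repD[OF rep a] i(1)[OF t]] i(1)[OF h]])
      fix v :: "'k vec" assume v: "v \<in> carrier_vec (d (tail Q a))"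
      have "i (tail Q a) *\<^sub>v v \<in> ?E (tail Q a)" using i(3)[OF t] v by auto
      then have "mats \<phi> a *\<^sub>v (i (tail Q a) *\<^sub>v v) \<in> ?E (head Q a)" using surj_part_arrow[OF Q rep a] by auto
      then have "(mats \<phi> a * i (tail Q a)) *\<^sub>v v \<in> (*\<^sub>v) (i (head Q a)) ` carrier_vec (d (head Q a))"
        using i(3)[OF h] assoc_mult_mat_vec[OF is_repD[OF rep a] i(1)[OF t] v] by simp
      then show "\<exists>w\<in>carrier_vec (d (head Q a)). (mats \<phi> a * i (tail Q a)) *\<^sub>v v = i (head Q a) *\<^sub>v w" by auto
    qed
    then show "\<exists>H. H \<in> carrier_mat (d (head Q a)) (d (tail Q a)) \<and> mats \<phi> a * i (tail Q a) = i (head Q a) * H"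
      unfolding Bex_def .
  qed
  then obtain H where H: "\<forall>a\<in>arcs Q. H a \<in> carrier_mat (d (head Q a)) (d (tail Q a)) \<and> mats \<phi> a * i (tail Q a) = i (head Q a) * H a"
    by (elim bchoice[THEN exE])
  define \<epsilon> where "\<epsilon> = \<lparr> dimv = d, mats = H \<rparr>"
  have rep_\<epsilon>: "is_rep Q \<epsilon>" unfolding is_rep_def \<epsilon>_def using H by simp
  have hom: "rep_hom Q \<epsilon> \<phi> i" unfolding rep_hom_def \<epsilon>_def using H i(1) by simp
  have "mat_surj (H a)" if a: "a \<in> arcs Q" for a
  proof -
    note h = quiverD(4)[OF Q a] and t = quiverD(5)[OF Q a]
    have Ha: "H a \<in> carrier_mat (d (head Q a)) (d (tail Q a))" using H a by simp
    show ?thesis unfolding mat_surj_iff[OF Ha]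
    proof
      fix w :: "'k vec" assume w: "w \<in> carrier_vec (d (head Q a))"
      have "i (head Q a) *\<^sub>v w \<in> ?E (head Q a)" using i(3)[OF h] w by auto
      then obtain v where v: "v \<in> ?E (tail Q a)" "i (head Q a) *\<^sub>v w = mats \<phi> a *\<^sub>v v"
        using surj_part_arrow[OF Q rep a] by auto
      then obtain u where u: "u \<in> carrier_vec (d (tail Q a))" "v = i (tail Q a) *\<^sub>v u"
        using i(3)[OF t] by auto
      have "i (head Q a) *\<^sub>v w = i (head Q a) *\<^sub>v (H a *\<^sub>v u)"
        using rep_hom_mult_vec[OF Q rep_\<epsilon> rep hom a, of u] u v(2) unfolding \<epsilon>_def by simp
      then have "w = H a *\<^sub>v u"
        using i(2)[OF h] i(1)[OF h] w mult_mat_vec_carrier[OF Ha u(1)] unfolding mat_inj_def inj_on_def by simp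
      then show "\<exists>v\<in>carrier_vec (d (tail Q a)). w = H a *\<^sub>v v" using u(1) by blast
    qed
  qed
  then have "surj_sub Q \<phi> \<epsilon> i" unfolding surj_sub_def using rep_\<epsilon> hom i(2) by (simp add: \<epsilon>_def)
  moreover have "\<forall>x\<in>verts Q. (*\<^sub>v) (i x) ` carrier_vec (dimv \<epsilon> x) = ?E x" unfolding \<epsilon>_def using i(3) by simp
  ultimately show ?thesis by blast
qed

text \<open>Vertexwise factors exist because every competitor has its range in
  \<open>surj_part\<close>; they commute with the arrows because the injection \<open>i\<close> at
  the head can be cancelled.\<close>

lemma largest_surj_subI:
  assumes i: "surj_sub Q \<phi> \<epsilon> i" and range: "\<And>x. x \<in> verts Q \<Longrightarrow> (*\<^sub>v) (i x) ` carrier_vec (dimv \<epsilon> x) = surj_part Q \<phi> x"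
  shows "largest_surj_sub Q \<phi> \<epsilon> i"
  unfolding largest_surj_sub_def
proof (intro conjI allI impI)
  fix \<epsilon>' i' assume i': "surj_sub Q \<phi> \<epsilon>' i'"
  have rep_\<epsilon>: "is_rep Q \<epsilon>" and hom: "rep_hom Q \<epsilon> \<phi> i" using i unfolding surj_sub_def by auto
  have rep_\<epsilon>': "is_rep Q \<epsilon>'" and hom': "rep_hom Q \<epsilon>' \<phi> i'" using i' unfolding surj_sub_def by auto
  have "\<forall>x\<in>verts Q. \<exists>h. h \<in> carrier_mat (dimv \<epsilon> x) (dimv \<epsilon>' x) \<and> i' x = i x * h"
  proof
    fix x assume x: "x \<in> verts Q"
    have "\<exists>h\<in>carrier_mat (dimv \<epsilon> x) (dimv \<epsilon>' x). i' x = i x * h"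
    proof (rule factor_left[OF rep_homD(1)[OF hom' x] rep_homD(1)[OF hom x]])
      fix v :: "'k vec" assume "v \<in> carrier_vec (dimv \<epsilon>' x)"
      then have "i' x *\<^sub>v v \<in> surj_part Q \<phi> x" using surj_sub_range_subset[OF i' x] by auto
      then show "\<exists>w\<in>carrier_vec (dimv \<epsilon> x). i' x *\<^sub>v v = i x *\<^sub>v w" using range[OF x] by auto
    qed
    then show "\<exists>h. h \<in> carrier_mat (dimv \<epsilon> x) (dimv \<epsilon>' x) \<and> i' x = i x * h" unfolding Bex_def .
  qed
  then obtain h where "\<forall>x\<in>verts Q. h x \<in> carrier_mat (dimv \<epsilon> x) (dimv \<epsilon>' x) \<and> i' x = i x * h x"
    by (elim bchoice[THEN exE])
  then have h: "h x \<in> carrier_mat (dimv \<epsilon> x) (dimv \<epsilon>' x)" "i' x = i x * h x" if "x \<in> verts Q" for x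
    using that by auto
  have "rep_hom Q \<epsilon>' \<epsilon> h" unfolding rep_hom_def
  proof (intro conjI ballI)
    fix a assume a: "a \<in> arcs Q"
    note vh = quiverD(4)[OF Q a] and vt = quiverD(5)[OF Q a]
    note ih = rep_homD(1)[OF hom vh] and it = rep_homD(1)[OF hom vt]
    note A = is_repD[OF rep a] and e = is_repD[OF rep_\<epsilon> a] and e' = is_repD[OF rep_\<epsilon>' a]
    show "h (head Q a) * mats \<epsilon>' a = mats \<epsilon> a * h (tail Q a)"
    proof (rule mat_inj_cancel[OF _ ih])
      show "mat_inj (i (head Q a))" using i vh unfolding surj_sub_def by simp
      show "h (head Q a) * mats \<epsilon>' a \<in> carrier_mat (dimv \<epsilon> (head Q a)) (dimv \<epsilon>' (tail Q a))"
        by (rule mult_carrier_mat[OF h(1)[OF vh] e'])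
      show "mats \<epsilon> a * h (tail Q a) \<in> carrier_mat (dimv \<epsilon> (head Q a)) (dimv \<epsilon>' (tail Q a))"
        by (rule mult_carrier_mat[OF e h(1)[OF vt]])
      have "i (head Q a) * (h (head Q a) * mats \<epsilon>' a) = i' (head Q a) * mats \<epsilon>' a"
        using assoc_mult_mat[OF ih h(1)[OF vh] e'] h(2)[OF vh] by simp
      also have "\<dots> = mats \<phi> a * (i (tail Q a) * h (tail Q a))"
        using rep_homD(2)[OF hom' a] h(2)[OF vt] by simp
      also have "\<dots> = (mats \<phi> a * i (tail Q a)) * h (tail Q a)"
        by (rule assoc_mult_mat[OF A it h(1)[OF vt], symmetric])
      also have "\<dots> = (i (head Q a) * mats \<epsilon> a) * h (tail Q a)"
        using rep_homD(2)[OF hom a] by simp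
      also have "\<dots> = i (head Q a) * (mats \<epsilon> a * h (tail Q a))"
        by (rule assoc_mult_mat[OF ih e h(1)[OF vt]])
      finally show "i (head Q a) * (h (head Q a) * mats \<epsilon>' a) = i (head Q a) * (mats \<epsilon> a * h (tail Q a))" .
    qed
  qed (rule h(1))
  then show "\<exists>h. rep_hom Q \<epsilon>' \<epsilon> h \<and> (\<forall>x\<in>verts Q. i' x = i x * h x)" using h(2) by blast
qed (rule i)

text \<open>A largest subrepresentation is given by a universal property only; comparing it with the
  concrete one determines its image.\<close>

lemma largest_surj_sub_range:
  assumes i: "largest_surj_sub Q \<phi> \<epsilon> i" and x: "x \<in> verts Q"
  shows "(*\<^sub>v) (i x) ` carrier_vec (dimv \<epsilon> x) = surj_part Q \<phi> x"
proof
  show "(*\<^sub>v) (i x) ` carrier_vec (dimv \<epsilon> x) \<subseteq> surj_part Q \<phi> x"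
    using i x by (intro surj_sub_range_subset) (auto simp: largest_surj_sub_def)
  obtain \<epsilon>' i' where "surj_sub Q \<phi> \<epsilon>' i'"
    "\<forall>x\<in>verts Q. (*\<^sub>v) (i' x) ` carrier_vec (dimv \<epsilon>' x) = surj_part Q \<phi> x"
    using ex_surj_part_sub by (elim exE conjE)
  then have i': "surj_sub Q \<phi> \<epsilon>' i'" "(*\<^sub>v) (i' x) ` carrier_vec (dimv \<epsilon>' x) = surj_part Q \<phi> x"
    using x by auto
  then obtain h where h: "rep_hom Q \<epsilon>' \<epsilon> h" "i' x = i x * h x" using i x unfolding largest_surj_sub_def by blast
  have hom: "rep_hom Q \<epsilon> \<phi> i" using i unfolding largest_surj_sub_def surj_sub_def by auto
  show "surj_part Q \<phi> x \<subseteq> (*\<^sub>v) (i x) ` carrier_vec (dimv \<epsilon> x)"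
  proof
    fix v assume "v \<in> surj_part Q \<phi> x"
    then obtain u where u: "u \<in> carrier_vec (dimv \<epsilon>' x)" "v = i' x *\<^sub>v u" using i'(2) by auto
    then have "v = i x *\<^sub>v (h x *\<^sub>v u)"
      using assoc_mult_mat_vec[OF rep_homD(1)[OF hom x] rep_homD(1)[OF h(1) x] u(1)] h(2) by simp
    then show "v \<in> (*\<^sub>v) (i x) ` carrier_vec (dimv \<epsilon> x)"
      using mult_mat_vec_carrier[OF rep_homD(1)[OF h(1) x] u(1)] by simp
  qed
qed

text \<open>Dual to \<open>ex_surj_part_sub\<close>: arrow maps come from factoring
  \<open>p (head Q a) * mats \<phi> a\<close> through the surjection at the tail. They are injective
  because a vector sent into \<open>inj_kernel\<close> by an arrow already lies in it.\<close>

lemma ex_inj_kernel_quot: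
  "\<exists>\<mu> p. inj_quot Q \<phi> \<mu> p \<and> (\<forall>x\<in>verts Q. inj_kernel Q \<phi> x = {v\<in>carrier_vec (dimv \<phi> x). p x *\<^sub>v v = 0\<^sub>v (dimv \<mu> x)})"
proof -
  let ?N = "inj_kernel Q \<phi>"
  have "\<forall>x\<in>verts Q. \<exists>d. \<exists>p. p \<in> carrier_mat d (dimv \<phi> x) \<and> mat_surj p \<and> ?N x = {v\<in>carrier_vec (dimv \<phi> x). p *\<^sub>v v = 0\<^sub>v d}"
  proof
    fix x assume "x \<in> verts Q"
    then have "subsp (dimv \<phi> x) (?N x)" using subfam_inj_kernel[OF Q rep] unfolding subfam_def by simp
    from ex_mat_surj_kernel[OF this]
    show "\<exists>d. \<exists>p. p \<in> carrier_mat d (dimv \<phi> x) \<and> mat_surj p \<and> ?N x = {v\<in>carrier_vec (dimv \<phi> x). p *\<^sub>v v = 0\<^sub>v d}"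
      unfolding Bex_def .
  qed
  then obtain d p where "\<forall>x\<in>verts Q. p x \<in> carrier_mat (d x) (dimv \<phi> x) \<and> mat_surj (p x) \<and> ?N x = {v\<in>carrier_vec (dimv \<phi> x). p x *\<^sub>v v = 0\<^sub>v (d x)}"
    by (elim bchoice[THEN exE])
  then have p: "p x \<in> carrier_mat (d x) (dimv \<phi> x)" "mat_surj (p x)" "?N x = {v\<in>carrier_vec (dimv \<phi> x). p x *\<^sub>v v = 0\<^sub>v (d x)}"
    if "x \<in> verts Q" for x using that by auto
  have "\<forall>a\<in>arcs Q. \<exists>H. H \<in> carrier_mat (d (head Q a)) (d (tail Q a)) \<and> p (head Q a) * mats \<phi> a = H * p (tail Q a)"
  proof
    fix a assume a: "a \<in> arcs Q"
    note h = quiverD(4)[OF Q a] and t = quiverD(5)[OF Q a]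
    have "\<exists>H\<in>carrier_mat (d (head Q a)) (d (tail Q a)). p (head Q a) * mats \<phi> a = H * p (tail Q a)"
    proof (rule factor_right[OF p(1)[OF t] mult_carrier_mat[OF p(1)[OF h] is_repD[OF rep a]]])
      show "\<exists>v\<in>carrier_vec (dimv \<phi> (tail Q a)). w = p (tail Q a) *\<^sub>v v" if "w \<in> carrier_vec (d (tail Q a))" for w
        using p(2)[OF t] that unfolding mat_surj_iff[OF p(1)[OF t]] by simp
      fix v :: "'k vec" assume v: "v \<in> carrier_vec (dimv \<phi> (tail Q a))" "p (tail Q a) *\<^sub>v v = 0\<^sub>v (d (tail Q a))"
      then have "v \<in> ?N (tail Q a)" using p(3)[OF t] by simp
      then have "mats \<phi> a *\<^sub>v v \<in> ?N (head Q a)" using inj_kernel_arrow[OF Q rep a v(1)] by simp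
      then show "(p (head Q a) * mats \<phi> a) *\<^sub>v v = 0\<^sub>v (d (head Q a))"
        using p(3)[OF h] assoc_mult_mat_vec[OF p(1)[OF h] is_repD[OF rep a] v(1)] by simp
    qed
    then show "\<exists>H. H \<in> carrier_mat (d (head Q a)) (d (tail Q a)) \<and> p (head Q a) * mats \<phi> a = H * p (tail Q a)"
      unfolding Bex_def .
  qed
  then obtain H where H: "\<forall>a\<in>arcs Q. H a \<in> carrier_mat (d (head Q a)) (d (tail Q a)) \<and> p (head Q a) * mats \<phi> a = H a * p (tail Q a)"
    by (elim bchoice[THEN exE])
  define \<mu> where "\<mu> = \<lparr> dimv = d, mats = H \<rparr>"
  have rep_\<mu>: "is_rep Q \<mu>" unfolding is_rep_def \<mu>_def using H by simp
  have hom: "rep_hom Q \<phi> \<mu> p" unfolding rep_hom_def \<mu>_def using H p(1) by simp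
  have "mat_inj (H a)" if a: "a \<in> arcs Q" for a
  proof -
    note h = quiverD(4)[OF Q a] and t = quiverD(5)[OF Q a]
    have Ha: "H a \<in> carrier_mat (d (head Q a)) (d (tail Q a))" using H a by simp
    show ?thesis unfolding mat_inj_iff[OF Ha]
    proof (intro ballI impI)
      fix w :: "'k vec" assume w: "w \<in> carrier_vec (d (tail Q a))" "H a *\<^sub>v w = 0\<^sub>v (d (head Q a))"
      then obtain v where v: "v \<in> carrier_vec (dimv \<phi> (tail Q a))" "w = p (tail Q a) *\<^sub>v v"
        using p(2)[OF t] unfolding mat_surj_iff[OF p(1)[OF t]] by auto
      have "p (head Q a) *\<^sub>v (mats \<phi> a *\<^sub>v v) = 0\<^sub>v (d (head Q a))"
        using rep_hom_mult_vec[OF Q rep rep_\<mu> hom a v(1)] w(2) v(2) unfolding \<mu>_def by simp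
      then have "mats \<phi> a *\<^sub>v v \<in> ?N (head Q a)"
        using p(3)[OF h] mult_mat_vec_carrier[OF is_repD[OF rep a] v(1)] by simp
      then have "v \<in> ?N (tail Q a)" using inj_kernel_arrow[OF Q rep a v(1)] by simp
      then show "w = 0\<^sub>v (d (tail Q a))" using p(3)[OF t] v(2) by simp
    qed
  qed
  then have "inj_quot Q \<phi> \<mu> p" unfolding inj_quot_def using rep_\<mu> hom p(2) by (simp add: \<mu>_def)
  moreover have "\<forall>x\<in>verts Q. ?N x = {v\<in>carrier_vec (dimv \<phi> x). p x *\<^sub>v v = 0\<^sub>v (dimv \<mu> x)}"
    unfolding \<mu>_def rep.simps by (intro ballI p(3))
  ultimately show ?thesis by blast
qed

text \<open>As for \<open>largest_surj_subI\<close>, but the factors come from inclusions of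
  kernels, and it is the surjection \<open>p\<close> at the tail that is cancelled.\<close>

lemma largest_inj_quotI:
  assumes p: "inj_quot Q \<phi> \<mu> p"
    and kernel: "\<And>x. x \<in> verts Q \<Longrightarrow> inj_kernel Q \<phi> x = {v\<in>carrier_vec (dimv \<phi> x). p x *\<^sub>v v = 0\<^sub>v (dimv \<mu> x)}"
  shows "largest_inj_quot Q \<phi> \<mu> p"
  unfolding largest_inj_quot_def
proof (intro conjI allI impI)
  fix \<mu>' p' assume p': "inj_quot Q \<phi> \<mu>' p'"
  have rep_\<mu>: "is_rep Q \<mu>" and hom: "rep_hom Q \<phi> \<mu> p" using p unfolding inj_quot_def by auto
  have rep_\<mu>': "is_rep Q \<mu>'" and hom': "rep_hom Q \<phi> \<mu>' p'" using p' unfolding inj_quot_def by auto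
  have surj: "mat_surj (p x)" if "x \<in> verts Q" for x using p that unfolding inj_quot_def by simp
  have "\<forall>x\<in>verts Q. \<exists>h. h \<in> carrier_mat (dimv \<mu>' x) (dimv \<mu> x) \<and> p' x = h * p x"
  proof
    fix x assume x: "x \<in> verts Q"
    have "\<exists>h\<in>carrier_mat (dimv \<mu>' x) (dimv \<mu> x). p' x = h * p x"
    proof (rule factor_right[OF rep_homD(1)[OF hom x] rep_homD(1)[OF hom' x]])
      show "\<exists>v\<in>carrier_vec (dimv \<phi> x). w = p x *\<^sub>v v" if "w \<in> carrier_vec (dimv \<mu> x)" for w
        using surj[OF x] that unfolding mat_surj_iff[OF rep_homD(1)[OF hom x]] by simp
      fix v :: "'k vec" assume "v \<in> carrier_vec (dimv \<phi> x)" "p x *\<^sub>v v = 0\<^sub>v (dimv \<mu> x)"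
      then have "v \<in> inj_kernel Q \<phi> x" using kernel[OF x] by simp
      then show "p' x *\<^sub>v v = 0\<^sub>v (dimv \<mu>' x)" using inj_quot_kernel_supset[OF p' x] by auto
    qed
    then show "\<exists>h. h \<in> carrier_mat (dimv \<mu>' x) (dimv \<mu> x) \<and> p' x = h * p x" unfolding Bex_def .
  qed
  then obtain h where "\<forall>x\<in>verts Q. h x \<in> carrier_mat (dimv \<mu>' x) (dimv \<mu> x) \<and> p' x = h x * p x"
    by (elim bchoice[THEN exE])
  then have h: "h x \<in> carrier_mat (dimv \<mu>' x) (dimv \<mu> x)" "p' x = h x * p x" if "x \<in> verts Q" for x
    using that by auto
  have "rep_hom Q \<mu> \<mu>' h" unfolding rep_hom_def
  proof (intro conjI ballI)
    fix a assume a: "a \<in> arcs Q"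
    note vh = quiverD(4)[OF Q a] and vt = quiverD(5)[OF Q a]
    note ph = rep_homD(1)[OF hom vh] and pt = rep_homD(1)[OF hom vt]
    note A = is_repD[OF rep a] and m = is_repD[OF rep_\<mu> a] and m' = is_repD[OF rep_\<mu>' a]
    show "h (head Q a) * mats \<mu> a = mats \<mu>' a * h (tail Q a)"
    proof (rule mat_surj_cancel[OF surj[OF vt] pt])
      show "h (head Q a) * mats \<mu> a \<in> carrier_mat (dimv \<mu>' (head Q a)) (dimv \<mu> (tail Q a))"
        by (rule mult_carrier_mat[OF h(1)[OF vh] m])
      show "mats \<mu>' a * h (tail Q a) \<in> carrier_mat (dimv \<mu>' (head Q a)) (dimv \<mu> (tail Q a))"
        by (rule mult_carrier_mat[OF m' h(1)[OF vt]])
      have "(mats \<mu>' a * h (tail Q a)) * p (tail Q a) = mats \<mu>' a * p' (tail Q a)"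
        using assoc_mult_mat[OF m' h(1)[OF vt] pt] h(2)[OF vt] by simp
      also have "\<dots> = (h (head Q a) * p (head Q a)) * mats \<phi> a"
        using rep_homD(2)[OF hom' a] h(2)[OF vh] by simp
      also have "\<dots> = h (head Q a) * (p (head Q a) * mats \<phi> a)"
        by (rule assoc_mult_mat[OF h(1)[OF vh] ph A])
      also have "\<dots> = h (head Q a) * (mats \<mu> a * p (tail Q a))"
        using rep_homD(2)[OF hom a] by simp
      also have "\<dots> = (h (head Q a) * mats \<mu> a) * p (tail Q a)"
        by (rule assoc_mult_mat[OF h(1)[OF vh] m pt, symmetric])
      finally show "(h (head Q a) * mats \<mu> a) * p (tail Q a) = (mats \<mu>' a * h (tail Q a)) * p (tail Q a)" ..
    qed
  qed (rule h(1))
  then show "\<exists>h. rep_hom Q \<mu> \<mu>' h \<and> (\<forall>x\<in>verts Q. p' x = h x * p x)" using h(2) by blast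
qed (rule p)

lemma largest_inj_quot_kernel:
  assumes p: "largest_inj_quot Q \<phi> \<mu> p" and x: "x \<in> verts Q"
  shows "{v\<in>carrier_vec (dimv \<phi> x). p x *\<^sub>v v = 0\<^sub>v (dimv \<mu> x)} = inj_kernel Q \<phi> x"
proof
  show "inj_kernel Q \<phi> x \<subseteq> {v\<in>carrier_vec (dimv \<phi> x). p x *\<^sub>v v = 0\<^sub>v (dimv \<mu> x)}"
    using p x by (intro inj_quot_kernel_supset) (auto simp: largest_inj_quot_def)
  obtain \<mu>' p' where p'': "inj_quot Q \<phi> \<mu>' p'"
    "\<forall>x\<in>verts Q. inj_kernel Q \<phi> x = {v\<in>carrier_vec (dimv \<phi> x). p' x *\<^sub>v v = 0\<^sub>v (dimv \<mu>' x)}"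
    using ex_inj_kernel_quot by (elim exE conjE)
  note p' = p''(1) p''(2)[rule_format, OF x]
  then obtain h where h: "rep_hom Q \<mu> \<mu>' h" "p' x = h x * p x" using p x unfolding largest_inj_quot_def by blast
  have hom: "rep_hom Q \<phi> \<mu> p" using p unfolding largest_inj_quot_def inj_quot_def by auto
  show "{v\<in>carrier_vec (dimv \<phi> x). p x *\<^sub>v v = 0\<^sub>v (dimv \<mu> x)} \<subseteq> inj_kernel Q \<phi> x"
  proof
    fix v assume "v \<in> {v\<in>carrier_vec (dimv \<phi> x). p x *\<^sub>v v = 0\<^sub>v (dimv \<mu> x)}"
    then have v: "v \<in> carrier_vec (dimv \<phi> x)" "p x *\<^sub>v v = 0\<^sub>v (dimv \<mu> x)" by auto
    have "p' x *\<^sub>v v = h x *\<^sub>v 0\<^sub>v (dimv \<mu> x)"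
      using assoc_mult_mat_vec[OF rep_homD(1)[OF h(1) x] rep_homD(1)[OF hom x] v(1)] h(2) v(2) by simp
    also have "\<dots> = 0\<^sub>v (dimv \<mu>' x)" using rep_homD(1)[OF h(1) x] by (intro eq_vecI) auto
    finally show "v \<in> inj_kernel Q \<phi> x" using p'(2) v(1) by simp
  qed
qed

lemma ex_largest_surj_sub: "\<exists>\<epsilon> i. largest_surj_sub Q \<phi> \<epsilon> i"
proof -
  obtain \<epsilon> i where "surj_sub Q \<phi> \<epsilon> i"
    "\<forall>x\<in>verts Q. (*\<^sub>v) (i x) ` carrier_vec (dimv \<epsilon> x) = surj_part Q \<phi> x"
    using ex_surj_part_sub by (elim exE conjE)
  then have "largest_surj_sub Q \<phi> \<epsilon> i" by (intro largest_surj_subI) auto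
  then show ?thesis by blast
qed

lemma ex_largest_inj_quot: "\<exists>\<mu> p. largest_inj_quot Q \<phi> \<mu> p"
proof -
  obtain \<mu> p where p: "inj_quot Q \<phi> \<mu> p"
    "\<forall>x\<in>verts Q. inj_kernel Q \<phi> x = {v\<in>carrier_vec (dimv \<phi> x). p x *\<^sub>v v = 0\<^sub>v (dimv \<mu> x)}"
    using ex_inj_kernel_quot by (elim exE conjE)
  have "largest_inj_quot Q \<phi> \<mu> p" by (rule largest_inj_quotI[OF p(1) p(2)[rule_format]])
  then show ?thesis by blast
qed

end

text \<open>The dimension of the surjective part modulo its intersection with the kernel, hence that
  of its image in the largest injective quotient, expressed by leading positions.\<close>

definition rank_at :: "quiver \<Rightarrow> 'k::field rep \<Rightarrow> nat \<Rightarrow> nat" where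
  "rank_at Q \<phi> x = card (piv (dimv \<phi> x) (surj_part Q \<phi> x) - piv (dimv \<phi> x) (surj_part Q \<phi> x \<inter> inj_kernel Q \<phi> x))"

lemma rank_largest:
  assumes "quiver Q" "is_rep Q \<phi>" "largest_surj_sub Q \<phi> \<epsilon> i" "largest_inj_quot Q \<phi> \<mu> p" "x \<in> verts Q"
  shows "vec_space.rank (dimv \<mu> x) (p x * i x) = rank_at Q \<phi> x"
proof -
  have hom: "rep_hom Q \<epsilon> \<phi> i" "rep_hom Q \<phi> \<mu> p"
    using assms(3,4) unfolding largest_surj_sub_def surj_sub_def largest_inj_quot_def inj_quot_def by auto
  show ?thesis unfolding rank_at_def
    by (rule rank_mult[OF rep_homD(1)[OF hom(2) assms(5)] rep_homD(1)[OF hom(1) assms(5)]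
      largest_surj_sub_range[OF assms(1,2,3,5), symmetric] largest_inj_quot_kernel[OF assms(1,2,4,5), symmetric]])
qed

text \<open>\<open>mats \<mu> a\<close> maps the image at the tail isomorphically onto the image at
  the head: it is injective, and the image at the head is exhausted because
  \<open>mats \<epsilon> a\<close> is surjective. A basis \<open>J\<close> at the tail is therefore
  carried to a basis at the head.\<close>

lemma rank_at_arrow:
  fixes \<phi> :: "'k::field rep"
  assumes Q: "quiver Q" and rep: "is_rep Q \<phi>" and a: "a \<in> arcs Q"
  shows "rank_at Q \<phi> (tail Q a) = rank_at Q \<phi> (head Q a)"
proof -
  obtain \<epsilon> i where i: "largest_surj_sub Q \<phi> \<epsilon> i" using ex_largest_surj_sub[OF Q rep] by (elim exE)
  obtain \<mu> p where p: "largest_inj_quot Q \<phi> \<mu> p" using ex_largest_inj_quot[OF Q rep] by (elim exE)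
  have rep_\<epsilon>: "is_rep Q \<epsilon>" and hom_i: "rep_hom Q \<epsilon> \<phi> i" and surj: "mat_surj (mats \<epsilon> a)"
    using i a unfolding largest_surj_sub_def surj_sub_def by auto
  have rep_\<mu>: "is_rep Q \<mu>" and hom_p: "rep_hom Q \<phi> \<mu> p" and inj: "mat_inj (mats \<mu> a)"
    using p a unfolding largest_inj_quot_def inj_quot_def by auto
  note h = quiverD(4)[OF Q a] and t = quiverD(5)[OF Q a]
  let ?t = "tail Q a" and ?h = "head Q a"
  note it = rep_homD(1)[OF hom_i t] and ih = rep_homD(1)[OF hom_i h]
  note pt = rep_homD(1)[OF hom_p t] and ph = rep_homD(1)[OF hom_p h]
  note e = is_repD[OF rep_\<epsilon> a] and m = is_repD[OF rep_\<mu> a]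
  obtain d J where J: "J \<in> carrier_mat (dimv \<mu> ?t) d" "mat_inj J"
    and J_range: "(*\<^sub>v) J ` carrier_vec d = (*\<^sub>v) (p ?t * i ?t) ` carrier_vec (dimv \<epsilon> ?t)"
    using ex_mat_inj_range[OF subsp_image[OF subsp_carrier mult_carrier_mat[OF pt it]]] by auto
  have J0: "c = 0\<^sub>v d" if "c \<in> carrier_vec d" "J *\<^sub>v c = 0\<^sub>v (dimv \<mu> ?t)" for c
    using J(2) that unfolding mat_inj_iff[OF J(1)] by simp
  have "vec_space.rank (dimv \<mu> ?t) (p ?t * i ?t) = d"
    by (rule rank_eq_dim_col[OF mult_carrier_mat[OF pt it] J(1) J0 J_range[symmetric]])
  moreover have "vec_space.rank (dimv \<mu> ?h) (p ?h * i ?h) = d"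
  proof (rule rank_eq_dim_col[OF mult_carrier_mat[OF ph ih] mult_carrier_mat[OF m J(1)]])
    fix c :: "'k vec" assume c: "c \<in> carrier_vec d" "(mats \<mu> a * J) *\<^sub>v c = 0\<^sub>v (dimv \<mu> ?h)"
    then have "mats \<mu> a *\<^sub>v (J *\<^sub>v c) = 0\<^sub>v (dimv \<mu> ?h)" using assoc_mult_mat_vec[OF m J(1) c(1)] by simp
    then have "J *\<^sub>v c = 0\<^sub>v (dimv \<mu> ?t)"
      using inj mult_mat_vec_carrier[OF J(1) c(1)] unfolding mat_inj_iff[OF m] by simp
    then show "c = 0\<^sub>v d" using J0 c(1) by simp
  next
    have "(*\<^sub>v) (p ?h * i ?h) ` carrier_vec (dimv \<epsilon> ?h) = (*\<^sub>v) (p ?h * i ?h) ` ((*\<^sub>v) (mats \<epsilon> a) ` carrier_vec (dimv \<epsilon> ?t))"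
      using surj e unfolding mat_surj_def by simp
    also have "\<dots> = (\<lambda>u. mats \<mu> a *\<^sub>v ((p ?t * i ?t) *\<^sub>v u)) ` carrier_vec (dimv \<epsilon> ?t)"
      unfolding image_image
    proof (rule image_cong[OF refl])
      fix u :: "'k vec" assume u: "u \<in> carrier_vec (dimv \<epsilon> ?t)"
      have "(p ?h * i ?h) *\<^sub>v (mats \<epsilon> a *\<^sub>v u) = p ?h *\<^sub>v (i ?h *\<^sub>v (mats \<epsilon> a *\<^sub>v u))"
        by (rule assoc_mult_mat_vec[OF ph ih mult_mat_vec_carrier[OF e u]])
      also have "\<dots> = p ?h *\<^sub>v (mats \<phi> a *\<^sub>v (i ?t *\<^sub>v u))"
        by (simp only: rep_hom_mult_vec[OF Q rep_\<epsilon> rep hom_i a u])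
      also have "\<dots> = mats \<mu> a *\<^sub>v (p ?t *\<^sub>v (i ?t *\<^sub>v u))"
        by (rule rep_hom_mult_vec[OF Q rep rep_\<mu> hom_p a mult_mat_vec_carrier[OF it u]])
      also have "p ?t *\<^sub>v (i ?t *\<^sub>v u) = (p ?t * i ?t) *\<^sub>v u"
        by (rule assoc_mult_mat_vec[OF pt it u, symmetric])
      finally show "(p ?h * i ?h) *\<^sub>v (mats \<epsilon> a *\<^sub>v u) = mats \<mu> a *\<^sub>v ((p ?t * i ?t) *\<^sub>v u)" .
    qed
    also have "\<dots> = (*\<^sub>v) (mats \<mu> a) ` ((*\<^sub>v) J ` carrier_vec d)"
      unfolding J_range by (simp only: image_image)
    also have "\<dots> = (*\<^sub>v) (mats \<mu> a * J) ` carrier_vec d"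
      unfolding image_image using assoc_mult_mat_vec[OF m J(1)] by (intro image_cong refl) simp
    finally show "(*\<^sub>v) (p ?h * i ?h) ` carrier_vec (dimv \<epsilon> ?h) = (*\<^sub>v) (mats \<mu> a * J) ` carrier_vec d" .
  qed
  ultimately show ?thesis
    using rank_largest[OF Q rep i p t] rank_largest[OF Q rep i p h] by simp
qed

text \<open>The description operator in \<open>global_rank\<close> is well defined because all
  choices of largest objects give the value \<open>rank_at\<close>, and there is at least one vertex
  at which to compare.\<close>

lemma global_rank_eq:
  assumes "quiver Q" "is_rep Q \<phi>" "largest_surj_sub Q \<phi> \<epsilon> i" "largest_inj_quot Q \<phi> \<mu> p"
    and "\<And>x. x \<in> verts Q \<Longrightarrow> vec_space.rank (dimv \<mu> x) (p x * i x) = n"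
  shows "global_rank Q \<phi> = n"
  unfolding global_rank_def
proof (rule the_equality)
  show "\<exists>\<epsilon> i \<mu> p. largest_surj_sub Q \<phi> \<epsilon> i \<and> largest_inj_quot Q \<phi> \<mu> p \<and>
     (\<forall>x\<in>verts Q. vec_space.rank (dimv \<mu> x) (p x * i x) = n)"
    using assms(3,4,5) by blast
  fix m assume "\<exists>\<epsilon> i \<mu> p. largest_surj_sub Q \<phi> \<epsilon> i \<and> largest_inj_quot Q \<phi> \<mu> p \<and>
     (\<forall>x\<in>verts Q. vec_space.rank (dimv \<mu> x) (p x * i x) = m)"
  then obtain \<epsilon>' i' \<mu>' p' where *: "largest_surj_sub Q \<phi> \<epsilon>' i'" "largest_inj_quot Q \<phi> \<mu>' p'"
    "\<forall>x\<in>verts Q. vec_space.rank (dimv \<mu>' x) (p' x * i' x) = m" by (elim exE conjE)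
  obtain x where "x \<in> verts Q" using quiverD(3)[OF assms(1)] by auto
  then show "m = n"
    using rank_largest[OF assms(1-4)] rank_largest[OF assms(1,2) *(1,2)] assms(5) *(3) by simp
qed

lemma global_rank_rank_at:
  assumes "quiver Q" "is_rep Q \<phi>" "x \<in> verts Q"
  shows "global_rank Q \<phi> = rank_at Q \<phi> x"
proof -
  obtain \<epsilon> i where i: "largest_surj_sub Q \<phi> \<epsilon> i" using ex_largest_surj_sub[OF assms(1,2)] by (elim exE)
  obtain \<mu> p where p: "largest_inj_quot Q \<phi> \<mu> p" using ex_largest_inj_quot[OF assms(1,2)] by (elim exE)
  show ?thesis
  proof (rule global_rank_eq[OF assms(1,2) i p])
    fix y assume y: "y \<in> verts Q"
    have "rank_at Q \<phi> y = rank_at Q \<phi> x"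
      by (rule connected_constant[OF assms(1) _ y assms(3)]) (rule rank_at_arrow[OF assms(1,2)])
    then show "vec_space.rank (dimv \<mu> y) (p y * i y) = rank_at Q \<phi> x"
      using rank_largest[OF assms(1,2) i p y] by simp
  qed
qed

section \<open>Rank functions are constructible on polynomial families of representations\<close>

text \<open>The parameter space is independent of \<open>Q\<close> and \<open>\<alpha>\<close>. In
  the induction over rank functions the quiver and the dimension vector change, while the points of
  \<open>X\<close> continue to parametrize the family.\<close>

definition polyrep :: "quiver \<Rightarrow> (nat \<Rightarrow> nat) \<Rightarrow> 'p set \<Rightarrow> ('p \<Rightarrow> 'k::field) set \<Rightarrow> ('p \<Rightarrow> nat \<Rightarrow> 'k mat) \<Rightarrow> bool" where
  "polyrep Q \<alpha> X C \<Phi> \<longleftrightarrow> (\<forall>a\<in>arcs Q. polymat X C (\<alpha> (head Q a)) (\<alpha> (tail Q a)) (\<lambda>x. \<Phi> x a))"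

definition constr_fun :: "'p set \<Rightarrow> ('p \<Rightarrow> 'k::field) set \<Rightarrow> ('p \<Rightarrow> nat) \<Rightarrow> bool" where
  "constr_fun X C f \<longleftrightarrow> finite (f ` X) \<and> (\<forall>n. constr X C {x\<in>X. f x = n})"

lemma point_rep_simps [simp]: "dimv (point_rep \<alpha> \<phi>) = \<alpha>" "mats (point_rep \<alpha> \<phi>) = \<phi>"
  unfolding point_rep_def by auto

lemma polyrep_is_rep: "polyrep Q \<alpha> X C \<Phi> \<Longrightarrow> x \<in> X \<Longrightarrow> is_rep Q (point_rep \<alpha> (\<Phi> x))"
  unfolding polyrep_def is_rep_def polymat_def by simp

lemma constr_fun_cong: "constr_fun X C f \<Longrightarrow> (\<And>x. x \<in> X \<Longrightarrow> f x = g x) \<Longrightarrow> constr_fun X C g"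
  unfolding constr_fun_def by (auto cong: image_cong conj_cong)

text \<open>Whether the cardinality is \<open>n\<close> is decided by a finite disjunction over the
  sets \<open>J\<close> of \<open>n\<close> indices for which \<open>P\<close> may hold.\<close>

lemma constr_fun_card:
  fixes N :: nat
  assumes "\<And>j. j < N \<Longrightarrow> constr X C {x\<in>X. P j x}"
  shows "constr_fun X C (\<lambda>x. card {j. j < N \<and> P j x})"
  unfolding constr_fun_def
proof (intro conjI allI)
  have "card {j. j < N \<and> P j x} \<le> N" for x
    using card_mono[of "{..<N}" "{j. j < N \<and> P j x}"] by auto
  then have "(\<lambda>x. card {j. j < N \<and> P j x}) ` X \<subseteq> {..N}" by auto
  then show "finite ((\<lambda>x. card {j. j < N \<and> P j x}) ` X)" by (rule finite_subset) simp
  fix n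
  let ?\<J> = "{J. J \<subseteq> {..<N} \<and> card J = n}"
  have "constr X C {x\<in>X. \<exists>J\<in>?\<J>. \<forall>j\<in>{..<N}. if j \<in> J then P j x else \<not> P j x}"
  proof (intro constr_Bex constr_Ball)
    show "finite ?\<J>" by (rule finite_subset[of _ "Pow {..<N}"]) auto
    show "constr X C {x\<in>X. if j \<in> J then P j x else \<not> P j x}" if "j \<in> {..<N}" for j J
      using assms[of j] that constr_not[of X C "P j"] by (cases "j \<in> J") auto
  qed simp
  moreover have "(\<exists>J\<in>?\<J>. \<forall>j\<in>{..<N}. if j \<in> J then P j x else \<not> P j x) \<longleftrightarrow> card {j. j < N \<and> P j x} = n" for x
  proof
    assume "\<exists>J\<in>?\<J>. \<forall>j\<in>{..<N}. if j \<in> J then P j x else \<not> P j x"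
    then obtain J where J: "J \<subseteq> {..<N}" "card J = n" "\<forall>j\<in>{..<N}. if j \<in> J then P j x else \<not> P j x" by auto
    have "{j. j < N \<and> P j x} = J" using J(1,3) by (auto split: if_splits)
    then show "card {j. j < N \<and> P j x} = n" using J(2) by simp
  next
    assume "card {j. j < N \<and> P j x} = n"
    then show "\<exists>J\<in>?\<J>. \<forall>j\<in>{..<N}. if j \<in> J then P j x else \<not> P j x"
      by (intro bexI[of _ "{j. j < N \<and> P j x}"]) auto
  qed
  ultimately show "constr X C {x\<in>X. card {j. j < N \<and> P j x} = n}" by simp
qed

text \<open>The steps act pointwise in \<open>x\<close>, but definability is a property of the
  family as a whole, hence a second version of the invariant rule.\<close>

lemma fold_funpow_param_invariant:
  assumes "\<And>s W. s \<in> set os \<Longrightarrow> J W \<Longrightarrow> J (\<lambda>x. st x s (W x))" "J W0"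
  shows "J (\<lambda>x. (fold (st x) os ^^ n) (W0 x))"
proof -
  have "J (\<lambda>x. fold (st x) os (W x))" if "J W" for W
    using that assms(1) by (induction os arbitrary: W) auto
  then show ?thesis using assms(2) by (induction n) auto
qed

definition definable_family :: "quiver \<Rightarrow> (nat \<Rightarrow> nat) \<Rightarrow> 'p set \<Rightarrow> ('p \<Rightarrow> 'k::field) set \<Rightarrow> ('p \<Rightarrow> 'k family) \<Rightarrow> bool" where
  "definable_family Q \<alpha> X C W \<longleftrightarrow> (\<forall>v\<in>verts Q. definable X C (\<alpha> v) (\<lambda>x. W x v))"

lemma definable_family_upd:
  "definable_family Q \<alpha> X C W \<Longrightarrow> definable X C (\<alpha> v) S \<Longrightarrow> definable_family Q \<alpha> X C (\<lambda>x. (W x)(v := S x))"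
  unfolding definable_family_def
proof
  fix u assume W: "\<forall>v\<in>verts Q. definable X C (\<alpha> v) (\<lambda>x. W x v)" and S: "definable X C (\<alpha> v) S" and u: "u \<in> verts Q"
  show "definable X C (\<alpha> u) (\<lambda>x. ((W x)(v := S x)) u)"
    using W S u by (cases "u = v") auto
qed

lemma definable_surj_part:
  assumes Q: "quiver Q" and \<Phi>: "polyrep Q \<alpha> X C \<Phi>"
  shows "definable_family Q \<alpha> X C (\<lambda>x. surj_part Q (point_rep \<alpha> (\<Phi> x)))"
  unfolding surj_part_def point_rep_simps
proof (rule fold_funpow_param_invariant[where J = "definable_family Q \<alpha> X C" and
    st = "\<lambda>x. down_step Q (point_rep \<alpha> (\<Phi> x))"])
  fix s W assume s: "s \<in> set (arc_ops Q)" and W: "definable_family Q \<alpha> X C W"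
  obtain a b where ab: "s = (a, b)" "a \<in> arcs Q" using s unfolding set_arc_ops[OF quiverD(1)[OF Q]] by auto
  have A: "polymat X C (\<alpha> (head Q a)) (\<alpha> (tail Q a)) (\<lambda>x. \<Phi> x a)" using \<Phi> ab(2) unfolding polyrep_def by simp
  have h: "definable X C (\<alpha> (head Q a)) (\<lambda>x. W x (head Q a))" and t: "definable X C (\<alpha> (tail Q a)) (\<lambda>x. W x (tail Q a))"
    using W quiverD(4,5)[OF Q ab(2)] unfolding definable_family_def by auto
  show "definable_family Q \<alpha> X C (\<lambda>x. down_step Q (point_rep \<alpha> (\<Phi> x)) s (W x))"
  proof (cases b)
    case True
    from definable_family_upd[OF W definable_int[OF t definable_preimage[OF h A]]]
    show ?thesis unfolding ab(1) down_step_def using True by simp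
  next
    case False
    from definable_family_upd[OF W definable_int[OF h definable_image[OF t A]]]
    show ?thesis unfolding ab(1) down_step_def using False by simp
  qed
qed (simp add: definable_family_def definable_carrier)

lemma definable_inj_kernel:
  assumes Q: "quiver Q" and \<Phi>: "polyrep Q \<alpha> X C \<Phi>"
  shows "definable_family Q \<alpha> X C (\<lambda>x. inj_kernel Q (point_rep \<alpha> (\<Phi> x)))"
  unfolding inj_kernel_def point_rep_simps
proof (rule fold_funpow_param_invariant[where J = "definable_family Q \<alpha> X C" and
    st = "\<lambda>x. up_step Q (point_rep \<alpha> (\<Phi> x))"])
  fix s W assume s: "s \<in> set (arc_ops Q)" and W: "definable_family Q \<alpha> X C W"
  obtain a b where ab: "s = (a, b)" "a \<in> arcs Q" using s unfolding set_arc_ops[OF quiverD(1)[OF Q]] by auto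
  have A: "polymat X C (\<alpha> (head Q a)) (\<alpha> (tail Q a)) (\<lambda>x. \<Phi> x a)" using \<Phi> ab(2) unfolding polyrep_def by simp
  have h: "definable X C (\<alpha> (head Q a)) (\<lambda>x. W x (head Q a))" and t: "definable X C (\<alpha> (tail Q a)) (\<lambda>x. W x (tail Q a))"
    using W quiverD(4,5)[OF Q ab(2)] unfolding definable_family_def by auto
  show "definable_family Q \<alpha> X C (\<lambda>x. up_step Q (point_rep \<alpha> (\<Phi> x)) s (W x))"
  proof (cases b)
    case True
    from definable_family_upd[OF W definable_vsum[OF t definable_preimage[OF h A]]]
    show ?thesis unfolding ab(1) up_step_def using True by simp
  next
    case False
    from definable_family_upd[OF W definable_vsum[OF h definable_image[OF t A]]]
    show ?thesis unfolding ab(1) up_step_def using False by simp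
  qed
qed (simp add: definable_family_def definable_zero)

lemma constr_fun_global_rank:
  assumes Q: "quiver Q" and \<Phi>: "polyrep Q \<alpha> X C \<Phi>"
  shows "constr_fun X C (\<lambda>x. global_rank Q (point_rep \<alpha> (\<Phi> x)))"
proof -
  obtain v where v: "v \<in> verts Q" using quiverD(3)[OF Q] by auto
  let ?E = "\<lambda>x. surj_part Q (point_rep \<alpha> (\<Phi> x)) v" and ?N = "\<lambda>x. inj_kernel Q (point_rep \<alpha> (\<Phi> x)) v"
  have E: "definable X C (\<alpha> v) ?E" and N: "definable X C (\<alpha> v) ?N"
    by (rule definable_surj_part[OF assms, unfolded definable_family_def, THEN bspec, OF v],
        rule definable_inj_kernel[OF assms, unfolded definable_family_def, THEN bspec, OF v])
  let ?P = "\<lambda>j x. j \<in> piv (\<alpha> v) (?E x) \<and> \<not> j \<in> piv (\<alpha> v) (?E x \<inter> ?N x)"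
  have "constr_fun X C (\<lambda>x. card {j. j < \<alpha> v \<and> ?P j x})"
    by (intro constr_fun_card constr_conj constr_not constr_piv E definable_int N)
  then show ?thesis
  proof (rule constr_fun_cong)
    fix x assume x: "x \<in> X"
    have "{j. j < \<alpha> v \<and> ?P j x} = piv (\<alpha> v) (?E x) - piv (\<alpha> v) (?E x \<inter> ?N x)"
      using piv_lessThan by auto
    then show "card {j. j < \<alpha> v \<and> ?P j x} = global_rank Q (point_rep \<alpha> (\<Phi> x))"
      unfolding global_rank_rank_at[OF Q polyrep_is_rep[OF \<Phi> x] v] rank_at_def by simp
  qed
qed

section \<open>Pullbacks and pushforwards of polynomial families\<close>

lemma pullback_point_rep:
  "pullback fv fa (point_rep \<alpha> \<phi>) = point_rep (\<lambda>x. \<alpha> (fv x)) (\<lambda>a. \<phi> (fa a))"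
  unfolding pullback_def point_rep_def by simp

lemma polyrep_pullback:
  assumes "quiver_hom Q' Q fv fa" "polyrep Q \<alpha> X C \<Phi>"
  shows "polyrep Q' (\<lambda>x. \<alpha> (fv x)) X C (\<lambda>x a. \<Phi> x (fa a))"
  unfolding polyrep_def
proof
  fix a assume "a \<in> arcs Q'"
  then have "fa a \<in> arcs Q" "tail Q (fa a) = fv (tail Q' a)" "head Q (fa a) = fv (head Q' a)"
    using assms(1) unfolding quiver_hom_def by auto
  then show "polymat X C (\<alpha> (fv (head Q' a))) (\<alpha> (fv (tail Q' a))) (\<lambda>x. \<Phi> x (fa a))"
    using assms(2) unfolding polyrep_def by metis
qed

text \<open>This and the next definitions restate the pushforward in terms of the dimension vector,
  which is constant along a family; the block positions thus do not depend on the parameter.\<close>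

definition fibre_dim :: "quiver \<Rightarrow> (nat \<Rightarrow> nat) \<Rightarrow> (nat \<Rightarrow> nat) \<Rightarrow> nat \<Rightarrow> nat" where
  "fibre_dim Q fv \<alpha> x = (\<Sum>y | y \<in> verts Q \<and> fv y = x. \<alpha> y)"

definition offset :: "quiver \<Rightarrow> (nat \<Rightarrow> nat) \<Rightarrow> (nat \<Rightarrow> nat) \<Rightarrow> nat \<Rightarrow> nat" where
  "offset Q fv \<alpha> y = (\<Sum>z | z \<in> verts Q \<and> fv z = fv y \<and> z < y. \<alpha> z)"

definition block_entry :: "nat \<Rightarrow> nat \<Rightarrow> nat \<Rightarrow> nat \<Rightarrow> 'k::field mat \<Rightarrow> nat \<Rightarrow> nat \<Rightarrow> 'k" where
  "block_entry s t m n M i j = (if s \<le> i \<and> i < s + m \<and> t \<le> j \<and> j < t + n then M $$ (i - s, j - t) else 0)"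

definition push_mats :: "quiver \<Rightarrow> quiver \<Rightarrow> (nat \<Rightarrow> nat) \<Rightarrow> (nat \<Rightarrow> nat) \<Rightarrow> (nat \<Rightarrow> nat) \<Rightarrow> (nat \<Rightarrow> 'k::field mat) \<Rightarrow> nat \<Rightarrow> 'k mat" where
  "push_mats Q Q' fv fa \<alpha> \<phi> a = mat (fibre_dim Q fv \<alpha> (head Q' a)) (fibre_dim Q fv \<alpha> (tail Q' a))
     (\<lambda>(i, j). \<Sum>b | b \<in> arcs Q \<and> fa b = a. block_entry (offset Q fv \<alpha> (head Q b)) (offset Q fv \<alpha> (tail Q b))
        (\<alpha> (head Q b)) (\<alpha> (tail Q b)) (\<phi> b) i j)"

lemma pushforward_point_rep:
  "pushforward Q Q' fv fa (point_rep \<alpha> \<phi>) = point_rep (fibre_dim Q fv \<alpha>) (push_mats Q Q' fv fa \<alpha> \<phi>)"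
proof (rule rep.equality)
  have entry: "extended_entry Q fv (point_rep \<alpha> \<phi>) b ij = block_entry (offset Q fv \<alpha> (head Q b)) (offset Q fv \<alpha> (tail Q b))
      (\<alpha> (head Q b)) (\<alpha> (tail Q b)) (\<phi> b) (fst ij) (snd ij)" for b ij
    by (simp add: extended_entry_def block_entry_def block_start_def offset_def Let_def case_prod_unfold)
  show "mats (pushforward Q Q' fv fa (point_rep \<alpha> \<phi>)) = mats (point_rep (fibre_dim Q fv \<alpha>) (push_mats Q Q' fv fa \<alpha> \<phi>))"
    unfolding pushforward_def Let_def point_rep_simps push_mats_def fibre_dim_def
    by (simp add: entry case_prod_unfold)
qed (simp_all add: pushforward_def fibre_dim_def Let_def fun_eq_iff point_rep_def)

lemma ex_polyfun_sum:
  assumes "finite I" "\<And>b. b \<in> I \<Longrightarrow> \<exists>f\<in>polyfun C. \<forall>x\<in>X. g b x = f x"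
  shows "\<exists>f\<in>polyfun C. \<forall>x\<in>X. (\<Sum>b\<in>I. g b x) = f x"
  using assms
proof (induction I rule: finite_induct)
  case empty
  show ?case by (rule bexI[OF _ polyfun.const[of 0]]) simp
next
  case (insert b I)
  obtain f where f: "f \<in> polyfun C" "\<forall>x\<in>X. g b x = f x" using insert.prems[of b] by auto
  obtain f' where f': "f' \<in> polyfun C" "\<forall>x\<in>X. (\<Sum>b\<in>I. g b x) = f' x" using insert.IH insert.prems by auto
  show ?case by (rule bexI[OF _ polyfun.add[OF f(1) f'(1)]]) (use f(2) f'(2) insert.hyps in simp)
qed

lemma polyrep_pushforward:
  assumes Q: "quiver Q" and \<Phi>: "polyrep Q \<alpha> X C \<Phi>"
  shows "polyrep Q' (fibre_dim Q fv \<alpha>) X C (\<lambda>x. push_mats Q Q' fv fa \<alpha> (\<Phi> x))"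
  unfolding polyrep_def polymat_def
proof (intro ballI conjI allI impI)
  fix a i j assume i: "i < fibre_dim Q fv \<alpha> (head Q' a)" and j: "j < fibre_dim Q fv \<alpha> (tail Q' a)"
  let ?e = "\<lambda>b x. block_entry (offset Q fv \<alpha> (head Q b)) (offset Q fv \<alpha> (tail Q b))
        (\<alpha> (head Q b)) (\<alpha> (tail Q b)) (\<Phi> x b) i j"
  have "\<exists>f\<in>polyfun C. \<forall>x\<in>X. ?e b x = f x" if b: "b \<in> arcs Q" for b
  proof (cases "offset Q fv \<alpha> (head Q b) \<le> i \<and> i < offset Q fv \<alpha> (head Q b) + \<alpha> (head Q b) \<and>
      offset Q fv \<alpha> (tail Q b) \<le> j \<and> j < offset Q fv \<alpha> (tail Q b) + \<alpha> (tail Q b)")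
    case True
    then have "i - offset Q fv \<alpha> (head Q b) < \<alpha> (head Q b)" "j - offset Q fv \<alpha> (tail Q b) < \<alpha> (tail Q b)" by auto
    then show ?thesis using \<Phi> b True unfolding polyrep_def polymat_def block_entry_def by simp
  next
    case False
    then have "?e b x = 0" for x unfolding block_entry_def by auto
    then show ?thesis by (intro bexI[OF _ polyfun.const[of 0]]) simp
  qed
  then have "\<exists>f\<in>polyfun C. \<forall>x\<in>X. (\<Sum>b | b \<in> arcs Q \<and> fa b = a. ?e b x) = f x"
    using quiverD(1)[OF Q] by (intro ex_polyfun_sum) auto
  then show "\<exists>f\<in>polyfun C. \<forall>x\<in>X. push_mats Q Q' fv fa \<alpha> (\<Phi> x) a $$ (i, j) = f x"
    unfolding push_mats_def using i j by simp
qed (simp add: push_mats_def)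

lemma rank_function_constr_fun:
  assumes "rank_function Q r" "polyrep Q \<alpha> X C \<Phi>"
  shows "constr_fun X C (\<lambda>x. r (point_rep \<alpha> (\<Phi> x)))"
  using assms
proof (induction arbitrary: \<alpha> \<Phi> rule: rank_function.induct)
  case (global Q)
  then show ?case by (rule constr_fun_global_rank)
next
  case (pull Q Q' fv fa r)
  show ?case unfolding pullback_point_rep by (rule pull.IH[OF polyrep_pullback[OF pull(2) pull.prems]])
next
  case (push Q Q' fv fa r)
  show ?case unfolding pushforward_point_rep by (rule push.IH[OF polyrep_pushforward[OF push(1) push.prems]])
qed

section \<open>Rank functions are invariant under change of basis\<close>

text \<open>An isomorphism together with its inverse. Keeping \<open>h\<close> explicit makes the
  relation symmetric, and pullbacks and pushforwards then supply the inverse by the same formula as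
  the isomorphism.\<close>

definition base_change :: "quiver \<Rightarrow> (nat \<Rightarrow> nat) \<Rightarrow> (nat \<Rightarrow> 'k::field mat) \<Rightarrow> (nat \<Rightarrow> 'k mat) \<Rightarrow>
    (nat \<Rightarrow> 'k mat) \<Rightarrow> (nat \<Rightarrow> 'k mat) \<Rightarrow> bool" where
  "base_change Q \<alpha> \<phi> \<psi> g h \<longleftrightarrow>
     (\<forall>x\<in>verts Q. g x \<in> carrier_mat (\<alpha> x) (\<alpha> x) \<and> h x \<in> carrier_mat (\<alpha> x) (\<alpha> x) \<and>
        g x * h x = 1\<^sub>m (\<alpha> x) \<and> h x * g x = 1\<^sub>m (\<alpha> x)) \<and>
     (\<forall>a\<in>arcs Q. \<phi> a \<in> carrier_mat (\<alpha> (head Q a)) (\<alpha> (tail Q a)) \<and>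
        \<psi> a \<in> carrier_mat (\<alpha> (head Q a)) (\<alpha> (tail Q a)) \<and> g (head Q a) * \<phi> a = \<psi> a * g (tail Q a))"

lemma base_changeD:
  assumes "base_change Q \<alpha> \<phi> \<psi> g h"
  shows "x \<in> verts Q \<Longrightarrow> g x \<in> carrier_mat (\<alpha> x) (\<alpha> x)" "x \<in> verts Q \<Longrightarrow> h x \<in> carrier_mat (\<alpha> x) (\<alpha> x)"
    "x \<in> verts Q \<Longrightarrow> g x * h x = 1\<^sub>m (\<alpha> x)" "x \<in> verts Q \<Longrightarrow> h x * g x = 1\<^sub>m (\<alpha> x)"
    "a \<in> arcs Q \<Longrightarrow> \<phi> a \<in> carrier_mat (\<alpha> (head Q a)) (\<alpha> (tail Q a))"
    "a \<in> arcs Q \<Longrightarrow> \<psi> a \<in> carrier_mat (\<alpha> (head Q a)) (\<alpha> (tail Q a))"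
    "a \<in> arcs Q \<Longrightarrow> g (head Q a) * \<phi> a = \<psi> a * g (tail Q a)"
  using assms unfolding base_change_def by auto

lemma base_change_rep:
  assumes "base_change Q \<alpha> \<phi> \<psi> g h"
  shows "is_rep Q (point_rep \<alpha> \<phi>)" "is_rep Q (point_rep \<alpha> \<psi>)" "rep_hom Q (point_rep \<alpha> \<phi>) (point_rep \<alpha> \<psi>) g"
  using base_changeD[OF assms] unfolding is_rep_def rep_hom_def by auto

lemma base_change_sym:
  assumes Q: "quiver Q" and bc: "base_change Q \<alpha> \<phi> \<psi> g h"
  shows "base_change Q \<alpha> \<psi> \<phi> h g"
proof -
  have "h (head Q a) * \<psi> a = \<phi> a * h (tail Q a)" if a: "a \<in> arcs Q" for a
  proof -
    note b = base_changeD[OF bc]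
    note vh = quiverD(4)[OF Q a] and vt = quiverD(5)[OF Q a]
    have "h (head Q a) * \<psi> a = h (head Q a) * (\<psi> a * (g (tail Q a) * h (tail Q a)))"
      using b(6)[OF a] b(3)[OF vt] by simp
    also have "\<dots> = h (head Q a) * ((\<psi> a * g (tail Q a)) * h (tail Q a))"
      using assoc_mult_mat[OF b(6)[OF a] b(1)[OF vt] b(2)[OF vt]] by simp
    also have "\<dots> = h (head Q a) * ((g (head Q a) * \<phi> a) * h (tail Q a))"
      using b(7)[OF a] by simp
    also have "\<dots> = h (head Q a) * (g (head Q a) * (\<phi> a * h (tail Q a)))"
      using assoc_mult_mat[OF b(1)[OF vh] b(5)[OF a] b(2)[OF vt]] by simp
    also have "\<dots> = (h (head Q a) * g (head Q a)) * (\<phi> a * h (tail Q a))"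
      by (rule assoc_mult_mat[OF b(2)[OF vh] b(1)[OF vh] mult_carrier_mat[OF b(5)[OF a] b(2)[OF vt]], symmetric])
    also have "\<dots> = \<phi> a * h (tail Q a)"
      using b(4)[OF vh] left_mult_one_mat[OF mult_carrier_mat[OF b(5)[OF a] b(2)[OF vt]]] by simp
    finally show ?thesis .
  qed
  then show ?thesis using base_changeD[OF bc] unfolding base_change_def by simp
qed

lemma rep_hom_comp:
  assumes Q: "quiver Q" and "is_rep Q \<phi>" "is_rep Q \<psi>" "is_rep Q \<chi>" and g: "rep_hom Q \<psi> \<chi> g" and i: "rep_hom Q \<phi> \<psi> i"
  shows "rep_hom Q \<phi> \<chi> (\<lambda>x. g x * i x)"
  unfolding rep_hom_def
proof (intro conjI ballI)
  show "g x * i x \<in> carrier_mat (dimv \<chi> x) (dimv \<phi> x)" if "x \<in> verts Q" for x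
    by (rule mult_carrier_mat[OF rep_homD(1)[OF g that] rep_homD(1)[OF i that]])
  fix a assume a: "a \<in> arcs Q"
  note vh = quiverD(4)[OF Q a] and vt = quiverD(5)[OF Q a]
  have "(g (head Q a) * i (head Q a)) * mats \<phi> a = g (head Q a) * (mats \<psi> a * i (tail Q a))"
    using assoc_mult_mat[OF rep_homD(1)[OF g vh] rep_homD(1)[OF i vh] is_repD[OF assms(2) a]] rep_homD(2)[OF i a] by simp
  also have "\<dots> = (mats \<chi> a * g (tail Q a)) * i (tail Q a)"
    using assoc_mult_mat[OF rep_homD(1)[OF g vh] is_repD[OF assms(3) a] rep_homD(1)[OF i vt]] rep_homD(2)[OF g a] by simp
  also have "\<dots> = mats \<chi> a * (g (tail Q a) * i (tail Q a))"
    by (rule assoc_mult_mat[OF is_repD[OF assms(4) a] rep_homD(1)[OF g vt] rep_homD(1)[OF i vt]])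
  finally show "(g (head Q a) * i (head Q a)) * mats \<phi> a = mats \<chi> a * (g (tail Q a) * i (tail Q a))" .
qed

lemma mat_inj_left_inverse:
  assumes "g \<in> carrier_mat n m" "h \<in> carrier_mat m n" "h * g = 1\<^sub>m m" "i \<in> carrier_mat m k" "mat_inj i"
  shows "mat_inj (g * i)"
  unfolding mat_inj_iff[OF mult_carrier_mat[OF assms(1,4)]]
proof (intro ballI impI)
  fix v assume v: "v \<in> carrier_vec k" "(g * i) *\<^sub>v v = 0\<^sub>v n"
  have iv: "i *\<^sub>v v \<in> carrier_vec m" by (rule mult_mat_vec_carrier[OF assms(4) v(1)])
  have "i *\<^sub>v v = (h * g) *\<^sub>v (i *\<^sub>v v)" using assms(3) one_mult_mat_vec[OF iv] by simp
  also have "\<dots> = h *\<^sub>v (g *\<^sub>v (i *\<^sub>v v))" by (rule assoc_mult_mat_vec[OF assms(2,1) iv])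
  also have "g *\<^sub>v (i *\<^sub>v v) = 0\<^sub>v n" using assoc_mult_mat_vec[OF assms(1,4) v(1)] v(2) by simp
  also have "h *\<^sub>v 0\<^sub>v n = 0\<^sub>v m" using assms(2) by (intro eq_vecI) auto
  finally show "v = 0\<^sub>v k" using assms(5) v(1) unfolding mat_inj_iff[OF assms(4)] by simp
qed

lemma mat_surj_right_inverse:
  assumes "h \<in> carrier_mat m n" "g \<in> carrier_mat n m" "h * g = 1\<^sub>m m" "p \<in> carrier_mat k m" "mat_surj p"
  shows "mat_surj (p * h)"
  unfolding mat_surj_iff[OF mult_carrier_mat[OF assms(4,1)]]
proof
  fix w :: "'a vec" assume "w \<in> carrier_vec k"
  then obtain v where v: "v \<in> carrier_vec m" "w = p *\<^sub>v v" using assms(5) unfolding mat_surj_iff[OF assms(4)] by auto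
  have gv: "g *\<^sub>v v \<in> carrier_vec n" by (rule mult_mat_vec_carrier[OF assms(2) v(1)])
  have "(p * h) *\<^sub>v (g *\<^sub>v v) = p *\<^sub>v (h *\<^sub>v (g *\<^sub>v v))" by (rule assoc_mult_mat_vec[OF assms(4,1) gv])
  also have "h *\<^sub>v (g *\<^sub>v v) = (h * g) *\<^sub>v v" by (rule assoc_mult_mat_vec[OF assms(1,2) v(1), symmetric])
  also have "\<dots> = v" using assms(3) one_mult_mat_vec[OF v(1)] by simp
  finally show "\<exists>v\<in>carrier_vec n. w = (p * h) *\<^sub>v v" using gv v(2) by metis
qed

context
  fixes Q :: quiver and \<alpha> :: "nat \<Rightarrow> nat" and \<phi> \<psi> :: "nat \<Rightarrow> 'k::field mat" and g h :: "nat \<Rightarrow> 'k mat"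
  assumes Q: "quiver Q" and bc: "base_change Q \<alpha> \<phi> \<psi> g h"
begin

lemma surj_sub_base_change:
  assumes "surj_sub Q (point_rep \<alpha> \<phi>) \<epsilon> i"
  shows "surj_sub Q (point_rep \<alpha> \<psi>) \<epsilon> (\<lambda>x. g x * i x)"
proof -
  have e: "is_rep Q \<epsilon>" "rep_hom Q \<epsilon> (point_rep \<alpha> \<phi>) i" using assms unfolding surj_sub_def by auto
  have "mat_inj (g x * i x)" if x: "x \<in> verts Q" for x
  proof (rule mat_inj_left_inverse[OF base_changeD(1)[OF bc x] base_changeD(2)[OF bc x] base_changeD(4)[OF bc x]])
    show "i x \<in> carrier_mat (\<alpha> x) (dimv \<epsilon> x)" using rep_homD(1)[OF e(2) x] by simp
    show "mat_inj (i x)" using assms x unfolding surj_sub_def by simp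
  qed
  then show ?thesis using assms rep_hom_comp[OF Q e(1) base_change_rep(1,2)[OF bc] base_change_rep(3)[OF bc] e(2)]
    unfolding surj_sub_def by simp
qed

lemma inj_quot_base_change:
  assumes "inj_quot Q (point_rep \<alpha> \<phi>) \<mu> p"
  shows "inj_quot Q (point_rep \<alpha> \<psi>) \<mu> (\<lambda>x. p x * h x)"
proof -
  have m: "is_rep Q \<mu>" "rep_hom Q (point_rep \<alpha> \<phi>) \<mu> p" using assms unfolding inj_quot_def by auto
  have "mat_surj (p x * h x)" if x: "x \<in> verts Q" for x
  proof (rule mat_surj_right_inverse[OF base_changeD(2)[OF bc x] base_changeD(1)[OF bc x] base_changeD(4)[OF bc x]])
    show "p x \<in> carrier_mat (dimv \<mu> x) (\<alpha> x)" using rep_homD(1)[OF m(2) x] by simp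
    show "mat_surj (p x)" using assms x unfolding inj_quot_def by simp
  qed
  then show ?thesis using assms rep_hom_comp[OF Q base_change_rep(2,1)[OF bc] m(1) m(2) base_change_rep(3)[OF base_change_sym[OF Q bc]]]
    unfolding inj_quot_def by simp
qed

end

text \<open>A second context, so that the preceding lemmas can also be applied to the inverse base
  change.\<close>

context
  fixes Q :: quiver and \<alpha> :: "nat \<Rightarrow> nat" and \<phi> \<psi> :: "nat \<Rightarrow> 'k::field mat" and g h :: "nat \<Rightarrow> 'k mat"
  assumes Q: "quiver Q" and bc: "base_change Q \<alpha> \<phi> \<psi> g h"
begin

lemma largest_surj_sub_base_change:
  assumes i: "largest_surj_sub Q (point_rep \<alpha> \<phi>) \<epsilon> i"
  shows "largest_surj_sub Q (point_rep \<alpha> \<psi>) \<epsilon> (\<lambda>x. g x * i x)"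
  unfolding largest_surj_sub_def
proof (intro conjI allI impI)
  show "surj_sub Q (point_rep \<alpha> \<psi>) \<epsilon> (\<lambda>x. g x * i x)"
    using i by (intro surj_sub_base_change[OF Q bc]) (simp add: largest_surj_sub_def)
  fix \<epsilon>' i' assume i': "surj_sub Q (point_rep \<alpha> \<psi>) \<epsilon>' i'"
  from surj_sub_base_change[OF Q base_change_sym[OF Q bc] i'] i
  obtain k where k: "rep_hom Q \<epsilon>' \<epsilon> k" "\<forall>x\<in>verts Q. h x * i' x = i x * k x"
    unfolding largest_surj_sub_def by blast
  have hom: "rep_hom Q \<epsilon>' (point_rep \<alpha> \<psi>) i'" "rep_hom Q \<epsilon> (point_rep \<alpha> \<phi>) i" using i i' unfolding largest_surj_sub_def surj_sub_def by auto
  have "i' x = (g x * i x) * k x" if x: "x \<in> verts Q" for x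
  proof -
    note gx = base_changeD(1)[OF bc x] and hx = base_changeD(2)[OF bc x]
    have i'x: "i' x \<in> carrier_mat (\<alpha> x) (dimv \<epsilon>' x)" and ix: "i x \<in> carrier_mat (\<alpha> x) (dimv \<epsilon> x)"
      using rep_homD(1)[OF hom(1) x] rep_homD(1)[OF hom(2) x] by auto
    have "i' x = (g x * h x) * i' x" using base_changeD(3)[OF bc x] left_mult_one_mat[OF i'x] by simp
    also have "\<dots> = g x * (h x * i' x)" by (rule assoc_mult_mat[OF gx hx i'x])
    also have "\<dots> = g x * (i x * k x)" using k(2) x by simp
    also have "\<dots> = (g x * i x) * k x" by (rule assoc_mult_mat[OF gx ix rep_homD(1)[OF k(1) x], symmetric])
    finally show ?thesis .
  qed
  then show "\<exists>k. rep_hom Q \<epsilon>' \<epsilon> k \<and> (\<forall>x\<in>verts Q. i' x = (g x * i x) * k x)" using k(1) by blast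
qed

lemma largest_inj_quot_base_change:
  assumes p: "largest_inj_quot Q (point_rep \<alpha> \<phi>) \<mu> p"
  shows "largest_inj_quot Q (point_rep \<alpha> \<psi>) \<mu> (\<lambda>x. p x * h x)"
  unfolding largest_inj_quot_def
proof (intro conjI allI impI)
  show "inj_quot Q (point_rep \<alpha> \<psi>) \<mu> (\<lambda>x. p x * h x)"
    using p by (intro inj_quot_base_change[OF Q bc]) (simp add: largest_inj_quot_def)
  fix \<mu>' p' assume p': "inj_quot Q (point_rep \<alpha> \<psi>) \<mu>' p'"
  from inj_quot_base_change[OF Q base_change_sym[OF Q bc] p'] p
  obtain k where k: "rep_hom Q \<mu> \<mu>' k" "\<forall>x\<in>verts Q. p' x * g x = k x * p x"
    unfolding largest_inj_quot_def by blast
  have hom: "rep_hom Q (point_rep \<alpha> \<psi>) \<mu>' p'" "rep_hom Q (point_rep \<alpha> \<phi>) \<mu> p" using p p' unfolding largest_inj_quot_def inj_quot_def by auto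
  have "p' x = k x * (p x * h x)" if x: "x \<in> verts Q" for x
  proof -
    note gx = base_changeD(1)[OF bc x] and hx = base_changeD(2)[OF bc x]
    have p'x: "p' x \<in> carrier_mat (dimv \<mu>' x) (\<alpha> x)" and px: "p x \<in> carrier_mat (dimv \<mu> x) (\<alpha> x)"
      using rep_homD(1)[OF hom(1) x] rep_homD(1)[OF hom(2) x] by auto
    have "p' x = p' x * (g x * h x)" using base_changeD(3)[OF bc x] right_mult_one_mat[OF p'x] by simp
    also have "\<dots> = (p' x * g x) * h x" by (rule assoc_mult_mat[OF p'x gx hx, symmetric])
    also have "\<dots> = (k x * p x) * h x" using k(2) x by simp
    also have "\<dots> = k x * (p x * h x)" by (rule assoc_mult_mat[OF rep_homD(1)[OF k(1) x] px hx])
    finally show ?thesis .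
  qed
  then show "\<exists>k. rep_hom Q \<mu> \<mu>' k \<and> (\<forall>x\<in>verts Q. p' x = k x * (p x * h x))" using k(1) by blast
qed

text \<open>Transport replaces \<open>i\<close> by \<open>g * i\<close> and \<open>p\<close> by
  \<open>p * h\<close>, so the composition at each vertex is unchanged.\<close>

lemma global_rank_base_change: "global_rank Q (point_rep \<alpha> \<phi>) = global_rank Q (point_rep \<alpha> \<psi>)"
proof -
  note rep = base_change_rep(1,2)[OF bc]
  obtain \<epsilon> i where i: "largest_surj_sub Q (point_rep \<alpha> \<phi>) \<epsilon> i" using ex_largest_surj_sub[OF Q rep(1)] by (elim exE)
  obtain \<mu> p where p: "largest_inj_quot Q (point_rep \<alpha> \<phi>) \<mu> p" using ex_largest_inj_quot[OF Q rep(1)] by (elim exE)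
  have hom: "rep_hom Q \<epsilon> (point_rep \<alpha> \<phi>) i" "rep_hom Q (point_rep \<alpha> \<phi>) \<mu> p"
    using i p unfolding largest_surj_sub_def surj_sub_def largest_inj_quot_def inj_quot_def by auto
  have "global_rank Q (point_rep \<alpha> \<psi>) = global_rank Q (point_rep \<alpha> \<phi>)"
  proof (rule global_rank_eq[OF Q rep(2) largest_surj_sub_base_change[OF i] largest_inj_quot_base_change[OF p]])
    fix x assume x: "x \<in> verts Q"
    note gx = base_changeD(1)[OF bc x] and hx = base_changeD(2)[OF bc x]
    have ix: "i x \<in> carrier_mat (\<alpha> x) (dimv \<epsilon> x)" and px: "p x \<in> carrier_mat (dimv \<mu> x) (\<alpha> x)"
      using rep_homD(1)[OF hom(1) x] rep_homD(1)[OF hom(2) x] by auto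
    have "(p x * h x) * (g x * i x) = p x * (h x * (g x * i x))"
      by (rule assoc_mult_mat[OF px hx mult_carrier_mat[OF gx ix]])
    also have "h x * (g x * i x) = (h x * g x) * i x" by (rule assoc_mult_mat[OF hx gx ix, symmetric])
    also have "\<dots> = i x" using base_changeD(4)[OF bc x] left_mult_one_mat[OF ix] by simp
    finally show "vec_space.rank (dimv \<mu> x) ((p x * h x) * (g x * i x)) = global_rank Q (point_rep \<alpha> \<phi>)"
      using rank_largest[OF Q rep(1) i p x] global_rank_rank_at[OF Q rep(1) x] by simp
  qed
  then show ?thesis ..
qed

end

section \<open>Base changes under pullback and pushforward\<close>

lemma base_change_pullback:
  assumes "quiver_hom Q' Q fv fa" and bc: "base_change Q \<alpha> \<phi> \<psi> g h"
  shows "base_change Q' (\<lambda>x. \<alpha> (fv x)) (\<lambda>a. \<phi> (fa a)) (\<lambda>a. \<psi> (fa a)) (\<lambda>x. g (fv x)) (\<lambda>x. h (fv x))"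
proof -
  have v: "fv x \<in> verts Q" if "x \<in> verts Q'" for x
    using assms(1) that unfolding quiver_hom_def by auto
  have a: "fa a \<in> arcs Q" "tail Q (fa a) = fv (tail Q' a)" "head Q (fa a) = fv (head Q' a)" if "a \<in> arcs Q'" for a
    using assms(1) that unfolding quiver_hom_def by auto
  have "g (fv (head Q' b)) * \<phi> (fa b) = \<psi> (fa b) * g (fv (tail Q' b))"
    "\<phi> (fa b) \<in> carrier_mat (\<alpha> (fv (head Q' b))) (\<alpha> (fv (tail Q' b)))"
    "\<psi> (fa b) \<in> carrier_mat (\<alpha> (fv (head Q' b))) (\<alpha> (fv (tail Q' b)))" if "b \<in> arcs Q'" for b
    using base_changeD(5-7)[OF bc a(1)[OF that]] unfolding a(2,3)[OF that] by auto
  then show ?thesis using base_changeD(1-4)[OF bc v] unfolding base_change_def by simp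
qed

lemma offset_mono:
  assumes "finite (verts Q)" "y \<in> verts Q" "fv y = fv z" "y < z"
  shows "offset Q fv \<alpha> y + \<alpha> y \<le> offset Q fv \<alpha> z"
proof -
  have "offset Q fv \<alpha> y + \<alpha> y = (\<Sum>x\<in>insert y {x. x \<in> verts Q \<and> fv x = fv y \<and> x < y}. \<alpha> x)"
    unfolding offset_def using assms(1) by (subst sum.insert) auto
  also have "\<dots> \<le> offset Q fv \<alpha> z"
    unfolding offset_def using assms by (intro sum_mono2) auto
  finally show ?thesis .
qed

lemma offset_fibre_dim:
  assumes "finite (verts Q)" "y \<in> verts Q"
  shows "offset Q fv \<alpha> y + \<alpha> y \<le> fibre_dim Q fv \<alpha> (fv y)"
proof -
  have "offset Q fv \<alpha> y + \<alpha> y = (\<Sum>x\<in>insert y {x. x \<in> verts Q \<and> fv x = fv y \<and> x < y}. \<alpha> x)"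
    unfolding offset_def using assms(1) by (subst sum.insert) auto
  also have "\<dots> \<le> fibre_dim Q fv \<alpha> (fv y)"
    unfolding fibre_dim_def using assms by (intro sum_mono2) auto
  finally show ?thesis .
qed

text \<open>Adding the elements in increasing order appends a block at the end and leaves the
  earlier blocks in place.\<close>

lemma ex_sum_block:
  fixes A :: "nat set" and \<alpha> :: "nat \<Rightarrow> nat"
  assumes "finite A" "i < (\<Sum>y\<in>A. \<alpha> y)"
  shows "\<exists>y\<in>A. (\<Sum>z | z \<in> A \<and> z < y. \<alpha> z) \<le> i \<and> i < (\<Sum>z | z \<in> A \<and> z < y. \<alpha> z) + \<alpha> y"
  using assms
proof (induction A rule: finite_linorder_max_induct)
  case (insert b A)
  have b: "b \<notin> A" using insert.hyps by auto
  show ?case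
  proof (cases "i < (\<Sum>y\<in>A. \<alpha> y)")
    case True
    then obtain y where y: "y \<in> A" "(\<Sum>z | z \<in> A \<and> z < y. \<alpha> z) \<le> i" "i < (\<Sum>z | z \<in> A \<and> z < y. \<alpha> z) + \<alpha> y"
      using insert.IH by auto
    have "{z. z \<in> insert b A \<and> z < y} = {z. z \<in> A \<and> z < y}" using insert.hyps(2) y(1) by auto
    then show ?thesis using y by (intro bexI[of _ y]) simp_all
  next
    case False
    have "{z. z \<in> insert b A \<and> z < b} = A" using insert.hyps(2) by auto
    then show ?thesis using False insert.prems insert.hyps(1) b by (intro bexI[of _ b]) simp_all
  qed
qed simp

lemma ex_offset:
  assumes "finite (verts Q)" "i < fibre_dim Q fv \<alpha> x"
  shows "\<exists>y\<in>verts Q. fv y = x \<and> offset Q fv \<alpha> y \<le> i \<and> i < offset Q fv \<alpha> y + \<alpha> y"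
proof -
  obtain y where y: "y \<in> {y. y \<in> verts Q \<and> fv y = x}"
    "(\<Sum>z | z \<in> {y. y \<in> verts Q \<and> fv y = x} \<and> z < y. \<alpha> z) \<le> i"
    "i < (\<Sum>z | z \<in> {y. y \<in> verts Q \<and> fv y = x} \<and> z < y. \<alpha> z) + \<alpha> y"
    using ex_sum_block[of "{y. y \<in> verts Q \<and> fv y = x}" i \<alpha>] assms unfolding fibre_dim_def by auto
  have eq: "{z. z \<in> {y. y \<in> verts Q \<and> fv y = x} \<and> z < y} = {z. z \<in> verts Q \<and> fv z = fv y \<and> z < y}"
    using y(1) by auto
  show ?thesis using y(1) y(2,3)[unfolded eq] unfolding offset_def by (intro bexI[of _ y] conjI) auto
qed

lemma offset_disjoint:
  assumes "finite (verts Q)" "y \<in> verts Q" "z \<in> verts Q" "fv y = fv z" "y \<noteq> z"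
    and "offset Q fv \<alpha> y \<le> k" "k < offset Q fv \<alpha> y + \<alpha> y"
  shows "\<not> (offset Q fv \<alpha> z \<le> k \<and> k < offset Q fv \<alpha> z + \<alpha> z)"
proof (cases "y < z")
  case True
  then show ?thesis using offset_mono[OF assms(1,2,4) True, of \<alpha>] assms(7) by simp
next
  case False
  then have "z < y" using assms(5) by simp
  then show ?thesis using offset_mono[OF assms(1,3) assms(4)[symmetric], of \<alpha>] assms(6) by simp
qed

text \<open>Only inner indices in the shared block contribute; \<open>t + n \<le> d\<close> places
  this block inside the range of summation.\<close>

lemma block_entry_mult:
  assumes "M \<in> carrier_mat m n" "N \<in> carrier_mat n q" "t + n \<le> d"
  shows "(\<Sum>k<d. block_entry s t m n M i k * block_entry t u n q N k j) = block_entry s u m q (M * N) i j"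
proof (cases "s \<le> i \<and> i < s + m \<and> u \<le> j \<and> j < u + q")
  case True
  have "(\<Sum>k<d. block_entry s t m n M i k * block_entry t u n q N k j) =
      (\<Sum>k\<in>{t..<t + n}. M $$ (i - s, k - t) * N $$ (k - t, j - u))"
    using True assms(3) by (intro sum.mono_neutral_cong_right) (auto simp: block_entry_def)
  also have "\<dots> = (\<Sum>k<n. M $$ (i - s, k) * N $$ (k, j - u))"
    using sum.shift_bounds_nat_ivl[of "\<lambda>k. M $$ (i - s, k - t) * N $$ (k - t, j - u)" 0 t n]
    by (simp add: atLeast0LessThan add.commute)
  also have "\<dots> = (M * N) $$ (i - s, j - u)"
  proof -
    have "i - s < m" "j - u < q" using True by auto
    then show ?thesis using assms(1,2) by (simp add: scalar_prod_def atLeast0LessThan)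
  qed
  finally show ?thesis using True by (simp add: block_entry_def)
next
  case False
  then have "block_entry s t m n M i k * block_entry t u n q N k j = 0" for k
    unfolding block_entry_def by auto
  moreover have "block_entry s u m q (M * N) i j = 0"
    unfolding block_entry_def by (rule if_not_P) (use False in simp)
  ultimately show ?thesis by simp
qed

lemma block_entry_mult_disjoint:
  assumes "\<And>k. t \<le> k \<Longrightarrow> k < t + n \<Longrightarrow> \<not> (t' \<le> k \<and> k < t' + n')"
  shows "(\<Sum>k<d. block_entry s t m n M i k * block_entry t' u n' q N k j) = 0"
proof (rule sum.neutral, rule ballI)
  fix k
  show "block_entry s t m n M i k * block_entry t' u n' q N k j = 0"
    using assms[of k] unfolding block_entry_def by auto
qed

text \<open>The base change on the pushforward: the direct sum of the \<open>g y\<close> over the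
  fibre, in the order used by the pushforward.\<close>

definition block_diag :: "quiver \<Rightarrow> (nat \<Rightarrow> nat) \<Rightarrow> (nat \<Rightarrow> nat) \<Rightarrow> (nat \<Rightarrow> 'k::field mat) \<Rightarrow> nat \<Rightarrow> 'k mat" where
  "block_diag Q fv \<alpha> g x = mat (fibre_dim Q fv \<alpha> x) (fibre_dim Q fv \<alpha> x)
     (\<lambda>(i, j). \<Sum>y | y \<in> verts Q \<and> fv y = x. block_entry (offset Q fv \<alpha> y) (offset Q fv \<alpha> y) (\<alpha> y) (\<alpha> y) (g y) i j)"

lemma block_diag_mult:
  assumes Q: "quiver Q" and g: "\<And>x. x \<in> verts Q \<Longrightarrow> g x \<in> carrier_mat (\<alpha> x) (\<alpha> x)"
    and h: "\<And>x. x \<in> verts Q \<Longrightarrow> h x \<in> carrier_mat (\<alpha> x) (\<alpha> x)"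
    and gh: "\<And>x. x \<in> verts Q \<Longrightarrow> g x * h x = 1\<^sub>m (\<alpha> x)"
  shows "block_diag Q fv \<alpha> g x * block_diag Q fv \<alpha> h x = 1\<^sub>m (fibre_dim Q fv \<alpha> x)"
proof (rule eq_matI)
  let ?d = "fibre_dim Q fv \<alpha> x" and ?o = "offset Q fv \<alpha>" and ?V = "{y. y \<in> verts Q \<and> fv y = x}"
  note finV = quiverD(2)[OF Q]
  fix i j assume "i < dim_row (1\<^sub>m ?d :: 'a mat)" "j < dim_col (1\<^sub>m ?d :: 'a mat)"
  then have i: "i < ?d" and j: "j < ?d" by auto
  let ?b = "\<lambda>M y. block_entry (?o y) (?o y) (\<alpha> y) (\<alpha> y) M"
  have "(block_diag Q fv \<alpha> g x * block_diag Q fv \<alpha> h x) $$ (i, j) =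
      (\<Sum>k<?d. (\<Sum>y\<in>?V. ?b (g y) y i k) * (\<Sum>z\<in>?V. ?b (h z) z k j))"
    using i j by (simp add: block_diag_def scalar_prod_def atLeast0LessThan)
  also have "\<dots> = (\<Sum>k<?d. \<Sum>y\<in>?V. \<Sum>z\<in>?V. ?b (g y) y i k * ?b (h z) z k j)"
    by (simp only: sum_product)
  also have "\<dots> = (\<Sum>y\<in>?V. \<Sum>z\<in>?V. \<Sum>k<?d. ?b (g y) y i k * ?b (h z) z k j)"
    by (subst sum.swap) (intro sum.cong refl sum.swap)
  also have "\<dots> = (\<Sum>y\<in>?V. \<Sum>z\<in>?V. if z = y then ?b (1\<^sub>m (\<alpha> y)) y i j else 0)"
  proof (intro sum.cong refl)
    fix y z assume y: "y \<in> ?V" and z: "z \<in> ?V"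
    show "(\<Sum>k<?d. ?b (g y) y i k * ?b (h z) z k j) = (if z = y then ?b (1\<^sub>m (\<alpha> y)) y i j else 0)"
    proof (cases "z = y")
      case True
      have yV: "y \<in> verts Q" and le: "?o y + \<alpha> y \<le> ?d" using offset_fibre_dim[OF finV, of y fv \<alpha>] y by auto
      show ?thesis unfolding True gh[OF yV, symmetric] using block_entry_mult[OF g[OF yV] h[OF yV] le] by simp
    next
      case False
      then have "(\<Sum>k<?d. ?b (g y) y i k * ?b (h z) z k j) = 0"
        using y z by (intro block_entry_mult_disjoint offset_disjoint[OF finV]) auto
      then show ?thesis using False by simp
    qed
  qed
  also have "\<dots> = (\<Sum>y\<in>?V. ?b (1\<^sub>m (\<alpha> y)) y i j)"
    using finV by (intro sum.cong refl) (simp add: sum.delta)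
  also have "\<dots> = (if i = j then 1 else 0)"
  proof -
    \<comment> \<open>Every index lies in exactly one block, so the identity blocks assemble to the
      identity matrix.\<close>
    obtain y where y: "y \<in> ?V" "?o y \<le> i" "i < ?o y + \<alpha> y" using ex_offset[OF finV i] by auto
    have "?b (1\<^sub>m (\<alpha> z)) z i j = 0" if "z \<in> ?V - {y}" for z
      using offset_disjoint[OF finV _ _ _ _ y(2,3), of z] that y(1) unfolding block_entry_def by auto
    then have "(\<Sum>y\<in>?V. ?b (1\<^sub>m (\<alpha> y)) y i j) = (\<Sum>z\<in>{y}. ?b (1\<^sub>m (\<alpha> z)) z i j)"
      using y(1) finV by (intro sum.mono_neutral_right) auto
    also have "\<dots> = (if i = j then 1 else 0)"
      using y(2,3) unfolding block_entry_def by auto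
    finally show ?thesis .
  qed
  finally show "(block_diag Q fv \<alpha> g x * block_diag Q fv \<alpha> h x) $$ (i, j) = 1\<^sub>m ?d $$ (i, j)"
    using i j by simp
qed (simp_all add: block_diag_def)

text \<open>The block of an arrow \<open>b\<close> meets only the diagonal block at its head or
  tail, so both products are again pushforwards. The intertwining relation can then be checked arrow
  by arrow.\<close>

lemma block_diag_push_mats:
  assumes Q: "quiver Q" and hom: "quiver_hom Q Q' fv fa" and a: "a \<in> arcs Q'"
    and g: "\<And>x. x \<in> verts Q \<Longrightarrow> g x \<in> carrier_mat (\<alpha> x) (\<alpha> x)"
    and \<phi>: "\<And>b. b \<in> arcs Q \<Longrightarrow> \<phi> b \<in> carrier_mat (\<alpha> (head Q b)) (\<alpha> (tail Q b))"
  shows "block_diag Q fv \<alpha> g (head Q' a) * push_mats Q Q' fv fa \<alpha> \<phi> a =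
      push_mats Q Q' fv fa \<alpha> (\<lambda>b. g (head Q b) * \<phi> b) a" (is ?left)
    and "push_mats Q Q' fv fa \<alpha> \<phi> a * block_diag Q fv \<alpha> g (tail Q' a) =
      push_mats Q Q' fv fa \<alpha> (\<lambda>b. \<phi> b * g (tail Q b)) a" (is ?right)
proof -
  let ?o = "offset Q fv \<alpha>" and ?h = "head Q' a" and ?t = "tail Q' a"
  let ?V = "\<lambda>x. {y. y \<in> verts Q \<and> fv y = x}" and ?B = "{b. b \<in> arcs Q \<and> fa b = a}"
  let ?d = "fibre_dim Q fv \<alpha>"
  let ?v = "\<lambda>y. block_entry (?o y) (?o y) (\<alpha> y) (\<alpha> y) (g y)"
  let ?e = "\<lambda>M b. block_entry (?o (head Q b)) (?o (tail Q b)) (\<alpha> (head Q b)) (\<alpha> (tail Q b)) M"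
  note finV = quiverD(2)[OF Q] and finA = quiverD(1)[OF Q]
  have B: "b \<in> arcs Q" "head Q b \<in> verts Q" "tail Q b \<in> verts Q" "fv (head Q b) = ?h" "fv (tail Q b) = ?t"
    if "b \<in> ?B" for b
    using that hom quiverD(4,5)[OF Q] unfolding quiver_hom_def by auto
  show ?left
  proof (rule eq_matI)
    fix i j assume "i < dim_row (push_mats Q Q' fv fa \<alpha> (\<lambda>b. g (head Q b) * \<phi> b) a)"
      "j < dim_col (push_mats Q Q' fv fa \<alpha> (\<lambda>b. g (head Q b) * \<phi> b) a)"
    then have i: "i < ?d ?h" and j: "j < ?d ?t" by (auto simp: push_mats_def)
    have "(block_diag Q fv \<alpha> g ?h * push_mats Q Q' fv fa \<alpha> \<phi> a) $$ (i, j) =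
        (\<Sum>k<?d ?h. (\<Sum>y\<in>?V ?h. ?v y i k) * (\<Sum>b\<in>?B. ?e (\<phi> b) b k j))"
      using i j by (simp add: block_diag_def push_mats_def scalar_prod_def atLeast0LessThan)
    also have "\<dots> = (\<Sum>k<?d ?h. \<Sum>b\<in>?B. \<Sum>y\<in>?V ?h. ?v y i k * ?e (\<phi> b) b k j)"
      by (simp only: sum_product) (intro sum.cong refl sum.swap)
    also have "\<dots> = (\<Sum>b\<in>?B. \<Sum>y\<in>?V ?h. \<Sum>k<?d ?h. ?v y i k * ?e (\<phi> b) b k j)"
      by (subst sum.swap) (intro sum.cong refl sum.swap)
    also have "\<dots> = (\<Sum>b\<in>?B. \<Sum>y\<in>?V ?h. if y = head Q b then ?e (g (head Q b) * \<phi> b) b i j else 0)"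
    proof (intro sum.cong refl)
      fix b y assume b: "b \<in> ?B" and y: "y \<in> ?V ?h"
      show "(\<Sum>k<?d ?h. ?v y i k * ?e (\<phi> b) b k j) = (if y = head Q b then ?e (g (head Q b) * \<phi> b) b i j else 0)"
      proof (cases "y = head Q b")
        case True
        have le: "?o (head Q b) + \<alpha> (head Q b) \<le> ?d ?h"
          using offset_fibre_dim[OF finV, of y fv \<alpha>] y unfolding True by simp
        show ?thesis unfolding True
          using block_entry_mult[OF g[OF B(2)[OF b]] \<phi>[OF B(1)[OF b]] le] by simp
      next
        case False
        then have "(\<Sum>k<?d ?h. ?v y i k * ?e (\<phi> b) b k j) = 0"
          using y B[OF b] by (intro block_entry_mult_disjoint offset_disjoint[OF finV]) auto
        then show ?thesis using False by simp
      qed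
    qed
    also have "\<dots> = (\<Sum>b\<in>?B. ?e (g (head Q b) * \<phi> b) b i j)"
    proof (rule sum.cong[OF refl])
      fix b assume b: "b \<in> ?B"
      have "head Q b \<in> ?V ?h" "finite (?V ?h)" using B[OF b] finV by auto
      then show "(\<Sum>y\<in>?V ?h. if y = head Q b then ?e (g (head Q b) * \<phi> b) b i j else 0) = ?e (g (head Q b) * \<phi> b) b i j"
        by (simp only: sum.delta if_True)
    qed
    also have "\<dots> = push_mats Q Q' fv fa \<alpha> (\<lambda>b. g (head Q b) * \<phi> b) a $$ (i, j)"
      using i j by (simp add: push_mats_def)
    finally show "(block_diag Q fv \<alpha> g ?h * push_mats Q Q' fv fa \<alpha> \<phi> a) $$ (i, j) =
      push_mats Q Q' fv fa \<alpha> (\<lambda>b. g (head Q b) * \<phi> b) a $$ (i, j)" .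
  qed (simp_all add: block_diag_def push_mats_def)
  show ?right
  proof (rule eq_matI)
    fix i j assume "i < dim_row (push_mats Q Q' fv fa \<alpha> (\<lambda>b. \<phi> b * g (tail Q b)) a)"
      "j < dim_col (push_mats Q Q' fv fa \<alpha> (\<lambda>b. \<phi> b * g (tail Q b)) a)"
    then have i: "i < ?d ?h" and j: "j < ?d ?t" by (auto simp: push_mats_def)
    have "(push_mats Q Q' fv fa \<alpha> \<phi> a * block_diag Q fv \<alpha> g ?t) $$ (i, j) =
        (\<Sum>k<?d ?t. (\<Sum>b\<in>?B. ?e (\<phi> b) b i k) * (\<Sum>y\<in>?V ?t. ?v y k j))"
      using i j by (simp add: block_diag_def push_mats_def scalar_prod_def atLeast0LessThan)
    also have "\<dots> = (\<Sum>k<?d ?t. \<Sum>b\<in>?B. \<Sum>y\<in>?V ?t. ?e (\<phi> b) b i k * ?v y k j)"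
      by (simp only: sum_product)
    also have "\<dots> = (\<Sum>b\<in>?B. \<Sum>y\<in>?V ?t. \<Sum>k<?d ?t. ?e (\<phi> b) b i k * ?v y k j)"
      by (subst sum.swap) (intro sum.cong refl sum.swap)
    also have "\<dots> = (\<Sum>b\<in>?B. \<Sum>y\<in>?V ?t. if y = tail Q b then ?e (\<phi> b * g (tail Q b)) b i j else 0)"
    proof (intro sum.cong refl)
      fix b y assume b: "b \<in> ?B" and y: "y \<in> ?V ?t"
      show "(\<Sum>k<?d ?t. ?e (\<phi> b) b i k * ?v y k j) = (if y = tail Q b then ?e (\<phi> b * g (tail Q b)) b i j else 0)"
      proof (cases "y = tail Q b")
        case True
        have le: "?o (tail Q b) + \<alpha> (tail Q b) \<le> ?d ?t"
          using offset_fibre_dim[OF finV, of y fv \<alpha>] y unfolding True by simp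
        show ?thesis unfolding True
          using block_entry_mult[OF \<phi>[OF B(1)[OF b]] g[OF B(3)[OF b]] le] by simp
      next
        case False
        then have "(\<Sum>k<?d ?t. ?e (\<phi> b) b i k * ?v y k j) = 0"
          using y B[OF b] by (intro block_entry_mult_disjoint offset_disjoint[OF finV]) auto
        then show ?thesis using False by simp
      qed
    qed
    also have "\<dots> = (\<Sum>b\<in>?B. ?e (\<phi> b * g (tail Q b)) b i j)"
    proof (rule sum.cong[OF refl])
      fix b assume b: "b \<in> ?B"
      have "tail Q b \<in> ?V ?t" "finite (?V ?t)" using B[OF b] finV by auto
      then show "(\<Sum>y\<in>?V ?t. if y = tail Q b then ?e (\<phi> b * g (tail Q b)) b i j else 0) = ?e (\<phi> b * g (tail Q b)) b i j"
        by (simp only: sum.delta if_True)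
    qed
    also have "\<dots> = push_mats Q Q' fv fa \<alpha> (\<lambda>b. \<phi> b * g (tail Q b)) a $$ (i, j)"
      using i j by (simp add: push_mats_def)
    finally show "(push_mats Q Q' fv fa \<alpha> \<phi> a * block_diag Q fv \<alpha> g ?t) $$ (i, j) =
      push_mats Q Q' fv fa \<alpha> (\<lambda>b. \<phi> b * g (tail Q b)) a $$ (i, j)" .
  qed (simp_all add: block_diag_def push_mats_def)
qed

lemma push_mats_cong:
  assumes "\<And>b. b \<in> arcs Q \<Longrightarrow> \<phi> b = \<psi> b"
  shows "push_mats Q Q' fv fa \<alpha> \<phi> a = push_mats Q Q' fv fa \<alpha> \<psi> a"
  unfolding push_mats_def using assms by (intro cong_mat refl) (auto intro!: sum.cong)

lemma base_change_pushforward: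
  assumes Q: "quiver Q" and hom: "quiver_hom Q Q' fv fa" and bc: "base_change Q \<alpha> \<phi> \<psi> g h"
  shows "base_change Q' (fibre_dim Q fv \<alpha>) (push_mats Q Q' fv fa \<alpha> \<phi>) (push_mats Q Q' fv fa \<alpha> \<psi>)
    (block_diag Q fv \<alpha> g) (block_diag Q fv \<alpha> h)"
  unfolding base_change_def
proof (intro conjI ballI)
  note b = base_changeD[OF bc]
  show "block_diag Q fv \<alpha> g x * block_diag Q fv \<alpha> h x = 1\<^sub>m (fibre_dim Q fv \<alpha> x)" for x
    by (rule block_diag_mult[OF Q b(1) b(2) b(3)])
  show "block_diag Q fv \<alpha> h x * block_diag Q fv \<alpha> g x = 1\<^sub>m (fibre_dim Q fv \<alpha> x)" for x
    by (rule block_diag_mult[OF Q b(2) b(1) b(4)])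
  fix a assume a: "a \<in> arcs Q'"
  show "block_diag Q fv \<alpha> g (head Q' a) * push_mats Q Q' fv fa \<alpha> \<phi> a =
      push_mats Q Q' fv fa \<alpha> \<psi> a * block_diag Q fv \<alpha> g (tail Q' a)"
    using block_diag_push_mats(1)[where g = g and \<phi> = \<phi> and \<alpha> = \<alpha>, OF Q hom a b(1,5)]
      block_diag_push_mats(2)[where g = g and \<phi> = \<psi> and \<alpha> = \<alpha>, OF Q hom a b(1,6)]
      push_mats_cong[where \<phi> = "\<lambda>b. g (head Q b) * \<phi> b", OF b(7)] by simp
qed (simp_all add: block_diag_def push_mats_def)

lemma rank_function_base_change:
  assumes "rank_function Q r" "base_change Q \<alpha> \<phi> \<psi> g h"
  shows "r (point_rep \<alpha> \<phi>) = r (point_rep \<alpha> \<psi>)"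
  using assms
proof (induction arbitrary: \<alpha> \<phi> \<psi> g h rule: rank_function.induct)
  case (global Q)
  then show ?case by (rule global_rank_base_change)
next
  case (pull Q Q' fv fa r)
  show ?case unfolding pullback_point_rep by (rule pull.IH[OF base_change_pullback[OF pull(2) pull.prems]])
next
  case (push Q Q' fv fa r)
  show ?case unfolding pushforward_point_rep by (rule push.IH[OF base_change_pushforward[OF push(1,2) push.prems]])
qed

lemma GL_base_change:
  fixes \<phi> :: "nat \<Rightarrow> 'k::field mat"
  assumes Q: "quiver Q" and \<phi>: "\<phi> \<in> rep_space Q \<alpha>" and g: "g \<in> GL Q \<alpha>"
  shows "base_change Q \<alpha> \<phi> (GL_act Q \<alpha> g \<phi>) g (\<lambda>x. inv\<^bsub>ring_mat TYPE('k) (\<alpha> x) ()\<^esub> (g x))"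
proof -
  let ?R = "\<lambda>x. ring_mat TYPE('k) (\<alpha> x) ()"
  let ?h = "\<lambda>x. inv\<^bsub>?R x\<^esub> (g x)"
  have inv: "g x \<in> carrier_mat (\<alpha> x) (\<alpha> x)" "?h x \<in> carrier_mat (\<alpha> x) (\<alpha> x)"
    "g x * ?h x = 1\<^sub>m (\<alpha> x)" "?h x * g x = 1\<^sub>m (\<alpha> x)" if x: "x \<in> verts Q" for x
  proof -
    interpret ring "?R x" by (rule ring_mat)
    have u: "g x \<in> Units (?R x)" using g x unfolding GL_def by auto
    show "g x \<in> carrier_mat (\<alpha> x) (\<alpha> x)" "?h x \<in> carrier_mat (\<alpha> x) (\<alpha> x)"
      "g x * ?h x = 1\<^sub>m (\<alpha> x)" "?h x * g x = 1\<^sub>m (\<alpha> x)"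
      using Units_closed[OF u] Units_inv_closed[OF u] Units_r_inv[OF u] Units_l_inv[OF u]
      by (simp_all add: ring_mat_simps)
  qed
  have "\<phi> a \<in> carrier_mat (\<alpha> (head Q a)) (\<alpha> (tail Q a))" "GL_act Q \<alpha> g \<phi> a \<in> carrier_mat (\<alpha> (head Q a)) (\<alpha> (tail Q a))"
    "g (head Q a) * \<phi> a = GL_act Q \<alpha> g \<phi> a * g (tail Q a)" if a: "a \<in> arcs Q" for a
  proof -
    note h = quiverD(4)[OF Q a] and t = quiverD(5)[OF Q a]
    show A: "\<phi> a \<in> carrier_mat (\<alpha> (head Q a)) (\<alpha> (tail Q a))" using \<phi> a unfolding rep_space_def by auto
    have act: "GL_act Q \<alpha> g \<phi> a = g (head Q a) * \<phi> a * ?h (tail Q a)" unfolding GL_act_def using a by simp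
    note gA = mult_carrier_mat[OF inv(1)[OF h] A]
    show "GL_act Q \<alpha> g \<phi> a \<in> carrier_mat (\<alpha> (head Q a)) (\<alpha> (tail Q a))"
      unfolding act by (rule mult_carrier_mat[OF gA inv(2)[OF t]])
    show "g (head Q a) * \<phi> a = GL_act Q \<alpha> g \<phi> a * g (tail Q a)"
      unfolding act using assoc_mult_mat[OF gA inv(2)[OF t] inv(1)[OF t]] inv(4)[OF t] right_mult_one_mat[OF gA] by simp
  qed
  then show ?thesis unfolding base_change_def using inv by simp
qed

section \<open>Chevalley's theorem\<close>

text \<open>Univariate polynomials whose coefficients are polynomial in the parameter. The strict
  bound \<open>d\<close> on the degree is uniform in \<open>x\<close>; the actual degree may drop at
  special parameters, and \<open>d = 0\<close> means the zero family.\<close>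

definition polyfam :: "('p \<Rightarrow> 'k::field) set \<Rightarrow> nat \<Rightarrow> ('p \<Rightarrow> 'k poly) \<Rightarrow> bool" where
  "polyfam C d P \<longleftrightarrow> (\<forall>i. (\<lambda>x. coeff (P x) i) \<in> polyfun C) \<and> (\<forall>x. \<forall>i\<ge>d. coeff (P x) i = 0)"

lemma polyfamD:
  assumes "polyfam C d P"
  shows "(\<lambda>x. coeff (P x) i) \<in> polyfun C" "d \<le> i \<Longrightarrow> coeff (P x) i = 0"
  using assms unfolding polyfam_def by auto

lemma polyfam_const: "c \<in> polyfun C \<Longrightarrow> polyfam C (Suc 0) (\<lambda>x. [:c x:])"
  unfolding polyfam_def
proof (intro conjI allI impI)
  fix i assume c: "c \<in> polyfun C"
  show "(\<lambda>x. coeff [:c x:] i) \<in> polyfun C"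
    by (cases i) (simp_all add: c polyfun.const)
next
  fix x i assume "Suc 0 \<le> i"
  then show "coeff [:c x:] i = 0" by (cases i) auto
qed

lemma polyfam_add:
  assumes "polyfam C d P" "polyfam C e R"
  shows "polyfam C (max d e) (\<lambda>x. P x + R x)"
  using assms unfolding polyfam_def by (simp add: polyfun.add)

lemma polyfam_diff:
  assumes "polyfam C d P" "polyfam C e R"
  shows "polyfam C (max d e) (\<lambda>x. P x - R x)"
  using assms unfolding polyfam_def by (simp add: polyfun_diff)

lemma polyfam_mult:
  assumes "polyfam C d P" "polyfam C e R"
  shows "polyfam C (d + e) (\<lambda>x. P x * R x)"
  unfolding polyfam_def
proof (intro conjI allI impI)
  fix i
  show "(\<lambda>x. coeff (P x * R x) i) \<in> polyfun C"
    unfolding coeff_mult using polyfamD(1)[OF assms(1)] polyfamD(1)[OF assms(2)]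
    by (intro polyfun_sum polyfun.mult)
next
  fix x i assume i: "d + e \<le> i"
  have "coeff (P x) j * coeff (R x) (i - j) = 0" for j
    using i polyfamD(2)[OF assms(1), of j x] polyfamD(2)[OF assms(2), of "i - j" x] by (cases "d \<le> j") auto
  then show "coeff (P x * R x) i = 0" unfolding coeff_mult by simp
qed

lemma polyfam_monom: "c \<in> polyfun C \<Longrightarrow> polyfam C (Suc d) (\<lambda>x. monom (c x) d)"
  unfolding polyfam_def
proof (intro conjI allI impI)
  fix i assume c: "c \<in> polyfun C"
  show "(\<lambda>x. coeff (monom (c x) d) i) \<in> polyfun C"
    by (cases "d = i") (simp_all add: c polyfun.const)
qed simp

lemma polyfam_power:
  assumes "polyfam C d P"
  shows "\<exists>e. polyfam C e (\<lambda>x. P x ^ n)"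
proof (induction n)
  case 0
  show ?case using polyfam_const[OF polyfun.const[of 1 C]] by (auto simp: one_pCons)
next
  case (Suc n)
  then show ?case using polyfam_mult[OF assms] by auto
qed

lemma polyfam_truncate:
  assumes "polyfam C (Suc d) P"
  shows "polyfam C d (\<lambda>x. P x - monom (coeff (P x) d) d)"
  unfolding polyfam_def
proof (intro conjI allI impI)
  show "(\<lambda>x. coeff (P x - monom (coeff (P x) d) d) i) \<in> polyfun C" for i
    using polyfamD(1)[OF polyfam_diff[OF assms polyfam_monom[OF polyfamD(1)[OF assms]]]] .
  show "coeff (P x - monom (coeff (P x) d) d) i = 0" if "d \<le> i" for x i
    using that polyfamD(2)[OF assms, of i x] by (cases "i = d") auto
qed

text \<open>One step of pseudo-division with formal degrees \<open>d\<close> and \<open>e\<close>: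
  the coefficient at \<open>e\<close> cancels, and multiplying by \<open>coeff p d\<close> instead
  of dividing by it keeps the coefficients polynomial in the parameter.\<close>

definition reduce :: "nat \<Rightarrow> nat \<Rightarrow> 'k::field poly \<Rightarrow> 'k poly \<Rightarrow> 'k poly" where
  "reduce d e p q = Polynomial.smult (coeff p d) q - monom (coeff q e) (e - d) * p"

lemma polyfam_reduce:
  assumes "polyfam C (Suc d) P" "polyfam C (Suc e) R" "d \<le> e"
  shows "polyfam C e (\<lambda>x. reduce d e (P x) (R x))"
  unfolding polyfam_def
proof (intro conjI allI impI)
  have 1: "polyfam C (Suc 0 + Suc e) (\<lambda>x. [:coeff (P x) d:] * R x)"
    by (rule polyfam_mult[OF polyfam_const[OF polyfamD(1)[OF assms(1)]] assms(2)])
  have 2: "polyfam C (Suc (e - d) + Suc d) (\<lambda>x. monom (coeff (R x) e) (e - d) * P x)"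
    by (rule polyfam_mult[OF polyfam_monom[OF polyfamD(1)[OF assms(2)]] assms(1)])
  show "(\<lambda>x. coeff (reduce d e (P x) (R x)) i) \<in> polyfun C" for i
    using polyfamD(1)[OF polyfam_diff[OF 1 2], of i] unfolding reduce_def by simp
  show "coeff (reduce d e (P x) (R x)) i = 0" if i: "e \<le> i" for x i
  proof -
    have "coeff (reduce d e (P x) (R x)) i = coeff (P x) d * coeff (R x) i - coeff (R x) e * coeff (P x) (i - (e - d))"
      using i assms(3) unfolding reduce_def by (simp add: coeff_monom_mult)
    also have "\<dots> = 0"
    proof (cases "i = e")
      case True
      then show ?thesis using assms(3) by simp
    next
      case False
      then show ?thesis using i assms(3) polyfamD(2)[OF assms(2), of i x] polyfamD(2)[OF assms(1), of "i - (e - d)" x] by simp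
    qed
    finally show ?thesis .
  qed
qed

lemma poly_reduce:
  assumes "coeff p d \<noteq> 0" "poly p t = 0"
  shows "poly (reduce d e p q) t = 0 \<longleftrightarrow> poly q t = 0"
  using assms unfolding reduce_def by simp

lemma dvd_reduce:
  assumes "coeff p d \<noteq> 0"
  shows "p dvd reduce d e p q \<longleftrightarrow> p dvd q"
proof -
  have "p dvd reduce d e p q \<longleftrightarrow> p dvd Polynomial.smult (coeff p d) q"
    unfolding reduce_def by (rule dvd_diff_left_iff) simp
  then show ?thesis using assms by (simp add: dvd_smult_iff)
qed

text \<open>Where \<open>coeff (P x) d\<close> is nonzero, pseudo-division does not affect
  divisibility by \<open>P x\<close>, so the bound on \<open>R\<close> can be lowered until only the
  zero polynomial is divisible.\<close>

lemma constr_dvd: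
  assumes P: "polyfam C (Suc d) P" and R: "polyfam C e R"
  shows "constr X C {x\<in>X. coeff (P x) d \<noteq> 0 \<and> P x dvd R x}"
  using R
proof (induction e arbitrary: R)
  case 0
  have "R x = 0" for x using polyfamD(2)[OF 0, of _ x] by (intro poly_eqI) simp
  then show ?case using constr.nonzero[OF polyfamD(1)[OF P, of d], of X] by simp
next
  case (Suc e)
  show ?case
  proof (cases "d \<le> e")
    case True
    have "{x\<in>X. coeff (P x) d \<noteq> 0 \<and> P x dvd R x} = {x\<in>X. coeff (P x) d \<noteq> 0 \<and> P x dvd reduce d e (P x) (R x)}"
      using dvd_reduce by auto
    then show ?thesis using Suc.IH[OF polyfam_reduce[OF P Suc.prems True]] by simp
  next
    case False
    \<comment> \<open>The degree of \<open>R x\<close> is now below that of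
      \<open>P x\<close>.\<close>
    have "P x dvd R x \<longleftrightarrow> (\<forall>i\<in>{..e}. coeff (R x) i = 0)" if c: "coeff (P x) d \<noteq> 0" for x
    proof
      assume dvd: "P x dvd R x"
      have "degree (R x) \<le> e" using polyfamD(2)[OF Suc.prems, of _ x] by (intro degree_le) auto
      moreover have "d \<le> degree (P x)" using c by (rule le_degree)
      ultimately have "R x = 0" using False dvd_imp_degree_le[OF dvd] by auto
      then show "\<forall>i\<in>{..e}. coeff (R x) i = 0" by simp
    next
      assume z: "\<forall>i\<in>{..e}. coeff (R x) i = 0"
      have "coeff (R x) i = 0" for i
        using z polyfamD(2)[OF Suc.prems, of i x] by (cases "i \<le> e") auto
      then have "R x = 0" by (intro poly_eqI) simp
      then show "P x dvd R x" by simp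
    qed
    then have "{x\<in>X. coeff (P x) d \<noteq> 0 \<and> P x dvd R x} = {x\<in>X. coeff (P x) d \<noteq> 0 \<and> (\<forall>i\<in>{..e}. coeff (R x) i = 0)}"
      by auto
    moreover have "constr X C {x\<in>X. coeff (P x) d \<noteq> 0 \<and> (\<forall>i\<in>{..e}. coeff (R x) i = 0)}"
      by (intro constr_conj constr.nonzero constr_Ball constr.zero polyfamD(1)[OF P] polyfamD(1)[OF Suc.prems]) simp
    ultimately show ?thesis by simp
  qed
qed

section \<open>Common roots of univariate polynomials over an algebraically closed field\<close>

definition root_closed :: "'k::field itself \<Rightarrow> bool" where
  "root_closed _ \<longleftrightarrow> (\<forall>f :: 'k poly. degree f > 0 \<longrightarrow> (\<exists>c. poly f c = 0))"

lemma root_closed_nonzero_value: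
  assumes "root_closed TYPE('k::field)" "(q :: 'k poly) \<noteq> 0"
  shows "\<exists>t. poly q t \<noteq> 0"
proof (rule ccontr)
  assume "\<not> ?thesis"
  then have z: "poly q t = 0" for t by simp
  \<comment> \<open>This is \<open>1 + t * q\<close>, which would have the constant value
    \<open>1\<close> although its degree is positive.\<close>
  let ?f = "pCons 1 q"
  have "degree ?f > 0" using assms(2) by (simp add: degree_pCons_eq)
  then obtain c where "poly ?f c = 0" using assms(1) unfolding root_closed_def by blast
  then show False using z by simp
qed

text \<open>The Nullstellensatz in one variable with an explicit exponent: the roots of
  \<open>p\<close> are split off one at a time, and each linear factor divides one factor
  \<open>q\<close>.\<close>

lemma root_closed_dvd_power:
  assumes "root_closed TYPE('k::field)" "(p :: 'k poly) \<noteq> 0" "degree p \<le> d" "\<And>t. poly p t = 0 \<Longrightarrow> poly q t = 0"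
  shows "p dvd q ^ d"
  using assms(2-4)
proof (induction d arbitrary: p)
  case 0
  then show ?case by (simp add: is_unit_iff_degree)
next
  case (Suc d)
  show ?case
  proof (cases "degree p = 0")
    case True
    then have "is_unit p" using Suc.prems(1) is_unit_iff_degree by blast
    then show ?thesis by (rule unit_imp_dvd)
  next
    case False
    then obtain c where c: "poly p c = 0" using assms(1) unfolding root_closed_def by auto
    then obtain r where r: "p = [:- c, 1:] * r" unfolding poly_eq_0_iff_dvd by (elim dvdE)
    have r0: "r \<noteq> 0" using r Suc.prems(1) by auto
    have "degree p = Suc (degree r)" unfolding r using r0 by (subst degree_mult_eq) auto
    then have "r dvd q ^ d" using Suc.prems r0 by (intro Suc.IH) (auto simp: r)
    moreover have "[:- c, 1:] dvd q" using Suc.prems(3)[OF c] by (simp add: poly_eq_0_iff_dvd)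
    ultimately show ?thesis unfolding r power_Suc by (intro mult_dvd_mono)
  qed
qed

text \<open>Elimination of \<open>t\<close> by a Euclidean algorithm uniform in \<open>x\<close>.
  Given two equations, the formal leading coefficient of the one of lower degree either vanishes,
  and that equation is truncated, or it does not, and the other one is reduced. A single equation is
  settled by divisibility of a power of \<open>R\<close>, and no equation by the coefficients of
  \<open>R\<close>.\<close>

lemma constr_ex_root_list:
  fixes C :: "('p \<Rightarrow> 'k::field) set"
  assumes closed: "root_closed TYPE('k)" and R: "polyfam C e R"
    and "\<forall>(P, d)\<in>set Ps. polyfam C d P" and n: "sum_list (map snd Ps) + length Ps = n"
  shows "constr X C {x\<in>X. \<exists>t. (\<forall>(P, d)\<in>set Ps. poly (P x) t = 0) \<and> poly (R x) t \<noteq> 0}"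
  using assms(3,4)
proof (induction n arbitrary: Ps rule: less_induct)
  case (less n)
  let ?S = "\<lambda>Ps. {x\<in>X. \<exists>t. (\<forall>(P, d)\<in>set Ps. poly (P x) t = 0) \<and> poly (R x) t \<noteq> 0}"
  show ?case
  proof (cases "\<exists>P. (P, 0) \<in> set Ps")
    case True
    \<comment> \<open>A bound of \<open>0\<close> means the zero polynomial. Dropping it lowers only
      the number of equations, which is why the measure counts them.\<close>
    then obtain P Ps1 Ps2 where Ps: "Ps = Ps1 @ (P, 0) # Ps2" by (meson split_list)
    have "P x = 0" for x using less.prems(1) polyfamD(2)[of C 0 P _ x] unfolding Ps by (intro poly_eqI) simp
    then have "?S Ps = ?S (Ps1 @ Ps2)" unfolding Ps by auto
    moreover have "constr X C (?S (Ps1 @ Ps2))"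
    proof (rule less.IH[OF _ _ refl])
      show "sum_list (map snd (Ps1 @ Ps2)) + length (Ps1 @ Ps2) < n" using less.prems(2) unfolding Ps by simp
      show "\<forall>(P, d)\<in>set (Ps1 @ Ps2). polyfam C d P" using less.prems(1) unfolding Ps by auto
    qed
    ultimately show ?thesis by simp
  next
    case pos: False
    show ?thesis
    proof (cases Ps)
      case Nil
      \<comment> \<open>A root-closed field is infinite, so a polynomial with a nonzero coefficient
        takes a nonzero value.\<close>
      have "(\<exists>t. poly (R x) t \<noteq> 0) \<longleftrightarrow> (\<exists>i\<in>{..<e}. coeff (R x) i \<noteq> 0)" for x
      proof
        assume "\<exists>t. poly (R x) t \<noteq> 0"
        then have "R x \<noteq> 0" by auto
        have "degree (R x) < e"
          using polyfamD(2)[OF R, of "degree (R x)" x] \<open>R x \<noteq> 0\<close> by (cases "e \<le> degree (R x)") auto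
        then show "\<exists>i\<in>{..<e}. coeff (R x) i \<noteq> 0"
          using \<open>R x \<noteq> 0\<close> by (intro bexI[of _ "degree (R x)"]) simp_all
      next
        assume "\<exists>i\<in>{..<e}. coeff (R x) i \<noteq> 0"
        then have "R x \<noteq> 0" by auto
        then show "\<exists>t. poly (R x) t \<noteq> 0" by (rule root_closed_nonzero_value[OF closed])
      qed
      then have "?S Ps = {x\<in>X. \<exists>i\<in>{..<e}. coeff (R x) i \<noteq> 0}" unfolding Nil by simp
      moreover have "constr X C {x\<in>X. \<exists>i\<in>{..<e}. coeff (R x) i \<noteq> 0}"
        by (intro constr_Bex constr.nonzero polyfamD(1)[OF R]) simp
      ultimately show ?thesis by simp
    next
      case (Cons P1' Qs)
      show ?thesis
      proof (cases Qs)
        case Nil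
        obtain P d where Pd: "P1' = (P, Suc d)" using pos Cons by (cases P1'; cases "snd P1'") auto
        have P: "polyfam C (Suc d) P" using less.prems(1) unfolding Cons Pd by simp
        let ?T = "\<lambda>x. P x - monom (coeff (P x) d) d"
        \<comment> \<open>If \<open>coeff (P x) d\<close> is nonzero, then \<open>P x\<close> has
          degree \<open>d\<close>, and all its roots are roots of \<open>R x\<close> exactly if it
          divides \<open>R x ^ d\<close>.\<close>
        obtain m where m: "polyfam C m (\<lambda>x. R x ^ d)" using polyfam_power[OF R] by auto
        have "constr X C (?S [(?T, d)])"
          by (rule less.IH[OF _ _ refl]) (use less.prems(2) polyfam_truncate[OF P] in \<open>auto simp: Cons Nil Pd\<close>)
        then have "constr X C ({x\<in>X. coeff (P x) d = 0} \<inter> ?S [(?T, d)] \<union>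
            {x\<in>X. coeff (P x) d \<noteq> 0} \<inter> (X - {x\<in>X. coeff (P x) d \<noteq> 0 \<and> P x dvd R x ^ d}))"
          by (intro constr.un constr.int constr_compl constr_dvd[OF P m] constr.zero constr.nonzero polyfamD(1)[OF P])
        moreover have eq: "(\<exists>t. poly (P x) t = 0 \<and> poly (R x) t \<noteq> 0) \<longleftrightarrow>
            (if coeff (P x) d = 0 then \<exists>t. poly (?T x) t = 0 \<and> poly (R x) t \<noteq> 0 else \<not> P x dvd R x ^ d)" for x
        proof (cases "coeff (P x) d = 0")
          case False
          then have P0: "P x \<noteq> 0" by auto
          have deg: "degree (P x) \<le> d" using polyfamD(2)[OF P, of _ x] by (intro degree_le) auto
          have "P x dvd R x ^ d \<longleftrightarrow> (\<forall>t. poly (P x) t = 0 \<longrightarrow> poly (R x) t = 0)"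
          proof
            assume dvd: "P x dvd R x ^ d"
            show "\<forall>t. poly (P x) t = 0 \<longrightarrow> poly (R x) t = 0"
            proof (intro allI impI)
              fix t assume t: "poly (P x) t = 0"
              obtain s where "R x ^ d = P x * s" using dvd by (elim dvdE)
              then have "poly (R x ^ d) t = 0" using t by simp
              then show "poly (R x) t = 0" by simp
            qed
          next
            assume "\<forall>t. poly (P x) t = 0 \<longrightarrow> poly (R x) t = 0"
            then show "P x dvd R x ^ d" by (intro root_closed_dvd_power[OF closed P0 deg]) simp
          qed
          then show ?thesis using False by auto
        qed simp
        have "?S Ps = {x\<in>X. coeff (P x) d = 0} \<inter> ?S [(?T, d)] \<union>
            {x\<in>X. coeff (P x) d \<noteq> 0} \<inter> (X - {x\<in>X. coeff (P x) d \<noteq> 0 \<and> P x dvd R x ^ d})"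
        proof (rule Set.set_eqI)
          fix x
          have 1: "x \<in> ?S Ps \<longleftrightarrow> x \<in> X \<and> (\<exists>t. poly (P x) t = 0 \<and> poly (R x) t \<noteq> 0)"
            unfolding Cons Nil Pd by simp
          have 2: "x \<in> ?S [(?T, d)] \<longleftrightarrow> x \<in> X \<and> (\<exists>t. poly (?T x) t = 0 \<and> poly (R x) t \<noteq> 0)"
            by simp
          show "x \<in> ?S Ps \<longleftrightarrow> x \<in> {x\<in>X. coeff (P x) d = 0} \<inter> ?S [(?T, d)] \<union>
            {x\<in>X. coeff (P x) d \<noteq> 0} \<inter> (X - {x\<in>X. coeff (P x) d \<noteq> 0 \<and> P x dvd R x ^ d})"
            unfolding Un_iff Int_iff Diff_iff 1 2 unfolding mem_Collect_eq eq by (cases "coeff (P x) d = 0") auto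
        qed
        ultimately show ?thesis by simp
      next
        case (Cons P2' Rs)
        note Ps = \<open>Ps = P1' # Qs\<close>[unfolded Cons]
        obtain Q1 d1 Q2 d2 where Q12: "P1' = (Q1, Suc d1)" "P2' = (Q2, Suc d2)"
          using pos unfolding Ps by (cases P1'; cases P2'; cases "snd P1'"; cases "snd P2'") auto
        \<comment> \<open>The two equations are ordered by formal degree; the lower one acts as
          divisor.\<close>
        obtain P1 e1 P2 e2 where P12: "{(P1, Suc e1), (P2, Suc e2)} = {P1', P2'}" "e1 \<le> e2" "e1 + e2 = d1 + d2"
        proof (cases "d1 \<le> d2")
          case True
          then show ?thesis using that[of Q1 d1 Q2 d2] Q12 by simp
        next
          case False
          then show ?thesis using that[of Q2 d2 Q1 d1] Q12 by (simp add: insert_commute)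
        qed
        have mem: "(P1, Suc e1) \<in> set Ps" "(P2, Suc e2) \<in> set Ps"
          using P12(1) unfolding Ps by (auto simp: doubleton_eq_iff)
        have P1: "polyfam C (Suc e1) P1" and P2: "polyfam C (Suc e2) P2" using mem less.prems(1) by auto
        have S: "x \<in> ?S Ps \<longleftrightarrow> x \<in> X \<and> (\<exists>t. poly (P1 x) t = 0 \<and> poly (P2 x) t = 0 \<and> (\<forall>(P, d)\<in>set Rs. poly (P x) t = 0) \<and> poly (R x) t \<noteq> 0)" for x
        proof -
          have "set Ps = {(P1, Suc e1), (P2, Suc e2)} \<union> set Rs" unfolding P12(1) Ps by auto
          then show ?thesis by auto
        qed
        let ?T = "\<lambda>x. P1 x - monom (coeff (P1 x) e1) e1"
        let ?U = "\<lambda>x. reduce e1 e2 (P1 x) (P2 x)"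
        have n: "n = e1 + e2 + 2 + sum_list (map snd Rs) + length Rs + 2"
          using less.prems(2) P12(3) unfolding Ps Q12 by simp
        have Rs: "\<forall>(P, d)\<in>set Rs. polyfam C d P" using less.prems(1) unfolding Ps by auto
        have 1: "constr X C (?S ((?T, e1) # (P2, Suc e2) # Rs))"
          by (rule less.IH[OF _ _ refl]) (use n polyfam_truncate[OF P1] P2 Rs in auto)
        have 2: "constr X C (?S ((P1, Suc e1) # (?U, e2) # Rs))"
          by (rule less.IH[OF _ _ refl]) (use n P1 polyfam_reduce[OF P1 P2 P12(2)] Rs in auto)
        have "constr X C ({x\<in>X. coeff (P1 x) e1 = 0} \<inter> ?S ((?T, e1) # (P2, Suc e2) # Rs) \<union>
            {x\<in>X. coeff (P1 x) e1 \<noteq> 0} \<inter> ?S ((P1, Suc e1) # (?U, e2) # Rs))"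
          by (intro constr.un constr.int 1 2 constr.zero constr.nonzero polyfamD(1)[OF P1])
        moreover have "?S Ps = {x\<in>X. coeff (P1 x) e1 = 0} \<inter> ?S ((?T, e1) # (P2, Suc e2) # Rs) \<union>
            {x\<in>X. coeff (P1 x) e1 \<noteq> 0} \<inter> ?S ((P1, Suc e1) # (?U, e2) # Rs)"
        proof (rule Set.set_eqI)
          fix x
          show "x \<in> ?S Ps \<longleftrightarrow> x \<in> {x\<in>X. coeff (P1 x) e1 = 0} \<inter> ?S ((?T, e1) # (P2, Suc e2) # Rs) \<union>
            {x\<in>X. coeff (P1 x) e1 \<noteq> 0} \<inter> ?S ((P1, Suc e1) # (?U, e2) # Rs)"
          proof (cases "coeff (P1 x) e1 = 0")
            case True
            then show ?thesis unfolding S by simp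
          next
            case False
            have "(poly (P1 x) t = 0 \<and> poly (P2 x) t = 0) \<longleftrightarrow> (poly (P1 x) t = 0 \<and> poly (?U x) t = 0)" for t
              using poly_reduce[OF False] by auto
            then show ?thesis unfolding S using False by auto
          qed
        qed
        ultimately show ?thesis by simp
      qed
    qed
  qed
qed

text \<open>A disjunctive normal form with one inequation per clause, which is possible because a
  product in a field is nonzero exactly if all its factors are.\<close>

lemma constr_dnf:
  fixes C :: "('p \<Rightarrow> 'k::field) set"
  assumes "constr X C S"
  shows "\<exists>D. (\<forall>(fs, g)\<in>set D. set fs \<subseteq> polyfun C \<and> g \<in> polyfun C) \<and>
    S = {x\<in>X. \<exists>(fs, g)\<in>set D. (\<forall>f\<in>set fs. f x = 0) \<and> g x \<noteq> 0}"
  using assms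
proof induction
  case (zero p)
  show ?case
    by (rule exI[of _ "[([p], \<lambda>_. 1)]"]) (simp add: zero polyfun.const)
next
  case (nonzero p)
  show ?case by (rule exI[of _ "[([], p)]"]) (simp add: nonzero)
next
  case (un A B)
  then obtain D D' where D: "\<forall>(fs, g)\<in>set D. set fs \<subseteq> polyfun C \<and> g \<in> polyfun C"
    "A = {x\<in>X. \<exists>(fs, g)\<in>set D. (\<forall>f\<in>set fs. f x = 0) \<and> g x \<noteq> 0}"
    "\<forall>(fs, g)\<in>set D'. set fs \<subseteq> polyfun C \<and> g \<in> polyfun C"
    "B = {x\<in>X. \<exists>(fs, g)\<in>set D'. (\<forall>f\<in>set fs. f x = 0) \<and> g x \<noteq> 0}" by (elim exE conjE)
  show ?case
  proof (intro exI[of _ "D @ D'"] conjI)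
    show "\<forall>(fs, g)\<in>set (D @ D'). set fs \<subseteq> polyfun C \<and> g \<in> polyfun C" using D(1,3) by auto
    show "A \<union> B = {x\<in>X. \<exists>(fs, g)\<in>set (D @ D'). (\<forall>f\<in>set fs. f x = 0) \<and> g x \<noteq> 0}"
      unfolding D(2,4) by auto
  qed
next
  case (int A B)
  then obtain D D' where D: "\<forall>(fs, g)\<in>set D. set fs \<subseteq> polyfun C \<and> g \<in> polyfun C"
    "A = {x\<in>X. \<exists>(fs, g)\<in>set D. (\<forall>f\<in>set fs. f x = 0) \<and> g x \<noteq> 0}"
    "\<forall>(fs, g)\<in>set D'. set fs \<subseteq> polyfun C \<and> g \<in> polyfun C"
    "B = {x\<in>X. \<exists>(fs, g)\<in>set D'. (\<forall>f\<in>set fs. f x = 0) \<and> g x \<noteq> 0}" by (elim exE conjE)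
  let ?m = "\<lambda>((fs, g), (fs', g')). (fs @ fs', \<lambda>x. g x * g' x)"
  show ?case
  proof (intro exI[of _ "map ?m (List.product D D')"] conjI)
    show "\<forall>(fs, g)\<in>set (map ?m (List.product D D')). set fs \<subseteq> polyfun C \<and> g \<in> polyfun C"
    proof
      fix fg assume "fg \<in> set (map ?m (List.product D D'))"
      then obtain fs g fs' g' where *: "(fs, g) \<in> set D" "(fs', g') \<in> set D'" "fg = (fs @ fs', \<lambda>x. g x * g' x)"
        by auto
      have "set fs \<subseteq> polyfun C" "g \<in> polyfun C" "set fs' \<subseteq> polyfun C" "g' \<in> polyfun C"
        using D(1)[THEN bspec, OF *(1)] D(3)[THEN bspec, OF *(2)] by auto
      then show "case fg of (fs, g) \<Rightarrow> set fs \<subseteq> polyfun C \<and> g \<in> polyfun C"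
        unfolding *(3) by (simp add: polyfun.mult)
    qed
    show "A \<inter> B = {x\<in>X. \<exists>(fs, g)\<in>set (map ?m (List.product D D')). (\<forall>f\<in>set fs. f x = 0) \<and> g x \<noteq> 0}"
    proof (rule Set.set_eqI)
      fix x :: 'p
      let ?z = "\<lambda>(fs :: ('p \<Rightarrow> 'k) list, g :: 'p \<Rightarrow> 'k). (\<forall>f\<in>set fs. f x = 0) \<and> g x \<noteq> 0"
      have m: "?z (?m (a, b)) \<longleftrightarrow> ?z a \<and> ?z b" for a b
        by (cases a; cases b) (auto simp: ball_Un)
      have "(\<exists>c\<in>set (map ?m (List.product D D')). ?z c) \<longleftrightarrow> (\<exists>ab\<in>set D \<times> set D'. ?z (?m ab))"
        by (simp only: set_map set_product bex_simps)
      also have "\<dots> \<longleftrightarrow> (\<exists>a\<in>set D. \<exists>b\<in>set D'. ?z (?m (a, b)))"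
        by (simp only: split_paired_Bex_Sigma)
      also have "\<dots> \<longleftrightarrow> (\<exists>a\<in>set D. ?z a) \<and> (\<exists>b\<in>set D'. ?z b)"
        unfolding m by (simp only: bex_simps)
      finally have fin: "(\<exists>c\<in>set (map ?m (List.product D D')). ?z c) \<longleftrightarrow> (\<exists>a\<in>set D. ?z a) \<and> (\<exists>b\<in>set D'. ?z b)" .
      have "x \<in> A \<longleftrightarrow> x \<in> X \<and> (\<exists>a\<in>set D. ?z a)" "x \<in> B \<longleftrightarrow> x \<in> X \<and> (\<exists>b\<in>set D'. ?z b)"
        unfolding D(2,4) by (simp_all only: mem_Collect_eq)
      then show "x \<in> A \<inter> B \<longleftrightarrow> x \<in> {x\<in>X. \<exists>(fs, g)\<in>set (map ?m (List.product D D')). (\<forall>f\<in>set fs. f x = 0) \<and> g x \<noteq> 0}"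
        unfolding Int_iff mem_Collect_eq fin by (cases "x \<in> X") (simp_all only: simp_thms)
    qed
  qed
qed

text \<open>Affine space with countably many coordinates: binding a variable does not change the
  type. The infinite supply is harmless, since each set given by \<open>constr\<close> involves
  finitely many polynomials.\<close>

definition env_coords :: "((nat \<Rightarrow> 'k) \<Rightarrow> 'k) set" where
  "env_coords = range (\<lambda>j u. u j)"

lemma env_coord: "(\<lambda>u. u j) \<in> polyfun env_coords"
  unfolding env_coords_def by (intro polyfun.coord) auto

lemma polyfun_env_split:
  fixes f :: "(nat \<Rightarrow> 'k::field) \<Rightarrow> 'k"
  assumes "f \<in> polyfun env_coords"
  shows "\<exists>d P. polyfam env_coords d P \<and> (\<forall>t u. f (case_nat t u) = poly (P u) t)"
  using assms
proof induction
  case (const c)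
  show ?case
    by (intro exI[of _ "Suc 0"] exI[of _ "\<lambda>_. [:c:]"] conjI) (simp_all add: polyfam_const polyfun.const)
next
  case (coord f)
  then obtain j where f: "f = (\<lambda>u. u j)" unfolding env_coords_def by auto
  show ?case
  proof (cases j)
    case 0
    have "polyfam env_coords (Suc 1) (\<lambda>_. monom 1 1)" by (rule polyfam_monom[OF polyfun.const])
    then show ?thesis unfolding f 0
      by (intro exI[of _ "Suc 1"] exI[of _ "\<lambda>_. monom 1 1"]) (simp add: poly_monom)
  next
    case (Suc i)
    show ?thesis unfolding f Suc
      by (intro exI[of _ "Suc 0"] exI[of _ "\<lambda>u. [:u i:]"] conjI) (simp_all add: polyfam_const env_coord)
  qed
next
  case (add f g)
  then obtain d P e R where P: "polyfam env_coords d P" "\<forall>t u. f (case_nat t u) = poly (P u) t"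
    and R: "polyfam env_coords e R" "\<forall>t u. g (case_nat t u) = poly (R u) t" by (elim exE conjE)
  show ?case
    by (intro exI[of _ "max d e"] exI[of _ "\<lambda>u. P u + R u"] conjI polyfam_add P(1) R(1)) (simp add: P(2) R(2))
next
  case (mult f g)
  then obtain d P e R where P: "polyfam env_coords d P" "\<forall>t u. f (case_nat t u) = poly (P u) t"
    and R: "polyfam env_coords e R" "\<forall>t u. g (case_nat t u) = poly (R u) t" by (elim exE conjE)
  show ?case
    by (intro exI[of _ "d + e"] exI[of _ "\<lambda>u. P u * R u"] conjI polyfam_mult P(1) R(1)) (simp add: P(2) R(2))
qed

lemma constr_env_ex:
  fixes S :: "(nat \<Rightarrow> 'k::field) set"
  assumes closed: "root_closed TYPE('k)" and S: "constr UNIV env_coords S"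
  shows "constr UNIV env_coords {u. \<exists>t. case_nat t u \<in> S}"
proof -
  obtain D where D: "\<forall>(fs, g)\<in>set D. set fs \<subseteq> polyfun env_coords \<and> g \<in> polyfun env_coords"
    "S = {x\<in>UNIV. \<exists>(fs, g)\<in>set D. (\<forall>f\<in>set fs. f x = 0) \<and> g x \<noteq> 0}"
    using constr_dnf[OF S] by (elim exE conjE)
  have "constr UNIV env_coords {u\<in>UNIV. \<exists>t. (\<forall>f\<in>set fs. f (case_nat t u) = 0) \<and> g (case_nat t u) \<noteq> 0}"
    if fg: "(fs, g) \<in> set D" for fs and g :: "(nat \<Rightarrow> 'k) \<Rightarrow> 'k"
  proof -
    have "\<forall>f\<in>set fs. \<exists>d P. polyfam env_coords d P \<and> (\<forall>t u. f (case_nat t u) = poly (P u) t)"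
    proof
      fix f assume "f \<in> set fs"
      then have "f \<in> polyfun env_coords" using D(1) fg by auto
      then show "\<exists>d P. polyfam env_coords d P \<and> (\<forall>t u. f (case_nat t u) = poly (P u) t)"
        by (rule polyfun_env_split)
    qed
    then obtain d P where dP: "\<forall>f\<in>set fs. polyfam env_coords (d f) (P f) \<and> (\<forall>t u. f (case_nat t u) = poly (P f u) t)"
      by (elim bchoice[THEN exE])
    have "g \<in> polyfun env_coords" using D(1) fg by auto
    then obtain e R where R: "polyfam env_coords e R" "\<forall>t u. g (case_nat t u) = poly (R u) t"
      using polyfun_env_split by blast
    let ?Ps = "map (\<lambda>f. (P f, d f)) fs"
    have "constr UNIV env_coords {u\<in>UNIV. \<exists>t. (\<forall>(P, d)\<in>set ?Ps. poly (P u) t = 0) \<and> poly (R u) t \<noteq> 0}"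
      by (rule constr_ex_root_list[OF closed R(1) _ refl]) (use dP in auto)
    then show ?thesis using dP R(2) by simp
  qed
  then have "constr UNIV env_coords {u\<in>UNIV. \<exists>fg\<in>set D. \<exists>t. (\<forall>f\<in>set (fst fg). f (case_nat t u) = 0) \<and> snd fg (case_nat t u) \<noteq> 0}"
    by (intro constr_Bex) auto
  moreover have "{u. \<exists>t. case_nat t u \<in> S} = {u\<in>UNIV. \<exists>fg\<in>set D. \<exists>t. (\<forall>f\<in>set (fst fg). f (case_nat t u) = 0) \<and> snd fg (case_nat t u) \<noteq> 0}"
    unfolding D(2) by (auto simp: case_prod_unfold)
  ultimately show ?thesis by simp
qed

lemma constr_env_exs:
  fixes S :: "(nat \<Rightarrow> 'k::field) set"
  assumes closed: "root_closed TYPE('k)" and S: "constr UNIV env_coords S"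
  shows "constr UNIV env_coords {u. \<exists>w. (\<lambda>i. if i < n then w i else u (i - n)) \<in> S}"
  using S
proof (induction n arbitrary: S)
  case 0
  then show ?case by simp
next
  case (Suc n)
  have eq: "case_nat t (\<lambda>i. if i < n then w i else u (i - n)) =
    (\<lambda>i. if i < Suc n then case_nat t w i else u (i - Suc n))" for t :: 'k and w u
    by (auto simp: fun_eq_iff split: nat.splits)
  have surj: "case_nat (w 0) (\<lambda>i. w (Suc i)) = w" for w :: "nat \<Rightarrow> 'k"
    by (auto simp: fun_eq_iff split: nat.splits)
  have "(\<exists>w t. case_nat t (\<lambda>i. if i < n then w i else u (i - n)) \<in> S) \<longleftrightarrow>
    (\<exists>w. (\<lambda>i. if i < Suc n then w i else u (i - Suc n)) \<in> S)" for u
    unfolding eq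
  proof
    assume "\<exists>w. (\<lambda>i. if i < Suc n then w i else u (i - Suc n)) \<in> S"
    then obtain w where "(\<lambda>i. if i < Suc n then w i else u (i - Suc n)) \<in> S" ..
    then show "\<exists>w t. (\<lambda>i. if i < Suc n then case_nat t w i else u (i - Suc n)) \<in> S"
      by (intro exI[of _ "\<lambda>i. w (Suc i)"] exI[of _ "w 0"]) (simp only: surj)
  qed auto
  then show ?case using Suc.IH[OF constr_env_ex[OF closed Suc.prems]] by simp
qed

text \<open>With cleared denominators; where no \<open>q i\<close> vanishes, the set is the image of
  \<open>S\<close> under the map with components \<open>p i / q i\<close>. As elimination acts on
  environments, \<open>\<Theta>\<close> parametrizes \<open>X\<close> by the first \<open>D\<close>
  variables, and \<open>v\<close> occupies the indices from \<open>D\<close> on.\<close>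

lemma constr_image_rational_map:
  fixes C :: "('p \<Rightarrow> 'k::field) set" and \<Theta> :: "(nat \<Rightarrow> 'k) \<Rightarrow> 'p"
  assumes closed: "root_closed TYPE('k)" and S: "constr X C S"
    and \<Theta>: "polynomial_map UNIV env_coords C \<Theta>" "range \<Theta> = X"
    and dep: "\<And>u w. (\<And>i. i < D \<Longrightarrow> u i = w i) \<Longrightarrow> \<Theta> u = \<Theta> w"
    and pq: "\<And>i. i < n \<Longrightarrow> p i \<in> polyfun C" "\<And>i. i < n \<Longrightarrow> q i \<in> polyfun C"
  shows "constr (carrier_vec n) (vec_coords n) {v\<in>carrier_vec n. \<exists>x\<in>S. \<forall>i<n. q i x * v $ i = p i x}"
proof -
  let ?R = "{z. \<Theta> z \<in> S \<and> (\<forall>i\<in>{..<n}. q i (\<Theta> z) * z (D + i) - p i (\<Theta> z) = 0)}"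
  have "constr UNIV env_coords {z\<in>UNIV. \<Theta> z \<in> S \<and> (\<forall>i\<in>{..<n}. q i (\<Theta> z) * z (D + i) - p i (\<Theta> z) = 0)}"
  proof (intro constr_conj constr_Ball)
    show "constr UNIV env_coords {z\<in>UNIV. \<Theta> z \<in> S}"
      by (rule constr_vimage[OF S \<Theta>(1)]) (use \<Theta>(2) in auto)
    show "constr UNIV env_coords {z\<in>UNIV. q i (\<Theta> z) * z (D + i) - p i (\<Theta> z) = 0}" if i: "i \<in> {..<n}" for i
    proof -
      obtain q' where q': "q' \<in> polyfun env_coords" "\<forall>z\<in>UNIV. q i (\<Theta> z) = q' z"
        using polynomial_map_polyfun[OF \<Theta>(1) pq(2)[of i]] i by auto
      obtain p' where p': "p' \<in> polyfun env_coords" "\<forall>z\<in>UNIV. p i (\<Theta> z) = p' z"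
        using polynomial_map_polyfun[OF \<Theta>(1) pq(1)[of i]] i by auto
      have "constr UNIV env_coords {z\<in>UNIV. q' z * z (D + i) - p' z = 0}"
        by (intro constr.zero polyfun_diff polyfun.mult q'(1) p'(1) env_coord)
      then show ?thesis using q'(2) p'(2) by simp
    qed
  qed simp
  then have "constr UNIV env_coords ?R" by simp
  from constr_env_exs[OF closed this, of D]
  have T: "constr UNIV env_coords {u. \<exists>w. (\<lambda>i. if i < D then w i else u (i - D)) \<in> ?R}" (is "constr _ _ ?T") .
  \<comment> \<open>A vector is read as an environment by padding with zeros.\<close>
  let ?h = "\<lambda>v i. if i < n then v $ i else (0 :: 'k)"
  have "polynomial_map (carrier_vec n) (vec_coords n) env_coords ?h"
    unfolding polynomial_map_def
  proof
    fix c :: "(nat \<Rightarrow> 'k) \<Rightarrow> 'k" assume "c \<in> env_coords"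
    then obtain j where c: "c = (\<lambda>u. u j)" unfolding env_coords_def by auto
    show "\<exists>f\<in>polyfun (vec_coords n). \<forall>v\<in>carrier_vec n. c (?h v) = f v"
    proof (cases "j < n")
      case True
      then have "(\<lambda>v. v $ j) \<in> polyfun (vec_coords n)" unfolding vec_coords_def by (intro polyfun.coord) auto
      then show ?thesis using True unfolding c by auto
    next
      case False
      show ?thesis unfolding c by (rule bexI[OF _ polyfun.const[of 0]]) (simp add: False)
    qed
  qed
  from constr_vimage[OF T this] have "constr (carrier_vec n) (vec_coords n) {v\<in>carrier_vec n. ?h v \<in> ?T}" by simp
  moreover have "?h v \<in> ?T \<longleftrightarrow> (\<exists>x\<in>S. \<forall>i<n. q i x * v $ i = p i x)" if v: "v \<in> carrier_vec n" for v
  proof -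
    have \<Theta>eq: "\<Theta> (\<lambda>i. if i < D then w i else ?h v (i - D)) = \<Theta> w" for w by (rule dep) simp
    have "?h v \<in> ?T \<longleftrightarrow> (\<exists>w. \<Theta> w \<in> S \<and> (\<forall>i<n. q i (\<Theta> w) * v $ i = p i (\<Theta> w)))"
      unfolding mem_Collect_eq \<Theta>eq by auto
    also have "\<dots> \<longleftrightarrow> (\<exists>x\<in>S. \<forall>i<n. q i x * v $ i = p i x)"
    proof
      assume "\<exists>x\<in>S. \<forall>i<n. q i x * v $ i = p i x"
      then obtain x where x: "x \<in> S" "\<forall>i<n. q i x * v $ i = p i x" by auto
      then have "x \<in> range \<Theta>" using constr_subset[OF S] \<Theta>(2) by auto
      then obtain w where "x = \<Theta> w" by auto
      then show "\<exists>w. \<Theta> w \<in> S \<and> (\<forall>i<n. q i (\<Theta> w) * v $ i = p i (\<Theta> w))" using x by auto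
    qed auto
    finally show ?thesis .
  qed
  then have "{v\<in>carrier_vec n. ?h v \<in> ?T} = {v\<in>carrier_vec n. \<exists>x\<in>S. \<forall>i<n. q i x * v $ i = p i x}"
    by (intro Collect_cong conj_cong refl)
  ultimately show ?thesis by simp
qed

section \<open>Images of constructible sets under geometric quotients\<close>

lemma continuous_map_zariski:
  assumes "polynomial_map X C D h" "h \<in> X \<rightarrow> Y"
  shows "continuous_map (zariski X C) (zariski Y D) h"
  unfolding continuous_map_def topspace_zariski
proof (intro conjI allI impI assms(2))
  fix V assume "openin (zariski Y D) V"
  then obtain P where P: "P \<subseteq> polyfun D" "V = {y\<in>Y. \<exists>p\<in>P. p y \<noteq> 0}"
    unfolding openin_zariski zariski_open_alt by blast
  have "\<forall>p\<in>P. \<exists>f. f \<in> polyfun C \<and> (\<forall>x\<in>X. p (h x) = f x)"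
  proof
    fix p assume "p \<in> P"
    then have "p \<in> polyfun D" using P(1) by auto
    from polynomial_map_polyfun[OF assms(1) this]
    show "\<exists>f. f \<in> polyfun C \<and> (\<forall>x\<in>X. p (h x) = f x)" unfolding Bex_def .
  qed
  then obtain f where f: "\<forall>p\<in>P. f p \<in> polyfun C \<and> (\<forall>x\<in>X. p (h x) = f p x)" by (elim bchoice[THEN exE])
  have "{x\<in>X. h x \<in> V} = {x\<in>X. \<exists>p\<in>f ` P. p x \<noteq> 0}"
    using f assms(2) unfolding P(2) by auto
  moreover have "f ` P \<subseteq> polyfun C" using f by auto
  ultimately show "openin (zariski X C) {x\<in>X. h x \<in> V}"
    unfolding openin_zariski zariski_open_alt by (intro exI[of _ "f ` P"] conjI)
qed

section \<open>Saturated sets and the quotient topology\<close>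

definition saturated :: "'p set \<Rightarrow> ('p \<Rightarrow> 'm) \<Rightarrow> 'p set \<Rightarrow> bool" where
  "saturated U \<pi> S \<longleftrightarrow> S \<subseteq> U \<and> (\<forall>x\<in>S. \<forall>y\<in>U. \<pi> y = \<pi> x \<longrightarrow> y \<in> S)"

lemma saturated_diff: "saturated U \<pi> A \<Longrightarrow> saturated U \<pi> B \<Longrightarrow> saturated U \<pi> (A - B)"
  unfolding saturated_def by (metis Diff_iff Diff_subset subset_iff)

lemma saturated_int: "saturated U \<pi> A \<Longrightarrow> saturated U \<pi> B \<Longrightarrow> saturated U \<pi> (A \<inter> B)"
  unfolding saturated_def by auto

text \<open>Some nonempty relatively open part of \<open>Z\<close> lies entirely inside or entirely
  outside \<open>S\<close>. For unions and intersections, shrink once for each of the two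
  sets.\<close>

lemma constructible_decides_open_subset:
  assumes "constructible_in T S" "Z \<subseteq> topspace T" "Z \<noteq> {}"
  shows "\<exists>V. openin T V \<and> Z \<inter> V \<noteq> {} \<and> (Z \<inter> V \<subseteq> S \<or> Z \<inter> V \<inter> S = {})"
  using assms
proof (induction arbitrary: Z rule: constructible_in.induct)
  case (opn S)
  show ?case
  proof (cases "Z \<inter> S = {}")
    case True
    then show ?thesis using opn by (intro exI[of _ "topspace T"]) auto
  next
    case False
    then show ?thesis using opn by (intro exI[of _ S]) auto
  qed
next
  case (cls S)
  show ?case
  proof (cases "Z \<subseteq> S")
    case True
    then show ?thesis using cls by (intro exI[of _ "topspace T"]) auto
  next
    case False
    then show ?thesis using cls by (intro exI[of _ "topspace T - S"]) auto
  qed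
next
  case (un A B)
  obtain V where V: "openin T V" "Z \<inter> V \<noteq> {}" "Z \<inter> V \<subseteq> A \<or> Z \<inter> V \<inter> A = {}"
    using un.IH(1)[OF un.prems] by auto
  have "Z \<inter> V \<subseteq> topspace T" using un.prems(1) by auto
  then obtain V' where V': "openin T V'" "Z \<inter> V \<inter> V' \<noteq> {}" "Z \<inter> V \<inter> V' \<subseteq> B \<or> Z \<inter> V \<inter> V' \<inter> B = {}"
    using un.IH(2)[OF _ V(2)] by auto
  show ?case using V V' by (intro exI[of _ "V \<inter> V'"]) (auto simp: Int_assoc)
next
  case (int A B)
  obtain V where V: "openin T V" "Z \<inter> V \<noteq> {}" "Z \<inter> V \<subseteq> A \<or> Z \<inter> V \<inter> A = {}"
    using int.IH(1)[OF int.prems] by auto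
  have "Z \<inter> V \<subseteq> topspace T" using int.prems(1) by auto
  then obtain V' where V': "openin T V'" "Z \<inter> V \<inter> V' \<noteq> {}" "Z \<inter> V \<inter> V' \<subseteq> B \<or> Z \<inter> V \<inter> V' \<inter> B = {}"
    using int.IH(2)[OF _ V(2)] by auto
  show ?case using V V' by (intro exI[of _ "V \<inter> V'"]) (auto simp: Int_assoc)
qed

text \<open>A saturated constructible set contains a nonempty saturated subset that is open in its
  closure; noetherian induction deals with the rest.\<close>

lemma constructible_image_quotient_map:
  fixes C :: "('p \<Rightarrow> 'k::field) set"
  assumes "finite C" and quot: "quotient_map (zariski U C) T \<pi>"
    and closure: "\<And>S. saturated U \<pi> S \<Longrightarrow> saturated U \<pi> (zariski U C closure_of S)"
    and "constructible_in (zariski U C) S" "saturated U \<pi> S"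
  shows "constructible_in T (\<pi> ` S)"
proof -
  let ?Z = "zariski U C"
  \<comment> \<open>A saturated set is the full preimage of its image, so the quotient topology
    detects that the image is closed.\<close>
  have closed_image: "closedin T (\<pi> ` F)" if F: "closedin ?Z F" "saturated U \<pi> F" for F
  proof -
    have surj: "\<pi> ` U = topspace T" using quotient_imp_surjective_map[OF quot] by simp
    have "\<pi> ` F \<subseteq> topspace T" using closedin_subset[OF F(1)] surj by auto
    moreover have "{x\<in>topspace ?Z. \<pi> x \<in> \<pi> ` F} = F" using F(2) closedin_subset[OF F(1)] unfolding saturated_def by auto
    ultimately show ?thesis using quot F(1) unfolding quotient_map_closedin by metis
  qed
  have "constructible_in T (\<pi> ` S)"
    if "constructible_in ?Z S" "saturated U \<pi> S" "?Z closure_of S = F" for S F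
    using that
  proof (induction F arbitrary: S rule: wf_induct_rule[OF wf_closed_zariski[OF assms(1), of U]])
    case (1 F)
    have SU: "S \<subseteq> U" using 1(3) unfolding saturated_def by simp
    have SF: "S \<subseteq> F" using closure_of_subset[of S ?Z] SU 1(4) by simp
    have F: "closedin ?Z F" "saturated U \<pi> F" using 1(4) closure[OF 1(3)] closedin_closure_of by auto
    show ?case
    proof (cases "S = {}")
      case True
      then show ?thesis using constructible_in.opn[of T "{}"] by simp
    next
      case False
      \<comment> \<open>\<open>F - ?G\<close> is the interior of \<open>S\<close> relative to
        \<open>F\<close>. It is saturated, because closures of saturated sets are.\<close>
      let ?G = "?Z closure_of (F - S)"
      have G: "closedin ?Z ?G" "saturated U \<pi> ?G" using closure[OF saturated_diff[OF F(2) 1(3)]] closedin_closure_of by auto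
      have GF: "?G \<subseteq> F" by (rule closure_of_minimal[OF _ F(1)]) auto
      have FS_G: "F - S \<subseteq> ?G" using closure_of_subset[of "F - S" ?Z] closedin_subset[OF F(1)] by auto
      have FU: "F \<subseteq> topspace ?Z" using closedin_subset[OF F(1)] .
      obtain V where V: "openin ?Z V" "F \<inter> V \<noteq> {}" "F \<inter> V \<subseteq> S \<or> F \<inter> V \<inter> S = {}"
        using constructible_decides_open_subset[OF 1(2) FU] False SF by auto
      \<comment> \<open>\<open>S\<close> meets every open set that meets its closure
        \<open>F\<close>; this excludes the second alternative for \<open>V\<close>.\<close>
      have "F \<inter> V \<inter> S \<noteq> {}"
      proof -
        obtain x where x: "x \<in> F" "x \<in> V" using V(2) by auto
        then have "x \<in> ?Z closure_of S" using 1(4) by simp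
        then obtain y where "y \<in> S" "y \<in> V" using V(1) x(2) unfolding in_closure_of by blast
        then show ?thesis using SF by auto
      qed
      then have VS: "F \<inter> V \<subseteq> S" using V(3) by auto
      have "F - S \<subseteq> topspace ?Z - V" using VS FU by auto
      then have "?G \<subseteq> topspace ?Z - V" by (intro closure_of_minimal closedin_diff closedin_topspace V(1))
      then have "?G \<subset> F" using GF V(2) by auto
      \<comment> \<open>On saturated sets taking images commutes with differences, so this image is
        a difference of two closed sets.\<close>
      have inner: "constructible_in T (\<pi> ` (F - ?G))"
      proof -
        have "\<pi> ` (F - ?G) = \<pi> ` F - \<pi> ` ?G"
          using F(2) G(2) closedin_subset[OF G(1)] closedin_subset[OF F(1)] unfolding saturated_def by auto
        then show ?thesis
          using closed_image[OF F] closed_image[OF G] by (simp add: constructible_in_diff constructible_in.cls)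
      qed
      \<comment> \<open>The rest of \<open>S\<close> lies in \<open>?G\<close>, so its closure is
        strictly smaller than \<open>F\<close> and the induction applies.\<close>
      have "?Z closure_of (S \<inter> ?G) \<subseteq> ?G" by (rule closure_of_minimal[OF _ G(1)]) auto
      then have "?Z closure_of (S \<inter> ?G) \<subset> F" using \<open>?G \<subset> F\<close> by auto
      then have "(?Z closure_of (S \<inter> ?G), F) \<in> {(A, B). closedin ?Z A \<and> closedin ?Z B \<and> A \<subset> B}"
        using F(1) by simp
      then have "constructible_in T (\<pi> ` (S \<inter> ?G))"
        by (rule 1(1)[OF _ constructible_in.int[OF 1(2) constructible_in.cls[OF G(1)]] saturated_int[OF 1(3) G(2)] refl])
      then have "constructible_in T (\<pi> ` (F - ?G) \<union> \<pi> ` (S \<inter> ?G))" by (intro constructible_in.un inner)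
      moreover have "\<pi> ` (F - ?G) \<union> \<pi> ` (S \<inter> ?G) = \<pi> ` S"
      proof -
        have "(F - ?G) \<union> (S \<inter> ?G) = S" using FS_G SF by auto
        then show ?thesis by (simp only: image_Un[symmetric])
      qed
      ultimately show ?thesis by simp
    qed
  qed
  then show ?thesis using assms(4,5) by simp
qed

section \<open>The group action and closures of saturated sets\<close>

lemma mult_mat_index_sum:
  "A \<in> carrier_mat m n \<Longrightarrow> B \<in> carrier_mat n q \<Longrightarrow> i < m \<Longrightarrow> j < q \<Longrightarrow>
    (A * B) $$ (i, j) = (\<Sum>l<n. A $$ (i, l) * B $$ (l, j))"
  by (simp add: scalar_prod_def atLeast0LessThan)

text \<open>For fixed \<open>g\<close> the inverse matrices are constants, so the action is linear
  in the matrix entries.\<close>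

lemma polynomial_map_GL_act:
  assumes Q: "quiver Q" and U: "U \<subseteq> rep_space Q \<alpha>" and g: "g \<in> GL Q \<alpha>"
  shows "polynomial_map U (rep_coords Q \<alpha>) (rep_coords Q \<alpha>) (GL_act Q \<alpha> g)"
  unfolding polynomial_map_def
proof
  fix c :: "(nat \<Rightarrow> 'a mat) \<Rightarrow> 'a" assume "c \<in> rep_coords Q \<alpha>"
  then obtain a i j where c: "c = (\<lambda>\<phi>. \<phi> a $$ (i, j))" and a: "a \<in> arcs Q"
    and i: "i < \<alpha> (head Q a)" and j: "j < \<alpha> (tail Q a)" unfolding rep_coords_def by auto
  let ?h = "head Q a" and ?t = "tail Q a"
  let ?H = "inv\<^bsub>ring_mat TYPE('a) (\<alpha> ?t) ()\<^esub> (g ?t)"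
  have H: "?H \<in> carrier_mat (\<alpha> ?t) (\<alpha> ?t)" and G: "g ?h \<in> carrier_mat (\<alpha> ?h) (\<alpha> ?h)"
  proof -
    \<comment> \<open>The zero representation is merely a point to which
      \<open>GL_base_change\<close> can be applied in order to get the sizes of the
      matrices.\<close>
    let ?\<zeta> = "\<lambda>a\<in>arcs Q. 0\<^sub>m (\<alpha> (head Q a)) (\<alpha> (tail Q a)) :: 'a mat"
    have "?\<zeta> \<in> rep_space Q \<alpha>" unfolding rep_space_def by auto
    note bc = GL_base_change[OF Q this g]
    show "?H \<in> carrier_mat (\<alpha> ?t) (\<alpha> ?t)" "g ?h \<in> carrier_mat (\<alpha> ?h) (\<alpha> ?h)"
      using base_changeD(2)[OF bc quiverD(5)[OF Q a]] base_changeD(1)[OF bc quiverD(4)[OF Q a]] by auto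
  qed
  let ?f = "\<lambda>\<phi>. \<Sum>l<\<alpha> ?t. (\<Sum>k<\<alpha> ?h. g ?h $$ (i, k) * \<phi> a $$ (k, l)) * ?H $$ (l, j)"
  have "(\<lambda>\<phi>. \<phi> a $$ (k, l)) \<in> polyfun (rep_coords Q \<alpha>)" if "k < \<alpha> ?h" "l < \<alpha> ?t" for k l
    using a that unfolding rep_coords_def by (intro polyfun.coord) auto
  then have "?f \<in> polyfun (rep_coords Q \<alpha>)"
    by (intro polyfun_sum polyfun.mult polyfun.const) auto
  moreover have "c (GL_act Q \<alpha> g \<phi>) = ?f \<phi>" if "\<phi> \<in> U" for \<phi>
  proof -
    have A: "\<phi> a \<in> carrier_mat (\<alpha> ?h) (\<alpha> ?t)" using that U a unfolding rep_space_def by auto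
    have "c (GL_act Q \<alpha> g \<phi>) = (g ?h * \<phi> a * ?H) $$ (i, j)" unfolding c GL_act_def using a by simp
    also have "\<dots> = (\<Sum>l<\<alpha> ?t. (g ?h * \<phi> a) $$ (i, l) * ?H $$ (l, j))"
      by (rule mult_mat_index_sum[OF mult_carrier_mat[OF G A] H i j])
    also have "\<dots> = ?f \<phi>"
      using mult_mat_index_sum[OF G A i] by (intro sum.cong refl) simp
    finally show ?thesis .
  qed
  ultimately show "\<exists>f\<in>polyfun (rep_coords Q \<alpha>). \<forall>\<phi>\<in>U. c (GL_act Q \<alpha> g \<phi>) = f \<phi>"
    by (intro bexI[of _ ?f] ballI)
qed

text \<open>Two points of a fibre differ by a group element. It acts continuously on
  \<open>U\<close> and maps \<open>S\<close> into itself, hence also the closure of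
  \<open>S\<close>.\<close>

lemma saturated_closure:
  assumes Q: "quiver Q" and U: "U \<subseteq> rep_space Q \<alpha>"
    and fibre: "\<And>\<phi>. \<phi> \<in> U \<Longrightarrow> {\<psi>\<in>U. \<pi> \<psi> = \<pi> \<phi>} = GL_orbit Q \<alpha> \<phi>"
    and S: "saturated U \<pi> S"
  shows "saturated U \<pi> (zariski U (rep_coords Q \<alpha>) closure_of S)"
  unfolding saturated_def
proof (intro conjI ballI impI)
  let ?Z = "zariski U (rep_coords Q \<alpha>)"
  show sub: "?Z closure_of S \<subseteq> U" using closure_of_subset_topspace[of ?Z S] by simp
  fix x y assume x: "x \<in> ?Z closure_of S" and y: "y \<in> U" "\<pi> y = \<pi> x"
  have xU: "x \<in> U" using x sub by auto
  have "y \<in> {\<psi>\<in>U. \<pi> \<psi> = \<pi> x}" using y by simp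
  then have "y \<in> GL_orbit Q \<alpha> x" unfolding fibre[OF xU] .
  then obtain g where g: "g \<in> GL Q \<alpha>" "y = GL_act Q \<alpha> g x" unfolding GL_orbit_def by auto
  have act: "GL_act Q \<alpha> g z \<in> {\<psi>\<in>U. \<pi> \<psi> = \<pi> z}" if z: "z \<in> U" for z
    unfolding fibre[OF z] GL_orbit_def using g(1) by auto
  then have "continuous_map ?Z ?Z (GL_act Q \<alpha> g)"
    by (intro continuous_map_zariski[OF polynomial_map_GL_act[OF Q U g(1)]]) auto
  then have "GL_act Q \<alpha> g ` (?Z closure_of S) \<subseteq> ?Z closure_of (GL_act Q \<alpha> g ` S)"
    by (rule continuous_map_image_closure_subset)
  moreover have "GL_act Q \<alpha> g ` S \<subseteq> S"
  proof
    fix w assume "w \<in> GL_act Q \<alpha> g ` S"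
    then obtain z where z: "z \<in> S" "w = GL_act Q \<alpha> g z" by auto
    then have "z \<in> U" using S unfolding saturated_def by auto
    from act[OF this] show "w \<in> S" using S z unfolding saturated_def by auto
  qed
  then have "?Z closure_of (GL_act Q \<alpha> g ` S) \<subseteq> ?Z closure_of S" by (rule closure_of_mono)
  ultimately show "y \<in> ?Z closure_of S" using x g(2) by auto
qed

section \<open>Images in an affine chart over an algebraically closed field\<close>

lemma regular_local_quotients:
  fixes n :: nat
  assumes "\<And>i. i < n \<Longrightarrow> regular (zariski_fspace U C) U' (f i)" "openin (zariski U C) U'" "x \<in> U'"
  shows "\<exists>W p q. openin (zariski U C) W \<and> x \<in> W \<and> W \<subseteq> U' \<and>
    (\<forall>i<n. p i \<in> polyfun C \<and> q i \<in> polyfun C \<and> (\<forall>y\<in>W. q i y \<noteq> 0 \<and> f i y = p i y / q i y))"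
  using assms(1)
proof (induction n)
  case 0
  show ?case by (rule exI[of _ U']) (use assms(2,3) in simp)
next
  case (Suc n)
  obtain W p q where W: "openin (zariski U C) W" "x \<in> W" "W \<subseteq> U'"
    "\<forall>i<n. p i \<in> polyfun C \<and> q i \<in> polyfun C \<and> (\<forall>y\<in>W. q i y \<noteq> 0 \<and> f i y = p i y / q i y)"
    using Suc.IH Suc.prems by (auto simp: less_Suc_eq)
  have "\<exists>W p q. openin (zariski U C) W \<and> x \<in> W \<and> W \<subseteq> U' \<and> p \<in> polyfun C \<and> q \<in> polyfun C \<and> (\<forall>y\<in>W. q y \<noteq> 0 \<and> f n y = p y / q y)"
    using Suc.prems[of n] assms(3) unfolding zariski_fspace_def by simp
  then obtain W' p' q' where W': "openin (zariski U C) W'" "x \<in> W'" "W' \<subseteq> U'" "p' \<in> polyfun C" "q' \<in> polyfun C"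
    "\<forall>y\<in>W'. q' y \<noteq> 0 \<and> f n y = p' y / q' y" by (elim exE conjE)
  show ?case
    by (rule exI[of _ "W \<inter> W'"], rule exI[of _ "p(n := p')"], rule exI[of _ "q(n := q')"])
      (use W W' in \<open>auto simp: less_Suc_eq\<close>)
qed

text \<open>In the coordinates of the chart, \<open>\<pi>\<close> is locally given by quotients of
  polynomials. Finitely many pieces suffice by quasi-compactness, and Chevalley's theorem applies to
  each.\<close>

lemma constructible_image_chart:
  fixes C :: "('p \<Rightarrow> 'k::field) set" and \<Theta> :: "(nat \<Rightarrow> 'k) \<Rightarrow> 'p" and M :: "('m, 'k) fspace"
  assumes closed: "root_closed TYPE('k)" and C: "finite C"
    and U: "constr X C U" and S: "constr X C S" "S \<subseteq> U"
    and \<Theta>: "polynomial_map UNIV env_coords C \<Theta>" "range \<Theta> = X"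
      "\<And>u w. (\<And>i. i < D \<Longrightarrow> u i = w i) \<Longrightarrow> \<Theta> u = \<Theta> w"
    and \<pi>: "regular_map (zariski_fspace U C) M \<pi>"
    and V: "openin (space_top M) V" and Z: "closedin (zariski (carrier_vec n) (vec_coords n)) Z"
    and h: "fspace_iso (restrict_fspace M V) (zariski_fspace Z (vec_coords n)) h"
  shows "constructible_in (space_top M) (V \<inter> \<pi> ` S)"
proof -
  let ?V = "subtopology (space_top M) V" and ?Z = "zariski Z (vec_coords n)"
  have top_V: "topspace ?V = V" using openin_subset[OF V] by auto
  have Zn: "Z \<subseteq> carrier_vec n" using closedin_subset[OF Z] by simp
  have h_reg: "regular_map (restrict_fspace M V) (zariski_fspace Z (vec_coords n)) h"
    using h unfolding fspace_iso_def by simp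
  have h_cont: "continuous_map ?V ?Z h"
    using h_reg unfolding regular_map_def restrict_fspace_def zariski_fspace_def by simp
  have hZ: "h m \<in> Z" if "m \<in> V" for m using continuous_map_funspace[OF h_cont] that top_V by auto
  have h_inj: "m = m'" if "m \<in> V" "m' \<in> V" "h m = h m'" for m m'
  proof -
    obtain k where "\<forall>x\<in>topspace (space_top (restrict_fspace M V)). k (h x) = x"
      using h unfolding fspace_iso_def by auto
    then have "\<forall>x\<in>V. k (h x) = x" using top_V unfolding restrict_fspace_def by simp
    then show ?thesis using that by metis
  qed
  have \<pi>_cont: "continuous_map (zariski U C) (space_top M) \<pi>"
    using \<pi> unfolding regular_map_def zariski_fspace_def by simp
  let ?U' = "{x\<in>U. \<pi> x \<in> V}"
  have U': "openin (zariski U C) ?U'"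
    using openin_continuous_map_preimage[OF \<pi>_cont V] by simp
  have reg: "regular (zariski_fspace U C) ?U' (\<lambda>x. h (\<pi> x) $ i)" if i: "i < n" for i
  proof -
    have "regular (zariski_fspace Z (vec_coords n)) Z (\<lambda>v. v $ i)"
    proof -
      have "(\<lambda>v. v $ i) \<in> polyfun (vec_coords n)" unfolding vec_coords_def using i by (intro polyfun.coord) auto
      moreover have "openin ?Z Z" using openin_topspace[of ?Z] by simp
      ultimately show ?thesis unfolding zariski_fspace_def fspace.simps
        by (intro ballI exI[of _ Z] exI[of _ "\<lambda>v. v $ i"] exI[of _ "\<lambda>_. 1"]) (simp add: polyfun.const)
    qed
    moreover have "openin (space_top (zariski_fspace Z (vec_coords n))) Z"
      using openin_topspace[of ?Z] unfolding zariski_fspace_def by simp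
    ultimately have "regular (restrict_fspace M V) {x \<in> topspace (space_top (restrict_fspace M V)). h x \<in> Z} (\<lambda>x. h x $ i)"
      by (intro h_reg[unfolded regular_map_def, THEN conjunct2, rule_format] conjI)
    moreover have "{x \<in> topspace (space_top (restrict_fspace M V)). h x \<in> Z} = V"
      using top_V hZ unfolding restrict_fspace_def by auto
    ultimately have "regular M V (\<lambda>x. h x $ i)" unfolding restrict_fspace_def by simp
    then have "regular (zariski_fspace U C) {x \<in> topspace (space_top (zariski_fspace U C)). \<pi> x \<in> V} (\<lambda>x. h (\<pi> x) $ i)"
      by (intro \<pi>[unfolded regular_map_def, THEN conjunct2, rule_format] conjI V)
    then show ?thesis unfolding zariski_fspace_def by simp
  qed
  \<comment> \<open>On a good \<open>W\<close> all coordinates of the chart are quotients of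
    polynomials simultaneously.\<close>
  let ?good = "\<lambda>W p q. \<forall>i<n. p i \<in> polyfun C \<and> q i \<in> polyfun C \<and> (\<forall>y\<in>W. q i y \<noteq> 0 \<and> h (\<pi> y) $ i = p i y / q i y)"
  let ?\<W> = "{W. openin (zariski U C) W \<and> W \<subseteq> ?U' \<and> (\<exists>p q. ?good W p q)}"
  have "\<exists>\<F>\<subseteq>?\<W>. finite \<F> \<and> \<Union>\<F> = \<Union>?\<W>"
    by (rule finite_subcover[OF C, of _ U]) simp
  then obtain \<F> where \<F>: "\<F> \<subseteq> ?\<W>" "finite \<F>" "\<Union>\<F> = \<Union>?\<W>"
    by (elim exE conjE)
  have "?U' \<subseteq> \<Union>?\<W>"
  proof
    fix x assume x: "x \<in> ?U'"
    have "\<exists>W p q. openin (zariski U C) W \<and> x \<in> W \<and> W \<subseteq> ?U' \<and> ?good W p q"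
      by (rule regular_local_quotients[where n = n and f = "\<lambda>i x. h (\<pi> x) $ i", OF reg U' x])
    then obtain W p q where "openin (zariski U C) W" "x \<in> W" "W \<subseteq> ?U'" "?good W p q"
      by (elim exE conjE)
    then show "x \<in> \<Union>?\<W>" by (intro UnionI[of W] CollectI conjI exI)
  qed
  moreover have "\<Union>\<F> \<subseteq> ?U'" using \<F>(1) by (intro Union_least) (drule subsetD, assumption, simp)
  ultimately have cover: "\<Union>\<F> = ?U'" unfolding \<F>(3) by (intro equalityI)
  have "constr (carrier_vec n) (vec_coords n) {v\<in>carrier_vec n. \<exists>x\<in>S \<inter> W. v = h (\<pi> x)}" if W: "W \<in> \<F>" for W
  proof -
    obtain p q where WU: "openin (zariski U C) W" "W \<subseteq> ?U'" and pq: "?good W p q"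
      using subsetD[OF \<F>(1) W] unfolding mem_Collect_eq by (elim exE conjE)
    have "constr U C W" using constructible_in.opn[OF WU(1)] unfolding constructible_in_zariski[OF C] .
    then have SW: "constr X C (S \<inter> W)" by (intro constr.int S(1) constr_subspace[OF _ U])
    have "constr (carrier_vec n) (vec_coords n) {v\<in>carrier_vec n. \<exists>x\<in>S \<inter> W. \<forall>i<n. q i x * v $ i = p i x}"
      by (rule constr_image_rational_map[OF closed SW \<Theta>]) (use pq in auto)
    moreover have "(\<forall>i<n. q i x * v $ i = p i x) \<longleftrightarrow> v = h (\<pi> x)" if v: "v \<in> carrier_vec n" and x: "x \<in> W" for v x
    proof -
      have "h (\<pi> x) \<in> carrier_vec n" using x WU(2) hZ Zn by auto
      then have "v = h (\<pi> x) \<longleftrightarrow> (\<forall>i<n. v $ i = h (\<pi> x) $ i)" using v by (auto simp: vec_eq_iff)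
      also have "\<dots> \<longleftrightarrow> (\<forall>i<n. q i x * v $ i = p i x)"
      proof -
        have "v $ i = h (\<pi> x) $ i \<longleftrightarrow> q i x * v $ i = p i x" if "i < n" for i
        proof -
          have q: "q i x \<noteq> 0" and hpq: "h (\<pi> x) $ i = p i x / q i x" using pq that x by auto
          show ?thesis unfolding hpq by (simp add: nonzero_eq_divide_eq[OF q] mult.commute)
        qed
        then show ?thesis by simp
      qed
      finally show ?thesis ..
    qed
    then have "{v\<in>carrier_vec n. \<exists>x\<in>S \<inter> W. \<forall>i<n. q i x * v $ i = p i x} = {v\<in>carrier_vec n. \<exists>x\<in>S \<inter> W. v = h (\<pi> x)}"
      by (intro Collect_cong conj_cong bex_cong refl) simp
    ultimately show ?thesis by (simp only:)
  qed
  then have "constr (carrier_vec n) (vec_coords n) {v\<in>carrier_vec n. \<exists>W\<in>\<F>. \<exists>x\<in>S \<inter> W. v = h (\<pi> x)}"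
    by (rule constr_Bex[OF \<F>(2)])
  from constr_restrict[OF this Zn]
  have "constructible_in ?Z (Z \<inter> {v\<in>carrier_vec n. \<exists>W\<in>\<F>. \<exists>x\<in>S \<inter> W. v = h (\<pi> x)})" (is "constructible_in _ ?T")
    by (rule constr_imp_constructible_in)
  from constructible_in_vimage[OF this h_cont]
  have "constructible_in ?V {m\<in>V. h m \<in> ?T}" unfolding top_V .
  then have "constructible_in (space_top M) {m\<in>V. h m \<in> ?T}" by (rule constructible_in_open_subspace[OF _ V])
  \<comment> \<open>\<open>h\<close> is injective on \<open>V\<close>, so membership in the image
    can be tested after applying \<open>h\<close>.\<close>
  moreover have "{m\<in>V. h m \<in> ?T} = V \<inter> \<pi> ` S"
  proof (intro equalityI subsetI)
    fix m assume "m \<in> {m\<in>V. h m \<in> ?T}"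
    then obtain W x where *: "m \<in> V" "W \<in> \<F>" "x \<in> S" "x \<in> W" "h m = h (\<pi> x)" by auto
    then have "\<pi> x \<in> V" using cover by auto
    then have "m = \<pi> x" using h_inj * by simp
    then show "m \<in> V \<inter> \<pi> ` S" using * by auto
  next
    fix m assume "m \<in> V \<inter> \<pi> ` S"
    then obtain x where x: "m \<in> V" "x \<in> S" "m = \<pi> x" by auto
    then have "x \<in> \<Union>\<F>" using S(2) cover by auto
    then obtain W where "W \<in> \<F>" "x \<in> W" by auto
    then show "m \<in> {m\<in>V. h m \<in> ?T}" using x hZ Zn by auto
  qed
  ultimately show ?thesis by simp
qed

section \<open>Coordinates of the representation space and transfer to the moduli space\<close>

lemma finite_rep_index:
  fixes \<alpha> :: "nat \<Rightarrow> nat"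
  assumes "quiver Q"
  shows "finite (SIGMA a:arcs Q. {..<\<alpha> (head Q a)} \<times> {..<\<alpha> (tail Q a)})"
  using quiverD(1)[OF assms] by auto

lemma finite_rep_coords:
  assumes "quiver Q"
  shows "finite (rep_coords Q \<alpha> :: ((nat \<Rightarrow> 'k mat) \<Rightarrow> 'k) set)"
proof -
  have "(rep_coords Q \<alpha> :: ((nat \<Rightarrow> 'k mat) \<Rightarrow> 'k) set) = (\<lambda>(a, i, j) \<phi>. \<phi> a $$ (i, j)) ` (SIGMA a:arcs Q. {..<\<alpha> (head Q a)} \<times> {..<\<alpha> (tail Q a)})"
    unfolding rep_coords_def by (auto simp: image_def)
  then show ?thesis using finite_rep_index[OF assms] by simp
qed

text \<open>An enumeration of the matrix entries identifies the representation space with an affine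
  space whose dimension is their number; further variables are ignored.\<close>

lemma rep_space_parametrization:
  assumes Q: "quiver Q"
  shows "\<exists>(\<Theta> :: (nat \<Rightarrow> 'k::field) \<Rightarrow> nat \<Rightarrow> 'k mat) D. polynomial_map UNIV env_coords (rep_coords Q \<alpha>) \<Theta> \<and>
    range \<Theta> = rep_space Q \<alpha> \<and> (\<forall>u w. (\<forall>i<D. u i = w i) \<longrightarrow> \<Theta> u = \<Theta> w)"
proof -
  let ?I = "SIGMA a:arcs Q. {..<\<alpha> (head Q a)} \<times> {..<\<alpha> (tail Q a)}"
  obtain e where e: "bij_betw e ?I {0..<card ?I}" using ex_bij_betw_finite_nat[OF finite_rep_index[OF Q]] by auto
  define \<Theta> where "\<Theta> = (\<lambda>(w :: nat \<Rightarrow> 'k). \<lambda>a\<in>arcs Q. mat (\<alpha> (head Q a)) (\<alpha> (tail Q a)) (\<lambda>(i, j). w (e (a, i, j))))"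
  have "polynomial_map UNIV env_coords (rep_coords Q \<alpha>) \<Theta>"
    unfolding polynomial_map_def
  proof
    fix c :: "(nat \<Rightarrow> 'k mat) \<Rightarrow> 'k" assume "c \<in> rep_coords Q \<alpha>"
    then obtain a i j where c: "c = (\<lambda>\<phi>. \<phi> a $$ (i, j))" "a \<in> arcs Q" "i < \<alpha> (head Q a)" "j < \<alpha> (tail Q a)"
      unfolding rep_coords_def by auto
    then have "c (\<Theta> w) = w (e (a, i, j))" for w unfolding \<Theta>_def by simp
    then show "\<exists>f\<in>polyfun env_coords. \<forall>w\<in>UNIV. c (\<Theta> w) = f w"
      by (intro bexI[OF _ env_coord[of "e (a, i, j)"]]) simp
  qed
  moreover have "range \<Theta> = rep_space Q \<alpha>"
  proof (intro equalityI subsetI)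
    fix \<phi> assume "\<phi> \<in> range \<Theta>"
    then show "\<phi> \<in> rep_space Q \<alpha>" unfolding \<Theta>_def rep_space_def by auto
  next
    fix \<phi> :: "nat \<Rightarrow> 'k mat" assume \<phi>: "\<phi> \<in> rep_space Q \<alpha>"
    define w where "w k = (case inv_into ?I e k of (a, i, j) \<Rightarrow> \<phi> a $$ (i, j))" for k
    have w: "w (e (a, i, j)) = \<phi> a $$ (i, j)" if "a \<in> arcs Q" "i < \<alpha> (head Q a)" "j < \<alpha> (tail Q a)" for a i j
    proof -
      have "inv_into ?I e (e (a, i, j)) = (a, i, j)"
        using that by (intro inv_into_f_f[OF bij_betw_imp_inj_on[OF e]]) auto
      then show ?thesis unfolding w_def by simp
    qed
    have "\<Theta> w = \<phi>"
    proof
      fix a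
      show "\<Theta> w a = \<phi> a"
      proof (cases "a \<in> arcs Q")
        case True
        then have "\<phi> a \<in> carrier_mat (\<alpha> (head Q a)) (\<alpha> (tail Q a))" using \<phi> unfolding rep_space_def by auto
        then show ?thesis unfolding \<Theta>_def using True w[OF True] by (intro eq_matI) auto
      next
        case False
        then show ?thesis using \<phi> unfolding \<Theta>_def rep_space_def by (auto simp: PiE_def extensional_def)
      qed
    qed
    then show "\<phi> \<in> range \<Theta>" by auto
  qed
  moreover have "\<Theta> u = \<Theta> w" if uw: "\<forall>i<card ?I. u i = w i" for u w
  proof -
    have "u (e (a, i, j)) = w (e (a, i, j))" if "a \<in> arcs Q" "i < \<alpha> (head Q a)" "j < \<alpha> (tail Q a)" for a i j
    proof -
      have "e (a, i, j) \<in> {0..<card ?I}" using that by (intro bij_betwE[OF e, THEN bspec]) auto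
      then show ?thesis using uw by simp
    qed
    then show ?thesis unfolding \<Theta>_def by (intro restrict_ext cong_mat refl) auto
  qed
  ultimately show ?thesis by blast
qed

text \<open>The two alternatives of \<open>geometric_quotient\<close> need different arguments: in
  the first one the image is computed chart by chart, in the second one the quotient topology is
  combined with saturation.\<close>

lemma constructible_image_geometric_quotient:
  fixes U :: "(nat \<Rightarrow> 'k::field mat) set" and M :: "('m, 'k) fspace"
  assumes Q: "quiver Q" and U: "constructible_in (zariski (rep_space Q \<alpha>) (rep_coords Q \<alpha>)) U"
    and quot: "geometric_quotient Q \<alpha> U M \<pi>"
    and S: "constr (rep_space Q \<alpha>) (rep_coords Q \<alpha>) S" "saturated U \<pi> S"
  shows "constructible_in (space_top M) (\<pi> ` S)"
proof -
  let ?X = "rep_space Q \<alpha> :: (nat \<Rightarrow> 'k mat) set" and ?C = "rep_coords Q \<alpha> :: ((nat \<Rightarrow> 'k mat) \<Rightarrow> 'k) set"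
  note C = finite_rep_coords[OF Q, of \<alpha>, where 'k = 'k]
  have cU: "constr ?X ?C U" using U unfolding constructible_in_zariski[OF C] .
  have SU: "S \<subseteq> U" using S(2) unfolding saturated_def by simp
  have var: "variety M" and \<pi>: "regular_map (zariski_fspace U ?C) M \<pi>" and surj: "\<pi> ` U = topspace (space_top M)"
    and fibre: "\<And>\<phi>. \<phi> \<in> U \<Longrightarrow> {\<psi>\<in>U. \<pi> \<psi> = \<pi> \<phi>} = GL_orbit Q \<alpha> \<phi>"
    using quot unfolding geometric_quotient_def by auto
  have "root_closed TYPE('k) \<or> quotient_map (zariski U ?C) (space_top M) \<pi>"
    using quot unfolding geometric_quotient_def root_closed_def by simp
  then show ?thesis
  proof
    assume closed: "root_closed TYPE('k)"
    have "\<exists>\<A>. finite \<A> \<and> (\<forall>c\<in>\<A>. affine_chart M c) \<and> (\<Union>(V, n, h)\<in>\<A>. V) = topspace (space_top M)"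
      using conjunct2[OF var[unfolded variety_def]] by (rule ex_forward) (elim conjE, intro conjI)
    then obtain \<A> where *: "finite \<A> \<and> (\<forall>c\<in>\<A>. affine_chart M c) \<and> (\<Union>(V, n, h)\<in>\<A>. V) = topspace (space_top M)" ..
    note \<A> = *[THEN conjunct1] *[THEN conjunct2, THEN conjunct1] *[THEN conjunct2, THEN conjunct2]
    obtain \<Theta> :: "(nat \<Rightarrow> 'k) \<Rightarrow> nat \<Rightarrow> 'k mat" and D where \<Theta>: "polynomial_map UNIV env_coords ?C \<Theta>" "range \<Theta> = ?X"
      "\<forall>u w. (\<forall>i<D. u i = w i) \<longrightarrow> \<Theta> u = \<Theta> w" using rep_space_parametrization[OF Q, of \<alpha>] by (elim exE conjE)
    have "constructible_in (space_top M) (fst c \<inter> \<pi> ` S)" if c: "c \<in> \<A>" for c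
    proof -
      obtain V n h where Vnh: "c = (V, n, h)" by (cases c)
      have "affine_chart M (V, n, h)" using \<A>(2) c Vnh by simp
      then obtain Z where "openin (space_top M) V" "closedin (zariski (carrier_vec n) (vec_coords n)) Z"
        "fspace_iso (restrict_fspace M V) (zariski_fspace Z (vec_coords n)) h"
        unfolding affine_chart_def by auto
      from constructible_image_chart[OF closed C cU S(1) SU \<Theta>(1,2) _ \<pi> this, of D]
      show ?thesis using \<Theta>(3) Vnh by simp
    qed
    then have "constructible_in (space_top M) (\<Union>c\<in>\<A>. fst c \<inter> \<pi> ` S)" by (intro constructible_in_UN \<A>(1))
    moreover have "(\<Union>c\<in>\<A>. fst c \<inter> \<pi> ` S) = \<pi> ` S"
    proof -
      have "(\<Union>c\<in>\<A>. fst c) = topspace (space_top M)" using \<A>(3) by (simp add: case_prod_unfold)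
      moreover have "\<pi> ` S \<subseteq> topspace (space_top M)" using surj SU by auto
      ultimately show ?thesis by auto
    qed
    ultimately show ?thesis by simp
  next
    assume q: "quotient_map (zariski U ?C) (space_top M) \<pi>"
    have UX: "U \<subseteq> ?X" by (rule constr_subset[OF cU])
    have "constr U ?C S" using constr_restrict[OF S(1) UX] SU by (simp add: Int_absorb1)
    then show ?thesis
      by (intro constructible_image_quotient_map[OF C q saturated_closure[OF Q UX fibre] constr_imp_constructible_in S(2)])
  qed
qed

lemma constructible_in_sum_topology:
  assumes "constructible_in (X i) S" "i \<in> I"
  shows "constructible_in (sum_topology X I) (Pair i ` S)"
  using assms(1)
proof induction
  case (opn S)
  then have "openin (sum_topology X I) (Pair i ` S)"
    using open_map_component_injection[OF assms(2), of X] unfolding open_map_def by simp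
  then show ?case by (rule constructible_in.opn)
next
  case (cls S)
  then have "closedin (sum_topology X I) (Pair i ` S)"
    using closed_map_component_injection[OF assms(2), of X] unfolding closed_map_def by simp
  then show ?case by (rule constructible_in.cls)
next
  case (un A B)
  then show ?case by (simp add: image_Un constructible_in.un)
next
  case (int A B)
  then show ?case by (simp add: image_Int inj_on_def constructible_in.int)
qed

theorem corollary16:
  fixes Q :: quiver
    and \<alpha> :: "nat \<Rightarrow> nat"
    and \<U> :: "(nat \<Rightarrow> 'k::field mat) set set"
    and M :: "(nat \<Rightarrow> 'k mat) set \<Rightarrow> ('m, 'k) fspace"
    and \<pi> :: "(nat \<Rightarrow> 'k mat) set \<Rightarrow> (nat \<Rightarrow> 'k mat) \<Rightarrow> 'm"
    and r :: "'k rep \<Rightarrow> nat"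
  assumes "quiver Q"
    and "indecomposable_moduli Q \<alpha> \<U> M \<pi>"
    and "rank_function Q r"
  shows "\<exists>\<rho>. induced_on_moduli \<alpha> \<U> \<pi> r \<rho> \<and>
    constructible_function (moduli_topology \<U> M) \<rho>"
proof -
  let ?X = "rep_space Q \<alpha> :: (nat \<Rightarrow> 'k mat) set" and ?C = "rep_coords Q \<alpha> :: ((nat \<Rightarrow> 'k mat) \<Rightarrow> 'k) set"
  let ?f = "\<lambda>\<phi>. r (point_rep \<alpha> \<phi>)"
  have fin: "finite \<U>"
    and U: "\<And>U. U \<in> \<U> \<Longrightarrow> constructible_in (zariski ?X ?C) U"
    and quot: "\<And>U. U \<in> \<U> \<Longrightarrow> geometric_quotient Q \<alpha> U (M U) (\<pi> U)"
    using assms(2) unfolding indecomposable_moduli_def by auto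
  have UX: "U \<subseteq> ?X" if "U \<in> \<U>" for U using constructible_in_subset[OF U[OF that]] by simp
  have fibre: "\<And>\<phi>. \<phi> \<in> U \<Longrightarrow> {\<psi>\<in>U. \<pi> U \<psi> = \<pi> U \<phi>} = GL_orbit Q \<alpha> \<phi>"
    and surj: "\<pi> U ` U = topspace (space_top (M U))" if "U \<in> \<U>" for U
    using quot[OF that] unfolding geometric_quotient_def by auto
  \<comment> \<open>The tautological family: each point of the representation space parametrizes
    itself.\<close>
  have "polyrep Q \<alpha> ?X ?C (\<lambda>\<phi>. \<phi>)"
    unfolding polyrep_def polymat_def
  proof (intro ballI conjI allI impI)
    fix a i j assume "a \<in> arcs Q" "i < \<alpha> (head Q a)" "j < \<alpha> (tail Q a)"
    then have "(\<lambda>\<phi>. \<phi> a $$ (i, j)) \<in> polyfun ?C" unfolding rep_coords_def by (intro polyfun.coord) auto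
    then show "\<exists>f\<in>polyfun ?C. \<forall>\<phi>\<in>?X. \<phi> a $$ (i, j) = f \<phi>" by (intro bexI[of _ "\<lambda>\<phi>. \<phi> a $$ (i, j)"]) auto
  qed (auto simp: rep_space_def)
  from rank_function_constr_fun[OF assms(3) this]
  have f: "finite (?f ` ?X)" "\<And>n. constr ?X ?C {\<phi>\<in>?X. ?f \<phi> = n}" unfolding constr_fun_def by auto
  have inv: "?f \<psi> = ?f \<phi>" if "U \<in> \<U>" "\<phi> \<in> U" "\<psi> \<in> U" "\<pi> U \<psi> = \<pi> U \<phi>" for U \<phi> \<psi>
  proof -
    have "\<psi> \<in> {\<psi>\<in>U. \<pi> U \<psi> = \<pi> U \<phi>}" using that by simp
    then have "\<psi> \<in> GL_orbit Q \<alpha> \<phi>" unfolding fibre[OF that(1,2)] .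
    then obtain g where g: "g \<in> GL Q \<alpha>" "\<psi> = GL_act Q \<alpha> g \<phi>" unfolding GL_orbit_def by auto
    have "\<phi> \<in> ?X" using UX[OF that(1)] that(2) by auto
    from rank_function_base_change[OF assms(3) GL_base_change[OF assms(1) this g(1)]]
    show ?thesis using g(2) by simp
  qed
  \<comment> \<open>The value is read off at an arbitrary point of the fibre; \<open>inv\<close>
    makes the choice immaterial.\<close>
  define \<rho> where "\<rho> = (\<lambda>(U, m). int (?f (SOME \<phi>. \<phi> \<in> U \<and> \<pi> U \<phi> = m)))"
  have \<rho>: "\<rho> (U, \<pi> U \<phi>) = int (?f \<phi>)" if "U \<in> \<U>" "\<phi> \<in> U" for U \<phi>
  proof -
    have "\<exists>\<psi>. \<psi> \<in> U \<and> \<pi> U \<psi> = \<pi> U \<phi>" using that(2) by auto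
    from someI_ex[OF this] show ?thesis unfolding \<rho>_def using inv[OF that] by simp
  qed
  let ?T = "sum_topology (\<lambda>U. space_top (M U)) \<U>"
  have top: "topspace ?T = (SIGMA U:\<U>. \<pi> U ` U)" unfolding topspace_sum_topology by (intro Sigma_cong refl) (simp add: surj)
  have "finite (\<rho> ` topspace ?T)"
  proof (rule finite_subset)
    show "\<rho> ` topspace ?T \<subseteq> int ` ?f ` ?X"
    proof
      fix k assume "k \<in> \<rho> ` topspace ?T"
      then obtain U \<phi> where U\<phi>: "U \<in> \<U>" "\<phi> \<in> U" "k = \<rho> (U, \<pi> U \<phi>)" unfolding top by auto
      have "\<phi> \<in> ?X" using UX[OF U\<phi>(1)] U\<phi>(2) by auto
      then show "k \<in> int ` ?f ` ?X" unfolding U\<phi>(3) \<rho>[OF U\<phi>(1,2)] by (intro imageI)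
    qed
    show "finite (int ` ?f ` ?X)" using f(1) by simp
  qed
  moreover have "constructible_in ?T {x\<in>topspace ?T. \<rho> x = n}" for n
  proof -
    \<comment> \<open>\<open>r\<close> has natural values and \<open>\<rho>\<close> integer ones:
      \<open>nat n\<close> names the right level only for \<open>0 \<le> n\<close>, and negative
      levels are empty.\<close>
    let ?S = "\<lambda>U. U \<inter> {\<phi>\<in>?X. ?f \<phi> = nat n}"
    have level: "constructible_in (space_top (M U)) (\<pi> U ` ?S U)" if "U \<in> \<U>" for U
    proof (rule constructible_image_geometric_quotient[OF assms(1) U[OF that] quot[OF that]])
      have "constr ?X ?C U" using U[OF that] unfolding constructible_in_zariski[OF finite_rep_coords[OF assms(1)]] .
      then show "constr ?X ?C (?S U)" by (rule constr.int[OF _ f(2)])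
      show "saturated U (\<pi> U) (?S U)" unfolding saturated_def
      proof (intro conjI ballI impI)
        fix \<phi> \<psi> assume *: "\<phi> \<in> ?S U" "\<psi> \<in> U" "\<pi> U \<psi> = \<pi> U \<phi>"
        then have "?f \<psi> = ?f \<phi>" by (intro inv[OF that]) auto
        then show "\<psi> \<in> ?S U" using * UX[OF that] by auto
      qed simp
    qed
    show ?thesis
    proof (cases "0 \<le> n")
      case True
      have "{x\<in>topspace ?T. \<rho> x = n} = (\<Union>U\<in>\<U>. Pair U ` \<pi> U ` ?S U)"
      proof (intro equalityI subsetI)
        fix x assume "x \<in> {x\<in>topspace ?T. \<rho> x = n}"
        then obtain U \<phi> where U\<phi>: "U \<in> \<U>" "\<phi> \<in> U" "x = (U, \<pi> U \<phi>)" "\<rho> x = n" unfolding top by auto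
        have "\<phi> \<in> ?S U" using UX[OF U\<phi>(1)] U\<phi>(2,4) \<rho>[OF U\<phi>(1,2)] unfolding U\<phi>(3) by auto
        then show "x \<in> (\<Union>U\<in>\<U>. Pair U ` \<pi> U ` ?S U)" unfolding U\<phi>(3) by (intro UN_I[OF U\<phi>(1)] imageI)
      next
        fix x assume "x \<in> (\<Union>U\<in>\<U>. Pair U ` \<pi> U ` ?S U)"
        then obtain U \<phi> where U\<phi>: "U \<in> \<U>" "\<phi> \<in> ?S U" "x = (U, \<pi> U \<phi>)" by auto
        then show "x \<in> {x\<in>topspace ?T. \<rho> x = n}" unfolding top using \<rho>[OF U\<phi>(1), of \<phi>] True by auto
      qed
      then show ?thesis
        using level by (auto intro!: constructible_in_UN[OF fin] constructible_in_sum_topology)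
    next
      case False
      have "{x\<in>topspace ?T. \<rho> x = n} = {}" unfolding top using \<rho> False by auto
      then show ?thesis using constructible_in.opn[of ?T "{}"] by (simp only: openin_empty)
    qed
  qed
  ultimately have "constructible_function (moduli_topology \<U> M) \<rho>"
    unfolding constructible_function_def moduli_topology_def by simp
  moreover have "induced_on_moduli \<alpha> \<U> \<pi> r \<rho>" unfolding induced_on_moduli_def using \<rho> by simp
  ultimately show ?thesis by (intro exI[of _ \<rho>] conjI)
qed

end
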